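(* Let $\{S_n\}_{n\in \mathbb{N}}$ be a family of sets with $S_n\subseteq\{0,1\}^n$ such that $xc_{SDP}(S_n) \in \Omega\left( 2^{f_n}\right)$ for some sequence $f_n$ satisfying \[\liminf_{n\rightarrow \infty }\frac{\log n}{f_n} < 1.\] Consider a sequence $\{\omega_n\}_{n \in \mathbb{N}}$ with $\omega_n\leq n-1$ for all $n \in \mathbb{N}$. Then there exists a family of sets $\{S'_n\}_{n \in \mathbb{N}}$, $S'_n \subseteq \{0,1\}^n$, such that \[tw(S'_n) \leq \omega_n + 1 \quad \text{and}\quad xc_{SDP}(S'_n)\in \Omega \left( \frac{n}{\omega_n + 1}\, 2^{f_{\omega_n}}\right). \] Moreover, $\mathrm{conv}(S_n')$ is a pyramid and $tw(S'_n) \in \Omega(f_{\omega_n})$.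
   Context: A formulation of $S\subseteq\{0,1\}^n$ is a representation $S=\{x\in\{0,1\}^n : \phi_i(x)=0,\ i\in[m]\}$ with Boolean functions $\phi_i$; its intersection graph has one vertex per variable and an edge between two variables appearing in a common $\phi_i$. The treewidth of a graph $G$ is the least $\omega$ such that $G$ is a subgraph of a chordal graph on the same vertex set with clique number at most $\omega+1$. $tw(S)$ is the smallest treewidth of the intersection graph of any formulation of $S$. $xc_{SDP}(S)$ is the semidefinite extension complexity of $\mathrm{conv}(S)$ (minimum $r$ such that $\mathrm{conv}(S)$ is the projection of an affine slice $\{(x,Y): a_i^Tx+\langle U_i,Y\rangle=b_i,\ i\in I,\ Y\in\mathbb{S}^r_+\}$). A polytope is a pyramid with base $B$ and apex $v$ if it equals $\mathrm{conv}(B\cup\{v\})$ with $v\notin\mathrm{aff}(B)$. $\log$ is base $2$. *)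

theory Defs
  imports "HOL-Analysis.Analysis" "HOL-Library.Function_Algebras" "HOL-Library.Landau_Symbols"
begin

section \<open>Real vectors of varying dimension\<close>

text \<open>
  The dimension varies along the sequences considered, so \<open>\<real>^n\<close> cannot be a type of its own: it is
  the set \<open>Rn n\<close> of real sequences that vanish from index \<open>n\<close> on (coordinates are numbered from 0).
  The pointwise vector space structure makes the library's convex hull, affine hull and
  \<open>polytope\<close> available for all \<open>n\<close> at once; \<open>Rn n\<close> is a linear subspace, so hulls of its subsets
  stay inside it.
\<close>

instantiation "fun" :: (type, scaleR) scaleR
begin

definition scaleR_fun :: "real \<Rightarrow> ('a \<Rightarrow> 'b) \<Rightarrow> 'a \<Rightarrow> 'b" where
  "scaleR_fun c f = (\<lambda>x. c *\<^sub>R f x)"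

instance ..

end

lemma scaleR_fun_apply [simp]: "(c *\<^sub>R f) x = c *\<^sub>R f x"
  by (simp add: scaleR_fun_def)

instance "fun" :: (type, real_vector) real_vector
  by standard (simp_all add: fun_eq_iff scaleR_add_right scaleR_add_left)

definition Rn :: "nat \<Rightarrow> (nat \<Rightarrow> real) set" where
  "Rn n = {x. \<forall>i\<ge>n. x i = 0}"

definition cube :: "nat \<Rightarrow> (nat \<Rightarrow> real) set" where
  "cube n = {x \<in> Rn n. \<forall>i<n. x i \<in> {0, 1}}"

definition is_pyramid :: "'a::real_vector set \<Rightarrow> bool" where
  "is_pyramid P \<longleftrightarrow> (\<exists>B v. polytope B \<and> v \<notin> affine hull B \<and> P = convex hull (B \<union> {v}))"


section \<open>Treewidth of a graph\<close>

text \<open>A finite simple graph is given by its vertex set \<open>V\<close> and a set \<open>E\<close> of two-element edges.\<close>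

definition simple_graph :: "'v set \<Rightarrow> 'v set set \<Rightarrow> bool" where
  "simple_graph V E \<longleftrightarrow> finite V \<and> (\<forall>e\<in>E. e \<subseteq> V \<and> card e = 2)"

definition is_cycle :: "'v set set \<Rightarrow> 'v list \<Rightarrow> bool" where
  "is_cycle E c \<longleftrightarrow> length c \<ge> 3 \<and> distinct c \<and>
     (\<forall>i<length c. {c ! i, c ! (Suc i mod length c)} \<in> E)"

definition has_chord :: "'v set set \<Rightarrow> 'v list \<Rightarrow> bool" where
  "has_chord E c \<longleftrightarrow> (\<exists>i<length c. \<exists>j<length c. i \<noteq> j \<and>
     j \<noteq> Suc i mod length c \<and> i \<noteq> Suc j mod length c \<and> {c ! i, c ! j} \<in> E)"

definition chordal :: "'v set set \<Rightarrow> bool" where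
  "chordal E \<longleftrightarrow> (\<forall>c. is_cycle E c \<and> length c \<ge> 4 \<longrightarrow> has_chord E c)"

definition is_clique :: "'v set \<Rightarrow> 'v set set \<Rightarrow> 'v set \<Rightarrow> bool" where
  "is_clique V E K \<longleftrightarrow> K \<subseteq> V \<and> (\<forall>u\<in>K. \<forall>v\<in>K. u \<noteq> v \<longrightarrow> {u, v} \<in> E)"

definition clique_number :: "'v set \<Rightarrow> 'v set set \<Rightarrow> nat" where
  "clique_number V E = Max (card ` {K. is_clique V E K})"

definition treewidth :: "'v set \<Rightarrow> 'v set set \<Rightarrow> nat" where
  "treewidth V E = (LEAST w. \<exists>F. simple_graph V F \<and> E \<subseteq> F \<and> chordal F \<and>
     clique_number V F \<le> w + 1)"


section \<open>Formulations and the treewidth of a 0/1 set\<close>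

text \<open>
  A Boolean function on \<open>{0,1}^n\<close> is a function with values in \<open>{0,1}\<close> on \<open>cube n\<close>; its values
  elsewhere are irrelevant. A variable appears in it if flipping that variable changes the value
  at some point. Declaring further, inessential, variables to appear would only add edges to the
  intersection graph, so it would not change the minimum in \<open>tw\<close>.
\<close>

definition is_formulation ::
    "nat \<Rightarrow> (nat \<Rightarrow> real) set \<Rightarrow> nat \<Rightarrow> (nat \<Rightarrow> (nat \<Rightarrow> real) \<Rightarrow> nat) \<Rightarrow> bool" where
  "is_formulation n S m \<phi> \<longleftrightarrow>
     (\<forall>i<m. \<forall>x\<in>cube n. \<phi> i x \<in> {0, 1}) \<and> S = {x \<in> cube n. \<forall>i<m. \<phi> i x = 0}"

definition appears_in :: "nat \<Rightarrow> nat \<Rightarrow> ((nat \<Rightarrow> real) \<Rightarrow> nat) \<Rightarrow> bool" where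
  "appears_in n j f \<longleftrightarrow> j < n \<and> (\<exists>x\<in>cube n. f (x(j := 1 - x j)) \<noteq> f x)"

definition intersection_graph ::
    "nat \<Rightarrow> nat \<Rightarrow> (nat \<Rightarrow> (nat \<Rightarrow> real) \<Rightarrow> nat) \<Rightarrow> nat set set" where
  "intersection_graph n m \<phi> =
     {{u, v} | u v. u \<noteq> v \<and> (\<exists>i<m. appears_in n u (\<phi> i) \<and> appears_in n v (\<phi> i))}"

definition tw :: "nat \<Rightarrow> (nat \<Rightarrow> real) set \<Rightarrow> nat" where
  "tw n S = (LEAST w. \<exists>m \<phi>. is_formulation n S m \<phi> \<and>
     w = treewidth {..<n} (intersection_graph n m \<phi>))"


section \<open>Semidefinite extension complexity\<close>

text \<open>Matrices of order \<open>r\<close> are, like vectors, padded with zeros.\<close>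

definition psd_cone :: "nat \<Rightarrow> (nat \<Rightarrow> nat \<Rightarrow> real) set" where
  "psd_cone r = {Y. (\<forall>i j. i \<ge> r \<or> j \<ge> r \<longrightarrow> Y i j = 0) \<and> (\<forall>i j. Y i j = Y j i) \<and>
     (\<forall>z. 0 \<le> (\<Sum>i<r. \<Sum>j<r. z i * Y i j * z j))}"

definition has_sdp_extension :: "nat \<Rightarrow> (nat \<Rightarrow> real) set \<Rightarrow> nat \<Rightarrow> bool" where
  "has_sdp_extension n P r \<longleftrightarrow>
     (\<exists>(m::nat) (a :: nat \<Rightarrow> nat \<Rightarrow> real) (U :: nat \<Rightarrow> nat \<Rightarrow> nat \<Rightarrow> real) (b :: nat \<Rightarrow> real).
        P = {x \<in> Rn n. \<exists>Y\<in>psd_cone r. \<forall>i<m.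
               (\<Sum>j<n. a i j * x j) + (\<Sum>k<r. \<Sum>l<r. U i k l * Y k l) = b i})"

definition xc_SDP :: "nat \<Rightarrow> (nat \<Rightarrow> real) set \<Rightarrow> nat" where
  "xc_SDP n S = (LEAST r. has_sdp_extension n (convex hull S) r)"

end

theory Submission
  imports Defs
begin

text \<open>
  Let \<open>A\<close> be a subset of \<open>{0,1}^w\<close> and \<open>k = n div (w + 1)\<close>. The set \<open>blocks w k A\<close> is the vertex
  set of an iterated join of an apex with \<open>k\<close> copies of \<open>conv A\<close>; each block of \<open>w\<close> coordinates
  gets one further coordinate, and the further coordinates form a nonincreasing chain. Its
  constraints only link neighbouring blocks, so an interval graph with clique number \<open>w + 2\<close>
  carries them, and the apex makes the convex hull a pyramid. Semidefinite extension complexity is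
  superadditive under joins: the matrices feasible over one face \<open>F\<close> share a kernel \<open>K\<close>; a
  complement of \<open>K\<close> suffices for \<open>F\<close>, and the restriction of all feasible matrices to \<open>K\<close> gives
  an extension of the opposite face.

  For \<open>A = S w\<close> this yields the bound on the extension complexity, but the treewidth may be too
  small: the hypothesis on \<open>log n / f n\<close> only concerns infinitely many \<open>n\<close>. So \<open>S w\<close> is replaced if
  its treewidth is at most about \<open>log w\<close>. Then some clique of a chordal supergraph separates a
  medium sized piece, the extension complexity is subadditive along this separation, and the better
  of the two sides, tagged by indicator variables for the patterns on the clique, leaves a constant
  fraction of the \<open>w\<close> coordinates free. On these a cube without one vertex is placed, which
  forces treewidth linear in \<open>w\<close>. If the treewidth of \<open>S w\<close> is larger, the junction tree bound
  \<open>2 * w * 2 ^ (tw + 1)\<close> on the extension complexity shows that it is of order \<open>f w\<close>.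
\<close>

section \<open>Quadratic forms\<close>

text \<open>The delicate point in superadditivity is that a matrix feasible for the restricted lift
  is only known to be nonnegative on \<open>K\<close>. A lift of least order has a positive definite
  feasible matrix, because a kernel vector common to all feasible matrices would permit a smaller
  lift. Mixing in a little of that matrix gives positivity on \<open>K\<close> minus the origin. By
  Finsler's lemma, adding a large multiple of a matrix over \<open>F\<close> with kernel exactly
  \<open>K\<close> then gives positivity everywhere, and averaging with a point of \<open>F\<close>
  changes the projected point only by a scalar. The perturbation vanishes in the limit because
  polytopes are closed. Subadditivity along a separation rests on tagging points by point masses:
  the tag component of a convex combination is the distribution of the pattern on the clique, and
  two distributions with the same pattern marginal can be coupled independently given the pattern. A
  single point has a lift of order 0, so each join is also shown to cost at least 1. This yields a
  bound linear in \<open>k\<close> even for the finitely many \<open>w\<close> below the range of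
  the asymptotic hypothesis.\<close>

definition bilin :: "nat \<Rightarrow> (nat \<Rightarrow> nat \<Rightarrow> real) \<Rightarrow> (nat \<Rightarrow> real) \<Rightarrow> (nat \<Rightarrow> real) \<Rightarrow> real" where
  "bilin r Y u v = (\<Sum>i<r. \<Sum>j<r. u i * Y i j * v j)"

definition sym_mats :: "nat \<Rightarrow> (nat \<Rightarrow> nat \<Rightarrow> real) set" where
  "sym_mats r = {Y. (\<forall>i j. i \<ge> r \<or> j \<ge> r \<longrightarrow> Y i j = 0) \<and> (\<forall>i j. Y i j = Y j i)}"

text \<open>The matrix of the form \<open>Y\<close> on the system \<open>g\<close>, that is, a
  congruence. Extraction of a diagonal block, embedding as a block and restriction to a subspace are
  all of this shape, so \<open>gram_psd\<close> serves for each of them.\<close>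

definition gram :: "nat \<Rightarrow> nat \<Rightarrow> (nat \<Rightarrow> nat \<Rightarrow> real) \<Rightarrow> (nat \<Rightarrow> nat \<Rightarrow> real) \<Rightarrow> nat \<Rightarrow> nat \<Rightarrow> real" where
  "gram r m g Y = (\<lambda>a b. if a < m \<and> b < m then bilin r Y (g a) (g b) else 0)"

lemma psd_cone_iff: "Y \<in> psd_cone r \<longleftrightarrow> Y \<in> sym_mats r \<and> (\<forall>z. 0 \<le> bilin r Y z z)"
  by (auto simp: psd_cone_def sym_mats_def bilin_def)

lemma bilin_add_left: "bilin r Y (\<lambda>i. u i + v i) w = bilin r Y u w + bilin r Y v w"
  and bilin_add_right: "bilin r Y w (\<lambda>i. u i + v i) = bilin r Y w u + bilin r Y w v"
  and bilin_scale_left: "bilin r Y (\<lambda>i. c * u i) w = c * bilin r Y u w"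
  and bilin_scale_right: "bilin r Y w (\<lambda>i. c * u i) = c * bilin r Y w u"
  by (simp_all add: bilin_def algebra_simps sum.distrib sum_distrib_left)

lemma bilin_zero_left [simp]: "bilin r Y (\<lambda>i. 0) w = 0"
  and bilin_zero_right [simp]: "bilin r Y w (\<lambda>i. 0) = 0"
  by (simp_all add: bilin_def)

lemma bilin_add_mat: "bilin r (Y + Z) u v = bilin r Y u v + bilin r Z u v"
  and bilin_scale_mat: "bilin r (c *\<^sub>R Y) u v = c * bilin r Y u v"
  by (simp_all add: bilin_def algebra_simps sum.distrib sum_distrib_left)

lemma bilin_sum_left: "bilin r Y (\<lambda>i. \<Sum>a\<in>A. f a i) w = (\<Sum>a\<in>A. bilin r Y (f a) w)"
proof (cases "finite A")
  case True
  then show ?thesis by (induction A rule: finite_induct) (simp_all add: bilin_add_left)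
qed simp

lemma bilin_sum_right: "bilin r Y w (\<lambda>i. \<Sum>a\<in>A. f a i) = (\<Sum>a\<in>A. bilin r Y w (f a))"
proof (cases "finite A")
  case True
  then show ?thesis by (induction A rule: finite_induct) (simp_all add: bilin_add_right)
qed simp

lemma bilin_commute:
  assumes "Y \<in> sym_mats r"
  shows "bilin r Y u v = bilin r Y v u"
proof -
  have "Y i j = Y j i" for i j using assms by (simp add: sym_mats_def)
  then have "bilin r Y u v = (\<Sum>i<r. \<Sum>j<r. v j * Y j i * u i)"
    unfolding bilin_def by (intro sum.cong refl) (metis mult.commute mult.left_commute)
  then show ?thesis unfolding bilin_def by (subst sum.swap)
qed

lemma bilin_cong: "(\<And>i. i < r \<Longrightarrow> u i = u' i) \<Longrightarrow> (\<And>i. i < r \<Longrightarrow> v i = v' i) \<Longrightarrow>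
    bilin r Y u v = bilin r Y u' v'"
  by (auto simp: bilin_def intro!: sum.cong)

lemma bilin_unit:
  assumes "i < r" "j < r"
  shows "bilin r Y (\<lambda>k. if k = i then 1 else 0) (\<lambda>k. if k = j then 1 else 0) = Y i j"
proof -
  have "bilin r Y (\<lambda>k. if k = i then 1 else 0) (\<lambda>k. if k = j then 1 else 0) =
      (\<Sum>k<r. if k = i then (\<Sum>l<r. if l = j then Y i j else 0) else 0)"
    unfolding bilin_def by (intro sum.cong refl) (simp add: if_distrib[of "\<lambda>c. _ * c"] cong: if_cong)
  then show ?thesis using assms by simp
qed

lemma bilin_gram:
  "bilin m (gram r m g Y) z w = bilin r Y (\<lambda>i. \<Sum>a<m. z a * g a i) (\<lambda>i. \<Sum>a<m. w a * g a i)"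
proof -
  have "bilin r Y (\<lambda>i. \<Sum>a<m. z a * g a i) (\<lambda>i. \<Sum>a<m. w a * g a i)
      = (\<Sum>a<m. \<Sum>b<m. z a * (w b * bilin r Y (g a) (g b)))"
    by (simp add: bilin_sum_left bilin_sum_right bilin_scale_left bilin_scale_right sum_distrib_left)
  then show ?thesis
    unfolding bilin_def[of m] by (simp add: gram_def mult.assoc mult.left_commute mult.commute)
qed

lemma gram_sym:
  assumes "Y \<in> sym_mats r"
  shows "gram r m g Y \<in> sym_mats m"
  using bilin_commute[OF assms] by (auto simp: sym_mats_def gram_def)

lemma gram_psd: "Y \<in> psd_cone r \<Longrightarrow> gram r m g Y \<in> psd_cone m"
  by (simp add: psd_cone_iff gram_sym bilin_gram)

lemma gram_add: "gram r m g (Y + Z) = gram r m g Y + gram r m g Z"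
  and gram_scale: "gram r m g (c *\<^sub>R Y) = c *\<^sub>R gram r m g Y"
  by (auto simp: gram_def fun_eq_iff bilin_add_mat bilin_scale_mat)

text \<open>On the line \<open>w + t * z\<close> the form is affine in \<open>t\<close> with slope
  twice \<open>bilin r Y w z\<close>, and a nonnegative affine function on the whole line is
  constant. The chosen \<open>t\<close> would make the value -1.\<close>

lemma psd_cone_bilin_null:
  assumes Y: "Y \<in> psd_cone r" and z: "bilin r Y z z = 0"
  shows "bilin r Y w z = 0"
proof (rule ccontr)
  assume nz: "bilin r Y w z \<noteq> 0"
  let ?b = "bilin r Y w z" and ?a = "bilin r Y w w"
  define t where "t = - (?a + 1) / (2 * ?b)"
  have "0 \<le> bilin r Y (\<lambda>i. w i + t * z i) (\<lambda>i. w i + t * z i)"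
    using Y by (simp add: psd_cone_iff)
  also have "\<dots> = ?a + 2 * t * ?b"
    using z bilin_commute[of Y r z w] Y
    by (simp add: bilin_add_left bilin_add_right bilin_scale_left bilin_scale_right psd_cone_iff algebra_simps)
  also have "\<dots> = -1" using nz by (simp add: t_def field_simps)
  finally show False by simp
qed

lemma psd_cone_add: "Y \<in> psd_cone r \<Longrightarrow> Z \<in> psd_cone r \<Longrightarrow> Y + Z \<in> psd_cone r"
  by (auto simp: psd_cone_iff bilin_add_mat sym_mats_def)

lemma psd_cone_scale: "Y \<in> psd_cone r \<Longrightarrow> 0 \<le> c \<Longrightarrow> c *\<^sub>R Y \<in> psd_cone r"
  by (auto simp: psd_cone_iff bilin_scale_mat sym_mats_def)

lemma convex_psd_cone: "convex (psd_cone r)"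
  by (rule convexI) (simp add: psd_cone_add psd_cone_scale)

lemma subspace_sym_mats: "subspace (sym_mats r)"
  by (rule subspaceI) (auto simp: sym_mats_def)

section \<open>Lifts\<close>

text \<open>Extensions without coordinates: an affine set replaces the list of equations, and any
  real vector space may hold the projection. Linear images, affine sections and products are then
  immediate; equations return only in \<open>has_sdp_extension_iff_lift\<close>.\<close>

definition sdp_lift :: "'a::real_vector set \<Rightarrow> nat \<Rightarrow> bool" where
  "sdp_lift P r \<longleftrightarrow> (\<exists>D. affine D \<and> P = {x. \<exists>Y\<in>psd_cone r. (x, Y) \<in> D})"

lemma affine_linear_image:
  assumes "linear f" "affine D"
  shows "affine (f ` D)"
  unfolding affine_def
proof (intro ballI allI impI)
  fix x y u v assume "x \<in> f ` D" "y \<in> f ` D" and uv: "u + v = (1::real)"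
  then obtain a b where ab: "a \<in> D" "b \<in> D" "x = f a" "y = f b" by auto
  have "u *\<^sub>R a + v *\<^sub>R b \<in> D" using assms(2) ab uv by (simp add: affine_def)
  moreover have "f (u *\<^sub>R a + v *\<^sub>R b) = u *\<^sub>R x + v *\<^sub>R y"
    using assms(1) ab by (simp add: linear_add linear_scale)
  ultimately show "u *\<^sub>R x + v *\<^sub>R y \<in> f ` D" by (metis imageI)
qed

lemma affine_linear_vimage:
  assumes "linear f" "affine D"
  shows "affine (f -` D)"
  using assms by (simp add: affine_def linear_add linear_scale)

lemma sdp_lift_linear_image:
  assumes f: "linear f" and P: "sdp_lift P r"
  shows "sdp_lift (f ` P) r"
proof -
  obtain D where D: "affine D" "P = {x. \<exists>Y\<in>psd_cone r. (x, Y) \<in> D}" using P by (auto simp: sdp_lift_def)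
  have "linear (\<lambda>p. (f (fst p), snd p))"
    by (rule linearI) (simp_all add: linear_add[OF f] linear_scale[OF f])
  then have "affine ((\<lambda>p. (f (fst p), snd p)) ` D)" using D(1) by (rule affine_linear_image)
  moreover have "f ` P = {x. \<exists>Y\<in>psd_cone r. (x, Y) \<in> (\<lambda>p. (f (fst p), snd p)) ` D}"
    unfolding D(2) by force
  ultimately show ?thesis unfolding sdp_lift_def by blast
qed

lemma sdp_lift_Int_affine:
  assumes A: "affine A" and P: "sdp_lift P r"
  shows "sdp_lift (P \<inter> A) r"
proof -
  obtain D where D: "affine D" "P = {x. \<exists>Y\<in>psd_cone r. (x, Y) \<in> D}" using P by (auto simp: sdp_lift_def)
  have "affine (D \<inter> fst -` A)"
    by (intro affine_Int D affine_linear_vimage linear_fst A)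
  moreover have "P \<inter> A = {x. \<exists>Y\<in>psd_cone r. (x, Y) \<in> D \<inter> fst -` A}"
    unfolding D(2) by auto
  ultimately show ?thesis unfolding sdp_lift_def by blast
qed

text \<open>The diagonal blocks of a psd matrix are psd and the off-diagonal blocks remain
  unconstrained; conversely, two psd matrices form a block diagonal one.\<close>

lemma sdp_lift_Times:
  assumes "sdp_lift P r" "sdp_lift Q s"
  shows "sdp_lift (P \<times> Q) (r + s)"
proof -
  obtain D where D: "affine D" "P = {x. \<exists>Y\<in>psd_cone r. (x, Y) \<in> D}"
    using assms(1) by (auto simp: sdp_lift_def)
  obtain E where E: "affine E" "Q = {x. \<exists>Y\<in>psd_cone s. (x, Y) \<in> E}"
    using assms(2) by (auto simp: sdp_lift_def)
  define unit :: "nat \<Rightarrow> nat \<Rightarrow> real" where "unit = (\<lambda>a k. if k = a then 1 else 0)"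
  define top where "top = gram (r + s) r unit"
  define bot where "bot = gram (r + s) s (\<lambda>a. unit (r + a))"
  have lin: "linear (\<lambda>p::('a \<times> 'b) \<times> (nat \<Rightarrow> nat \<Rightarrow> real). (fst (fst p), top (snd p)))"
            "linear (\<lambda>p::('a \<times> 'b) \<times> (nat \<Rightarrow> nat \<Rightarrow> real). (snd (fst p), bot (snd p)))"
    unfolding top_def bot_def by (rule linearI; simp add: gram_add gram_scale)+
  let ?G = "{p. (fst (fst p), top (snd p)) \<in> D \<and> (snd (fst p), bot (snd p)) \<in> E}"
  have "affine ?G"
    using affine_Int[OF affine_linear_vimage[OF lin(1) D(1)] affine_linear_vimage[OF lin(2) E(1)]]
    by (simp add: vimage_def Int_def)
  moreover have "P \<times> Q = {x. \<exists>Y\<in>psd_cone (r + s). (x, Y) \<in> ?G}"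
  proof (intro set_eqI iffI)
    fix x assume "x \<in> P \<times> Q"
    then obtain Y Z where Y: "Y \<in> psd_cone r" "(fst x, Y) \<in> D" and Z: "Z \<in> psd_cone s" "(snd x, Z) \<in> E"
      unfolding D(2) E(2) by auto
    \<comment> \<open>The block diagonal matrix of \<open>Y\<close> and \<open>Z\<close>, written as
      a sum of two congruences so that \<open>gram_psd\<close> gives positivity.\<close>
    define W where "W = (gram r (r + s) (\<lambda>i a. unit i a) Y) + gram s (r + s) (\<lambda>i a. unit i (r + a)) Z"
    have W: "W \<in> psd_cone (r + s)"
      unfolding W_def using Y Z by (intro psd_cone_add gram_psd)
    have z1: "Y i j = 0" if "i \<ge> r \<or> j \<ge> r" for i j using Y that unfolding psd_cone_def by blast
    have z2: "Z i j = 0" if "i \<ge> s \<or> j \<ge> s" for i j using Z that unfolding psd_cone_def by blast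
    have b1: "bilin r Y (unit i) (unit j) = Y i j" for i j
    proof (cases "i < r \<and> j < r")
      case True
      then have "unit i = (\<lambda>k. if k = i then 1 else 0)" "unit j = (\<lambda>k. if k = j then 1 else 0)"
        by (auto simp: unit_def)
      with True bilin_unit[of i r j Y] show ?thesis by simp
    next
      case False
      have "bilin r Y (unit i) (unit j) = 0"
        using False unfolding bilin_def unit_def by (intro sum.neutral ballI) auto
      with False z1 show ?thesis by (metis not_le)
    qed
    have b2: "bilin s Z (\<lambda>a. unit i (r + a)) (\<lambda>a. unit j (r + a)) =
        (if i \<ge> r \<and> j \<ge> r then Z (i - r) (j - r) else 0)" for i j
    proof (cases "i \<ge> r \<and> j \<ge> r \<and> i < r + s \<and> j < r + s")
      case True
      then have "(\<lambda>a. unit i (r + a)) = (\<lambda>k. if k = i - r then 1 else 0)"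
         "(\<lambda>a. unit j (r + a)) = (\<lambda>k. if k = j - r then 1 else 0)"
        by (auto simp: unit_def fun_eq_iff)
      with True bilin_unit[of "i - r" s "j - r" Z] show ?thesis by (auto simp: less_diff_conv2)
    next
      case False
      have "bilin s Z (\<lambda>a. unit i (r + a)) (\<lambda>a. unit j (r + a)) = 0"
        using False unfolding bilin_def unit_def by (intro sum.neutral ballI) auto
      moreover have "s \<le> i - r \<or> s \<le> j - r" if "i \<ge> r" "j \<ge> r"
        using False that by arith
      ultimately show ?thesis using z2 by auto
    qed
    have Wij: "W i j = (if i < r + s \<and> j < r + s then Y i j + (if i \<ge> r \<and> j \<ge> r then Z (i - r) (j - r) else 0) else 0)" for i j
      by (simp add: W_def gram_def b1 b2)
    have "bilin (r+s) W (unit i) (unit j) = W i j" if "i < r + s" "j < r + s" for i j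
      using bilin_unit[OF that, of W] by (simp add: unit_def)
    then have "top W = Y" "bot W = Z"
      unfolding top_def bot_def gram_def by (auto simp: fun_eq_iff Wij z1 z2 not_less)
    then show "x \<in> {x. \<exists>Y\<in>psd_cone (r + s). (x, Y) \<in> ?G}"
      using W Y Z by auto
  next
    fix x assume "x \<in> {x. \<exists>Y\<in>psd_cone (r + s). (x, Y) \<in> ?G}"
    then obtain W where "W \<in> psd_cone (r + s)" "(fst x, top W) \<in> D" "(snd x, bot W) \<in> E" by auto
    then show "x \<in> P \<times> Q"
      unfolding D(2) E(2) top_def bot_def by (cases x) (auto intro: gram_psd)
  qed
  ultimately show ?thesis unfolding sdp_lift_def by blast
qed

lemma sdp_lift_singleton: "sdp_lift {a} 0"
proof -
  have "(\<lambda>_ _. 0) \<in> psd_cone 0" by (simp add: psd_cone_def)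
  then have "{a} = {x. \<exists>Y\<in>psd_cone 0. (x, Y) \<in> {a} \<times> UNIV}" by auto
  moreover have "affine ({a} \<times> (UNIV :: (nat \<Rightarrow> nat \<Rightarrow> real) set))"
    by (auto simp: affine_def simp flip: scaleR_left_distrib)
  ultimately show ?thesis unfolding sdp_lift_def by blast
qed

lemma sdp_lift_empty: "sdp_lift {} r"
  unfolding sdp_lift_def by (rule exI[of _ "{}"]) simp

text \<open>The diagonal of a psd matrix is nonnegative, so with trace 1 it is a vector of convex
  weights; diagonal matrices realize all weights.\<close>

lemma sdp_lift_convex_hull_finite:
  fixes V :: "'a::real_vector set"
  assumes "finite V"
  shows "sdp_lift (convex hull V) (card V)"
proof -
  obtain h where h: "bij_betw h {..<card V} V"
    using ex_bij_betw_nat_finite[OF assms] by (auto simp: atLeast0LessThan)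
  let ?m = "card V"
  define L where "L = (\<lambda>p::'a \<times> (nat \<Rightarrow> nat \<Rightarrow> real). (fst p - (\<Sum>k<?m. snd p k k *\<^sub>R h k), (\<Sum>k<?m. snd p k k)))"
  have "linear L"
    unfolding L_def
    by (rule linearI) (simp_all add: sum.distrib scaleR_left_distrib scaleR_right_diff_distrib
        scaleR_sum_right sum_distrib_left)
  then have aff: "affine (L -` {(0, 1)})"
    by (intro affine_linear_vimage affine_sing)
  have "convex hull V = {x. \<exists>Y\<in>psd_cone ?m. (x, Y) \<in> L -` {(0, 1)}}"
  proof (intro set_eqI iffI)
    fix x assume "x \<in> convex hull V"
    then obtain u where u: "\<forall>v\<in>V. 0 \<le> u v" "sum u V = 1" "(\<Sum>v\<in>V. u v *\<^sub>R v) = x"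
      unfolding convex_hull_finite[OF assms] by auto
    define Y where "Y = (\<lambda>i j. if i < ?m \<and> i = j then u (h i) else 0)"
    have "bilin ?m Y z z = (\<Sum>i<?m. u (h i) * (z i)\<^sup>2)" for z
      unfolding bilin_def Y_def
      by (intro sum.cong refl) (simp add: if_distrib[of "\<lambda>c. _ * c"] if_distrib[of "\<lambda>c. c * _"] power2_eq_square cong: if_cong)
    then have "Y \<in> psd_cone ?m"
      using u(1) bij_betwE[OF h] unfolding psd_cone_iff
      by (auto simp: sym_mats_def Y_def intro!: sum_nonneg)
    moreover have "(\<Sum>k<?m. Y k k *\<^sub>R h k) = x" "(\<Sum>k<?m. Y k k) = 1"
      using u sum.reindex_bij_betw[OF h, of "\<lambda>v. u v *\<^sub>R v"] sum.reindex_bij_betw[OF h, of u]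
      by (simp_all add: Y_def)
    ultimately show "x \<in> {x. \<exists>Y\<in>psd_cone ?m. (x, Y) \<in> L -` {(0, 1)}}"
      by (auto simp: L_def)
  next
    fix x assume "x \<in> {x. \<exists>Y\<in>psd_cone ?m. (x, Y) \<in> L -` {(0, 1)}}"
    then obtain Y where Y: "Y \<in> psd_cone ?m" and x: "x = (\<Sum>k<?m. Y k k *\<^sub>R h k)" and s: "(\<Sum>k<?m. Y k k) = 1"
      by (auto simp: L_def)
    have "0 \<le> Y k k" if "k < ?m" for k
      using Y bilin_unit[OF that that, of Y] unfolding psd_cone_iff by metis
    then show "x \<in> convex hull V"
      unfolding x using s bij_betwE[OF h]
      by (intro convex_sum convex_convex_hull) (auto intro: hull_inc)
  qed
  with aff show ?thesis unfolding sdp_lift_def by blast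
qed

section \<open>Kernels of feasible matrices and face reduction\<close>

definition unitv :: "nat \<Rightarrow> nat \<Rightarrow> real" where
  "unitv a = (\<lambda>k. if k = a then 1 else 0)"

lemma sum_fun_apply: "(\<Sum>a\<in>A. f a) x = (\<Sum>a\<in>A. f a x)" for f :: "'b \<Rightarrow> 'c \<Rightarrow> real"
proof (cases "finite A")
  case True
  then show ?thesis by (induction A rule: finite_induct) simp_all
qed simp

lemma Rn_eq_span: "Rn r = span (unitv ` {..<r})"
proof
  have "unitv ` {..<r} \<subseteq> Rn r" by (auto simp: Rn_def unitv_def)
  moreover have "subspace (Rn r)" by (rule subspaceI) (auto simp: Rn_def)
  ultimately show "span (unitv ` {..<r}) \<subseteq> Rn r" by (rule span_minimal)
next
  show "Rn r \<subseteq> span (unitv ` {..<r})"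
  proof
    fix x assume "x \<in> Rn r"
    then have "x = (\<Sum>i<r. x i *\<^sub>R unitv i)"
      by (auto simp: fun_eq_iff sum_fun_apply unitv_def Rn_def not_less if_distrib[of "\<lambda>c. _ * c"] cong: if_cong)
    also have "\<dots> \<in> span (unitv ` {..<r})"
      by (intro span_sum span_scale span_base) auto
    finally show "x \<in> span (unitv ` {..<r})" .
  qed
qed

lemma independent_Rn:
  assumes "independent B" "B \<subseteq> Rn r"
  shows "finite B" "card B \<le> r"
proof -
  have "finite B \<and> card B \<le> card (unitv ` {..<r})"
    using assms by (intro independent_span_bound) (auto simp: Rn_eq_span)
  moreover have "card (unitv ` {..<r}) \<le> r" using card_image_le[of "{..<r}" unitv] by simp
  ultimately show "finite B" "card B \<le> r" by auto
qed

lemma Rn_basis_extend: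
  assumes "independent B" "B \<subseteq> Rn r"
  obtains B' where "B \<subseteq> B'" "B' \<subseteq> Rn r" "independent B'" "Rn r \<subseteq> span B'"
  using maximal_independent_subset_extend[OF assms(2,1)] by metis

lemma dim_less_Rn:
  assumes A: "subspace A" "A \<subseteq> V" and V: "V \<subseteq> Rn r" and z: "z \<in> V" "z \<notin> A"
  shows "dim A < dim V"
proof -
  obtain B where B: "B \<subseteq> A" "independent B" "A \<subseteq> span B" "card B = dim A" by (rule basis_exists)
  obtain C where C: "C \<subseteq> V" "independent C" "V \<subseteq> span C" "card C = dim V" by (rule basis_exists)
  have "span B \<subseteq> A" using A B by (intro span_minimal)
  then have zB: "z \<notin> span B" using z by auto
  then have "independent (insert z B)" by (simp add: independent_insert B)
  moreover have "insert z B \<subseteq> span C" using B A C z by auto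
  ultimately have "card (insert z B) \<le> card C"
    using independent_span_bound[of C "insert z B"] independent_Rn(1)[of C r] C V by auto
  moreover have "card (insert z B) = Suc (card B)"
    using zB independent_Rn(1)[of B r] B A V by (metis card_insert_disjoint order_trans span_base)
  ultimately show ?thesis using B C by simp
qed

lemma fun_eq_lambda: "(u::nat \<Rightarrow> real) + v = (\<lambda>i. u i + v i)" "c *\<^sub>R u = (\<lambda>i. c * u i)"
  by auto

lemma bilin_null_span:
  assumes Y: "Y \<in> psd_cone r" and B: "\<And>z. z \<in> B \<Longrightarrow> bilin r Y z z = 0" and k: "k \<in> span B"
  shows "bilin r Y w k = 0"
proof -
  have "subspace {k. \<forall>w. bilin r Y w k = 0}"
    by (rule subspaceI) (simp_all add: fun_eq_lambda bilin_add_right bilin_scale_right zero_fun_def)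
  moreover have "B \<subseteq> {k. \<forall>w. bilin r Y w k = 0}"
    using psd_cone_bilin_null[OF Y] B by auto
  ultimately have "span B \<subseteq> {k. \<forall>w. bilin r Y w k = 0}" by (intro span_minimal)
  then show ?thesis using k by auto
qed

lemma subspace_psd_null:
  assumes Y: "Y \<in> psd_cone r"
  shows "subspace {z \<in> Rn r. bilin r Y z z = 0}"
proof -
  have "subspace {z. \<forall>w. bilin r Y w z = 0}"
    by (rule subspaceI) (simp_all add: fun_eq_lambda bilin_add_right bilin_scale_right zero_fun_def)
  then have "subspace (Rn r \<inter> {z. \<forall>w. bilin r Y w z = 0})"
    by (intro subspace_inter) (simp add: Rn_eq_span)
  moreover have "{z \<in> Rn r. bilin r Y z z = 0} = Rn r \<inter> {z. \<forall>w. bilin r Y w z = 0}"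
    using psd_cone_bilin_null[OF Y] by blast
  ultimately show ?thesis by simp
qed

text \<open>Matrices that vanish on \<open>span B\<close> are determined by their restriction to a complement.\<close>

lemma sdp_lift_face_reduction:
  fixes D :: "('a::real_vector \<times> (nat \<Rightarrow> nat \<Rightarrow> real)) set"
  assumes D: "affine D"
    and B': "B' \<subseteq> Rn r" "independent B'" "Rn r \<subseteq> span B'" and B: "B \<subseteq> B'"
    and null: "\<And>x Y z. Y \<in> psd_cone r \<Longrightarrow> (x, Y) \<in> D \<Longrightarrow> z \<in> B \<Longrightarrow> bilin r Y z z = 0"
  shows "sdp_lift {x. \<exists>Y\<in>psd_cone r. (x, Y) \<in> D} (card (B' - B))"
proof -
  let ?E = "B' - B" let ?m = "card ?E"
  have finE: "finite ?E" using independent_Rn(1)[OF B'(2,1)] by auto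
  obtain e where e: "bij_betw e {..<?m} ?E"
    using ex_bij_betw_nat_finite[OF finE] by (auto simp: atLeast0LessThan)
  have "\<exists>u. \<exists>k\<in>span B. unitv i = (\<lambda>x. \<Sum>a<?m. u a * e a x) + k" if i: "i < r" for i
  proof -
    have "unitv i \<in> Rn r" using i by (auto simp: Rn_def unitv_def)
    then have "unitv i \<in> span (?E \<union> B)" using B' B by (auto simp: Un_absorb2)
    then obtain v k where vk: "unitv i = v + k" "v \<in> span ?E" "k \<in> span B"
      unfolding span_Un by blast
    then obtain u where "v = (\<Sum>b\<in>?E. u b *\<^sub>R b)" using span_finite[OF finE] by auto
    also have "\<dots> = (\<Sum>a<?m. u (e a) *\<^sub>R e a)"
      using sum.reindex_bij_betw[OF e, of "\<lambda>b. u b *\<^sub>R b"] by simp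
    also have "\<dots> = (\<lambda>x. \<Sum>a<?m. u (e a) * e a x)" by (auto simp: fun_eq_iff sum_fun_apply)
    finally show ?thesis using vk by auto
  qed
  then obtain c k where ck: "\<And>i. i < r \<Longrightarrow> k i \<in> span B"
     "\<And>i. i < r \<Longrightarrow> unitv i = (\<lambda>x. \<Sum>a<?m. c i a * e a x) + k i"
    by metis
  \<comment> \<open>The components of the unit vectors in \<open>span B\<close> contribute nothing
    to a feasible form, so \<open>Y\<close> is recovered from its compression to \<open>e\<close> by
    the coefficients \<open>c\<close>.\<close>
  have Yeq: "Y = gram ?m r c (gram r ?m e Y)" if Y: "Y \<in> psd_cone r" "(x, Y) \<in> D" for x Y
  proof -
    have k0: "bilin r Y w (k i) = 0" if "i < r" for w i
      by (rule bilin_null_span[OF Y(1) null[OF Y] ck(1)[OF that]])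
    have k1: "bilin r Y (k i) w = 0" if "i < r" for w i
      using k0[OF that, of w] bilin_commute[of Y r w "k i"] Y by (simp add: psd_cone_iff)
    have "Y i j = gram ?m r c (gram r ?m e Y) i j" for i j
    proof (cases "i < r \<and> j < r")
      case True
      then have "Y i j = bilin r Y (unitv i) (unitv j)" by (simp add: unitv_def bilin_unit)
      also have "\<dots> = bilin r Y (\<lambda>x. \<Sum>a<?m. c i a * e a x) (\<lambda>x. \<Sum>a<?m. c j a * e a x)"
        using True by (simp add: ck(2) fun_eq_lambda(1) bilin_add_left bilin_add_right k0 k1)
      also have "\<dots> = bilin ?m (gram r ?m e Y) (c i) (c j)" by (simp add: bilin_gram)
      finally show ?thesis using True by (simp add: gram_def[of ?m r])
    next
      case False
      then have "Y i j = 0" using Y unfolding psd_cone_def by auto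
      moreover have "gram ?m r c (gram r ?m e Y) i j = 0"
        unfolding gram_def[of ?m r] using False by (rule if_not_P)
      ultimately show ?thesis by (rule trans[OF _ sym])
    qed
    then show ?thesis by (simp add: fun_eq_iff)
  qed
  let ?G = "{p. (fst p, gram ?m r c (snd p)) \<in> D}"
  have "linear (\<lambda>p::'a \<times> (nat \<Rightarrow> nat \<Rightarrow> real). (fst p, gram ?m r c (snd p)))"
    by (rule linearI) (simp_all add: gram_add gram_scale)
  from affine_linear_vimage[OF this D] have "affine ?G" by (simp add: vimage_def)
  moreover have "{x. \<exists>Y\<in>psd_cone r. (x, Y) \<in> D} = {x. \<exists>Z\<in>psd_cone ?m. (x, Z) \<in> ?G}"
  proof (intro set_eqI iffI)
    fix x assume "x \<in> {x. \<exists>Y\<in>psd_cone r. (x, Y) \<in> D}"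
    then obtain Y where Y: "Y \<in> psd_cone r" "(x, Y) \<in> D" by blast
    then have "(x, gram r ?m e Y) \<in> ?G" using Yeq[OF Y] by simp
    with gram_psd[OF Y(1)] show "x \<in> {x. \<exists>Z\<in>psd_cone ?m. (x, Z) \<in> ?G}" by blast
  next
    fix x assume "x \<in> {x. \<exists>Z\<in>psd_cone ?m. (x, Z) \<in> ?G}"
    then show "x \<in> {x. \<exists>Y\<in>psd_cone r. (x, Y) \<in> D}" using gram_psd by auto
  qed
  ultimately show ?thesis unfolding sdp_lift_def by blast
qed

text \<open>The kernel of the midpoint of two psd matrices is the intersection of their kernels. A
  member of \<open>C\<close> with kernel of least dimension therefore has its kernel inside that of
  every other member.\<close>

lemma psd_max_rank:
  assumes C: "convex C" "C \<subseteq> psd_cone r" "C \<noteq> {}"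
  obtains Y where "Y \<in> C" "\<And>z Z. z \<in> Rn r \<Longrightarrow> bilin r Y z z = 0 \<Longrightarrow> Z \<in> C \<Longrightarrow> bilin r Z z z = 0"
proof -
  define K where "K Y = {z \<in> Rn r. bilin r Y z z = 0}" for Y
  obtain Y where Y: "Y \<in> C" "\<And>Z. Z \<in> C \<Longrightarrow> dim (K Y) \<le> dim (K Z)"
    using ex_has_least_nat[of "\<lambda>Y. Y \<in> C" _ "\<lambda>Y. dim (K Y)"] C(3) by auto
  have "bilin r Z z z = 0" if z: "z \<in> Rn r" "bilin r Y z z = 0" "Z \<in> C" for z Z
  proof (rule ccontr)
    assume nz: "bilin r Z z z \<noteq> 0"
    define W where "W = (1/2) *\<^sub>R Y + (1/2) *\<^sub>R Z"
    have W: "W \<in> C" unfolding W_def using C(1) Y(1) z(3) by (intro convexD) auto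
    have pos: "0 \<le> bilin r Y w w" "0 \<le> bilin r Z w w" for w
      using C Y z by (auto simp: psd_cone_iff subset_iff)
    have Ww: "bilin r W w w = (bilin r Y w w + bilin r Z w w) / 2" for w
      unfolding W_def by (simp add: bilin_add_mat bilin_scale_mat)
    have "K W \<subseteq> K Y" unfolding K_def Ww using pos by (auto simp: add_nonneg_eq_0_iff)
    moreover have "z \<in> K Y" "z \<notin> K W" using z nz by (auto simp: K_def Ww)
    moreover have "subspace (K W)" unfolding K_def using W C by (intro subspace_psd_null) auto
    ultimately have "dim (K W) < dim (K Y)"
      by (intro dim_less_Rn[of _ _ r z]) (auto simp: K_def)
    with Y(2)[OF W] show False by simp
  qed
  with Y(1) that show ?thesis by blast
qed

text \<open>Padded vectors carry the product topology, so a box is compact by Tychonoff's theorem.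
  With the sup norm the unit sphere is a closed part of a box.\<close>

lemma compact_unit_sphere_Rn: "compact {z \<in> Rn r. (\<forall>i<r. \<bar>z i\<bar> \<le> 1) \<and> (\<exists>i<r. \<bar>z i\<bar> = 1)}"
proof -
  let ?box = "PiE UNIV (\<lambda>i. if i < r then {-1..1::real} else {0})"
  have "compactin (product_topology (\<lambda>i. euclidean) UNIV) ?box"
    by (subst compactin_PiE) auto
  then have "compact ?box" by (simp add: euclidean_product_topology)
  moreover have "closed (\<Union>i\<in>{..<r}. {z::nat \<Rightarrow> real. \<bar>z i\<bar> = 1})"
    by (intro closed_UN ballI closed_Collect_eq continuous_on_rabs continuous_on_product_coordinates
        continuous_on_const) auto
  ultimately have "compact (?box \<inter> (\<Union>i\<in>{..<r}. {z. \<bar>z i\<bar> = 1}))" by (rule compact_Int_closed)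
  moreover have "z \<in> ?box \<longleftrightarrow> z \<in> Rn r \<and> (\<forall>i<r. \<bar>z i\<bar> \<le> 1)" for z
  proof -
    have "z i \<in> (if i < r then {-1..1::real} else {0}) \<longleftrightarrow> (i \<ge> r \<longrightarrow> z i = 0) \<and> (i < r \<longrightarrow> \<bar>z i\<bar> \<le> 1)" for i
      by (cases "i < r") (auto simp: abs_le_iff)
    then show ?thesis by (simp only: PiE_UNIV_domain Rn_def Pi_iff mem_Collect_eq UNIV_I True_implies_equals simp_thms) blast
  qed
  then have "?box \<inter> (\<Union>i\<in>{..<r}. {z. \<bar>z i\<bar> = 1}) =
      {z \<in> Rn r. (\<forall>i<r. \<bar>z i\<bar> \<le> 1) \<and> (\<exists>i<r. \<bar>z i\<bar> = 1)}"
    by blast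
  ultimately show ?thesis by simp
qed

text \<open>Finsler's lemma. On the compact part \<open>T\<close> of the sphere where
  \<open>Y\<close> is not positive, \<open>Y0\<close> has a positive minimum, so a large multiple of
  it outweighs \<open>Y\<close>; homogeneity extends this from the sphere to all vectors.\<close>

lemma finsler:
  assumes Y0: "\<And>z. 0 \<le> bilin r Y0 z z"
    and pos: "\<And>z. z \<in> Rn r \<Longrightarrow> z \<noteq> 0 \<Longrightarrow> bilin r Y0 z z = 0 \<Longrightarrow> 0 < bilin r Y z z"
  obtains N :: real where "N > 0" "\<And>z. 0 \<le> bilin r (Y + N *\<^sub>R Y0) z z"
proof -
  define S where "S = {z \<in> Rn r. (\<forall>i<r. \<bar>z i\<bar> \<le> 1) \<and> (\<exists>i<r. \<bar>z i\<bar> = 1)}"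
  define T where "T = S \<inter> {z. bilin r Y z z \<le> 0}"
  have cont: "continuous_on A (\<lambda>z::nat \<Rightarrow> real. bilin r X z z)" for A X
    unfolding bilin_def
    by (rule continuous_on_subset[OF _ subset_UNIV])
       (intro continuous_on_sum continuous_on_mult[OF continuous_on_mult[OF
          continuous_on_product_coordinates continuous_on_const] continuous_on_product_coordinates])
  have S: "compact S" unfolding S_def by (rule compact_unit_sphere_Rn)
  have T: "compact T" unfolding T_def
    by (intro compact_Int_closed S closed_Collect_le cont continuous_on_const)
  have "\<exists>N>0. \<forall>z\<in>S. 0 \<le> bilin r (Y + N *\<^sub>R Y0) z z"
  proof (cases "T = {}")
    case True
    have "0 \<le> bilin r (Y + 1 *\<^sub>R Y0) z z" if "z \<in> S" for z
    proof -
      have "bilin r Y z z > 0" using True that unfolding T_def by auto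
      with Y0[of z] show ?thesis by (simp add: bilin_add_mat)
    qed
    then show ?thesis by (intro exI[of _ 1] conjI) auto
  next
    case False
    obtain z0 where z0: "z0 \<in> T" "\<And>z. z \<in> T \<Longrightarrow> bilin r Y0 z0 z0 \<le> bilin r Y0 z z"
      using continuous_attains_inf[OF T False cont[of T Y0]] by auto
    obtain z1 where z1: "\<And>z. z \<in> T \<Longrightarrow> bilin r Y z1 z1 \<le> bilin r Y z z"
      using continuous_attains_inf[OF T False cont[of T Y]] by auto
    let ?a = "bilin r Y0 z0 z0" and ?b = "bilin r Y z1 z1"
    have "z0 \<noteq> 0" "z0 \<in> Rn r" "bilin r Y z0 z0 \<le> 0" using z0(1) by (auto simp: T_def S_def)
    with pos[of z0] Y0[of z0] have a: "?a > 0" by fastforce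
    \<comment> \<open>\<open>?a\<close> and \<open>?b\<close> are the minima of the forms of
      \<open>Y0\<close> and \<open>Y\<close> on \<open>T\<close>, so \<open>N * ?a\<close> exceeds
      the worst deficit.\<close>
    define N where "N = (\<bar>?b\<bar> + 1) / ?a"
    have N: "N > 0" using a by (simp add: N_def add_nonneg_pos)
    have "0 \<le> bilin r (Y + N *\<^sub>R Y0) z z" if z: "z \<in> S" for z
    proof (cases "z \<in> T")
      case True
      have "N * ?a \<le> N * bilin r Y0 z z" using z0(2)[OF True] N by simp
      moreover have "N * ?a = \<bar>?b\<bar> + 1" using a by (simp add: N_def)
      ultimately show ?thesis using z1[OF True] by (simp add: bilin_add_mat bilin_scale_mat)
    next
      case False
      then show ?thesis using z Y0[of z] N by (simp add: T_def bilin_add_mat bilin_scale_mat)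
    qed
    with N show ?thesis by blast
  qed
  then obtain N where N: "N > 0" "\<And>z. z \<in> S \<Longrightarrow> 0 \<le> bilin r (Y + N *\<^sub>R Y0) z z" by blast
  have "0 \<le> bilin r (Y + N *\<^sub>R Y0) z z" for z
  proof (cases "\<forall>i<r. z i = 0")
    case True
    then have "bilin r (Y + N *\<^sub>R Y0) z z = bilin r (Y + N *\<^sub>R Y0) (\<lambda>_. 0) (\<lambda>_. 0)"
      by (intro bilin_cong) auto
    then show ?thesis by simp
  next
    case False
    define M where "M = Max ((\<lambda>i. \<bar>z i\<bar>) ` {..<r})"
    have ne: "(\<lambda>i. \<bar>z i\<bar>) ` {..<r} \<noteq> {}" using False by auto
    have le: "\<bar>z i\<bar> \<le> M" if "i < r" for i using that by (auto simp: M_def)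
    obtain i where i: "i < r" "M = \<bar>z i\<bar>" using Max_in[OF _ ne] by (auto simp: M_def)
    obtain j where j: "j < r" "z j \<noteq> 0" using False by auto
    have M: "M > 0" using le[OF j(1)] j(2) by simp
    define w where "w = (\<lambda>k. if k < r then z k / M else 0)"
    have "w \<in> S" using le i M unfolding S_def
      by (auto simp: Rn_def w_def intro!: exI[of _ i])
    then have "0 \<le> M\<^sup>2 * bilin r (Y + N *\<^sub>R Y0) w w" using N(2) by simp
    also have "\<dots> = bilin r (Y + N *\<^sub>R Y0) (\<lambda>k. M * w k) (\<lambda>k. M * w k)"
      by (simp add: bilin_scale_left bilin_scale_right power2_eq_square)
    also have "\<dots> = bilin r (Y + N *\<^sub>R Y0) z z"
      using M by (intro bilin_cong) (auto simp: w_def)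
    finally show ?thesis .
  qed
  with N(1) that show ?thesis by blast
qed

section \<open>Lifts of joins\<close>

lemma affine_combination_pair:
  assumes "affine D" "(x, Y) \<in> D" "(x', Y') \<in> D" "u + v = (1::real)"
  shows "(u *\<^sub>R x + v *\<^sub>R x', u *\<^sub>R Y + v *\<^sub>R Y') \<in> D"
proof -
  have "u *\<^sub>R (x, Y) + v *\<^sub>R (x', Y') \<in> D" using assms unfolding affine_def by blast
  then show ?thesis by simp
qed

lemma convex_feasible_matrices:
  assumes "affine D"
  shows "convex {Y \<in> psd_cone r. \<exists>x. (x, Y) \<in> D}"
proof (rule convexI)
  fix Y Z :: "nat \<Rightarrow> nat \<Rightarrow> real" and u v :: real
  assume *: "Y \<in> {Y \<in> psd_cone r. \<exists>x. (x, Y) \<in> D}" "Z \<in> {Y \<in> psd_cone r. \<exists>x. (x, Y) \<in> D}"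
    and uv: "0 \<le> u" "0 \<le> v" "u + v = 1"
  then obtain x y where xy: "(x, Y) \<in> D" "(y, Z) \<in> D" by blast
  from affine_combination_pair[OF assms xy uv(3)] * uv
  show "u *\<^sub>R Y + v *\<^sub>R Z \<in> {Y \<in> psd_cone r. \<exists>x. (x, Y) \<in> D}"
    using convexD[OF convex_psd_cone, of Y r Z u v] by auto
qed

text \<open>A null vector of a feasible matrix of maximal rank is null for all feasible matrices,
  and face reduction along it would lower the order.\<close>

lemma minimal_lift_pos_def:
  fixes D :: "('a::real_vector \<times> (nat \<Rightarrow> nat \<Rightarrow> real)) set"
  assumes D: "affine D" and Q: "Q = {x. \<exists>Y\<in>psd_cone r. (x, Y) \<in> D}" and ne: "Q \<noteq> {}"
    and minimal: "\<And>r'. sdp_lift Q r' \<Longrightarrow> r \<le> r'"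
  obtains x Y where "Y \<in> psd_cone r" "(x, Y) \<in> D"
    "\<And>z. z \<in> Rn r \<Longrightarrow> z \<noteq> 0 \<Longrightarrow> 0 < bilin r Y z z"
proof -
  let ?C = "{Y \<in> psd_cone r. \<exists>x. (x, Y) \<in> D}"
  obtain Y where Y: "Y \<in> ?C" and Ymax: "\<And>z Z. z \<in> Rn r \<Longrightarrow> bilin r Y z z = 0 \<Longrightarrow> Z \<in> ?C \<Longrightarrow> bilin r Z z z = 0"
    using psd_max_rank[OF convex_feasible_matrices[OF D, of r]] ne unfolding Q by blast
  have "0 < bilin r Y z z" if z: "z \<in> Rn r" "z \<noteq> 0" for z
  proof (rule ccontr)
    assume "\<not> 0 < bilin r Y z z"
    moreover have "0 \<le> bilin r Y z z" using Y by (simp add: psd_cone_iff)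
    ultimately have null: "bilin r Y z z = 0" by simp
    have "independent {z}" using z by simp
    then obtain B where B: "{z} \<subseteq> B" "B \<subseteq> Rn r" "independent B" "Rn r \<subseteq> span B"
      using Rn_basis_extend[of "{z}" r] z by auto
    have "sdp_lift Q (card (B - {z}))"
      unfolding Q using Ymax[OF z(1) null]
      by (intro sdp_lift_face_reduction[OF D B(2-4,1)]) auto
    then have "r \<le> card (B - {z})" by (rule minimal)
    moreover have "finite B" "card B \<le> r" using independent_Rn[OF B(3,2)] by auto
    ultimately show False using B(1) card_Diff1_less[of B z] by auto
  qed
  with Y that show ?thesis by blast
qed

text \<open>Every point of \<open>Q\<close> lies on a segment between a point of the face \<open>F\<close> and a point over \<open>P\<close>.
  With \<open>K\<close> the common kernel of the feasible matrices over \<open>F\<close>, a lift of \<open>F\<close> lives on a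
  complement of \<open>K\<close>, and restricting all matrices to \<open>K\<close> gives a lift of \<open>P\<close>.\<close>

lemma sdp_lift_join:
  fixes Q :: "'a::real_vector set" and P :: "'b::real_vector set"
  assumes Q: "sdp_lift Q r" and h: "linear h" and \<rho>: "linear \<rho>"
    and hQ: "\<And>q. q \<in> Q \<Longrightarrow> 0 \<le> h q \<and> (\<exists>p\<in>P. \<rho> q = h q *\<^sub>R p)"
    and PQ: "\<And>p. p \<in> P \<Longrightarrow> \<exists>q\<in>Q. h q = 1 \<and> \<rho> q = p"
    and F: "F = {q \<in> Q. h q = 0}" "F \<noteq> {}" and P: "P \<noteq> {}"
    and P_closed: "\<And>p p1. p1 \<in> P \<Longrightarrow>
       (\<And>\<delta>. 0 < \<delta> \<Longrightarrow> \<delta> < 1 \<Longrightarrow> (1 - \<delta>) *\<^sub>R p + \<delta> *\<^sub>R p1 \<in> P) \<Longrightarrow> p \<in> P"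
  shows "\<exists>r1 r2. sdp_lift F r1 \<and> sdp_lift P r2 \<and> 1 \<le> r2 \<and> r1 + r2 \<le> r"
proof -
  \<comment> \<open>Minimality provides the positive definite feasible matrix
    \<open>Y1\<close>.\<close>
  define s where "s = (LEAST r. sdp_lift Q r)"
  have s: "sdp_lift Q s" "s \<le> r"
    unfolding s_def using LeastI[of "sdp_lift Q", OF Q] Least_le[of "sdp_lift Q", OF Q] by simp_all
  have smin: "s \<le> r'" if "sdp_lift Q r'" for r'
    unfolding s_def using that by (rule Least_le)
  obtain D where D: "affine D" and Qeq: "Q = {x. \<exists>Y\<in>psd_cone s. (x, Y) \<in> D}"
    using s(1) by (auto simp: sdp_lift_def)
  have Qne: "Q \<noteq> {}" using F by auto
  obtain x1 Y1 where xY1: "Y1 \<in> psd_cone s" "(x1, Y1) \<in> D"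
    and pd: "\<And>z. z \<in> Rn s \<Longrightarrow> z \<noteq> 0 \<Longrightarrow> 0 < bilin s Y1 z z"
    using minimal_lift_pos_def[OF D Qeq Qne smin] by metis
  have x1: "x1 \<in> Q" unfolding Qeq using xY1 by blast
  define DF where "DF = D \<inter> {p. h (fst p) = 0}"
  have lin_h: "linear (\<lambda>p::'a \<times> (nat \<Rightarrow> nat \<Rightarrow> real). h (fst p))"
    by (rule linearI) (simp_all add: linear_add[OF h] linear_scale[OF h])
  have aff_h: "affine {p::'a \<times> (nat \<Rightarrow> nat \<Rightarrow> real). h (fst p) = c}" for c
    using affine_linear_vimage[OF lin_h, of "{c}"] by (simp add: vimage_def)
  have DF: "affine DF" unfolding DF_def by (intro affine_Int D aff_h)
  have Feq: "F = {x. \<exists>Y\<in>psd_cone s. (x, Y) \<in> DF}"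
    unfolding F Qeq DF_def by auto
  define CF where "CF = {Y \<in> psd_cone s. \<exists>x. (x, Y) \<in> DF}"
  have CF: "convex CF" "CF \<subseteq> psd_cone s" "CF \<noteq> {}"
    unfolding CF_def using convex_feasible_matrices[OF DF] F(2) Feq by auto
  obtain Y0 where Y0': "Y0 \<in> CF"
    and Y0max: "\<And>z Z. z \<in> Rn s \<Longrightarrow> bilin s Y0 z z = 0 \<Longrightarrow> Z \<in> CF \<Longrightarrow> bilin s Z z z = 0"
    using psd_max_rank[OF CF] by metis
  have Y0: "Y0 \<in> psd_cone s" "\<exists>x. (x, Y0) \<in> DF" using Y0' by (auto simp: CF_def)
  from Y0 obtain x0 where x0: "(x0, Y0) \<in> D" "h x0 = 0" by (auto simp: DF_def)
  have x0Q: "x0 \<in> Q" unfolding Qeq using x0 Y0 by blast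
  have \<rho>0: "\<rho> x0 = 0" using hQ[OF x0Q] x0(2) by auto
  have Y0pos: "0 \<le> bilin s Y0 z z" for z using Y0 by (simp add: psd_cone_iff)
  define K where "K = {z \<in> Rn s. bilin s Y0 z z = 0}"
  have K: "subspace K" "K \<subseteq> Rn s" unfolding K_def using subspace_psd_null[OF Y0(1)] by auto
  obtain B where B: "B \<subseteq> K" "independent B" "K \<subseteq> span B" by (rule basis_exists)
  obtain B' where B': "B \<subseteq> B'" "B' \<subseteq> Rn s" "independent B'" "Rn s \<subseteq> span B'"
    using Rn_basis_extend[OF B(2) subset_trans[OF B(1) K(2)]] by metis
  have finB': "finite B'" "card B' \<le> s" using independent_Rn[OF B'(3,2)] by auto
  have finB: "finite B" using finB' B' finite_subset by blast
  let ?d = "card B"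
  have liftF: "sdp_lift F (card (B' - B))"
    unfolding Feq
  proof (rule sdp_lift_face_reduction[OF DF B'(2-4,1)])
    fix x Y z assume "Y \<in> psd_cone s" "(x, Y) \<in> DF" "z \<in> B"
    then show "bilin s Y z z = 0" using Y0max[of z Y] B(1) by (auto simp: K_def CF_def)
  qed
  obtain k where k: "bij_betw k {..<?d} B"
    using ex_bij_betw_nat_finite[OF finB] by (auto simp: atLeast0LessThan)
  have K_rep: "\<exists>u. z = (\<lambda>i. \<Sum>a<?d. u a * k a i)" if z: "z \<in> K" for z
  proof -
    obtain u where "z = (\<Sum>b\<in>B. u b *\<^sub>R b)" using z B(3) span_finite[OF finB] by auto
    also have "\<dots> = (\<Sum>a<?d. u (k a) *\<^sub>R k a)"
      using sum.reindex_bij_betw[OF k, of "\<lambda>b. u b *\<^sub>R b"] by simp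
    also have "\<dots> = (\<lambda>i. \<Sum>a<?d. u (k a) * k a i)" by (auto simp: fun_eq_iff sum_fun_apply)
    finally show ?thesis by (rule exI[of _ "\<lambda>a. u (k a)"])
  qed
  let ?g = "\<lambda>p::'a \<times> (nat \<Rightarrow> nat \<Rightarrow> real). (\<rho> (fst p), gram s ?d k (snd p))"
  \<comment> \<open>A compression to \<open>K\<close> sees symmetry only on \<open>K\<close>. The
    full matrix must be symmetric when positivity is extended to all of \<open>Rn s\<close>, so
    symmetry is imposed before compressing.\<close>
  define DP where "DP = ?g ` (D \<inter> {p. h (fst p) = 1} \<inter> snd -` sym_mats s)"
  have "linear ?g"
    by (rule linearI) (simp_all add: gram_add gram_scale linear_add[OF \<rho>] linear_scale[OF \<rho>])
  then have DP: "affine DP" unfolding DP_def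
    by (rule affine_linear_image)
       (intro affine_Int D aff_h affine_linear_vimage linear_snd subspace_imp_affine subspace_sym_mats)
  have in_P: "p \<in> P" if p: "p = \<rho> x" "(x, Y) \<in> D" "h x = 1" "Y \<in> sym_mats s"
    and Z: "gram s ?d k Y \<in> psd_cone ?d" for p x Y
  proof -
    have YK: "0 \<le> bilin s Y z z" if "z \<in> K" for z
    proof -
      obtain u where "z = (\<lambda>i. \<Sum>a<?d. u a * k a i)" using K_rep[OF \<open>z \<in> K\<close>] by blast
      then have "bilin s Y z z = bilin ?d (gram s ?d k Y) u u" by (simp add: bilin_gram)
      then show ?thesis using Z by (simp add: psd_cone_iff)
    qed
    obtain p1 where p1: "p1 \<in> P" "\<rho> x1 = h x1 *\<^sub>R p1" and h1: "0 \<le> h x1" using hQ[OF x1] by blast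
    \<comment> \<open>\<open>Y\<close> is nonnegative on \<open>K\<close> only. A share
      \<open>e\<close> of \<open>Y1\<close> makes it positive on \<open>K\<close> minus the origin,
      and a multiple of \<open>Y0\<close> then makes it psd by Finsler's lemma. Since
      \<open>h\<close> and \<open>\<rho>\<close> vanish at \<open>x0\<close>, the point of
      \<open>Q\<close> obtained in this way still determines the mixture of \<open>p\<close> and
      \<open>p1\<close> up to a scalar.\<close>
    have main: "\<exists>p'\<in>P. (1 - e) *\<^sub>R p + (e * h x1) *\<^sub>R p1 = ((1 - e) + e * h x1) *\<^sub>R p'"
      if e: "0 < e" "e < 1" for e
    proof -
      define xe Ye where "xe = (1 - e) *\<^sub>R x + e *\<^sub>R x1" and "Ye = (1 - e) *\<^sub>R Y + e *\<^sub>R Y1"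
      have xYe: "(xe, Ye) \<in> D" unfolding xe_def Ye_def
        by (rule affine_combination_pair[OF D p(2) xY1(2)]) simp
      have pos: "0 < bilin s Ye z z" if z: "z \<in> Rn s" "z \<noteq> 0" "bilin s Y0 z z = 0" for z
      proof -
        have "0 \<le> bilin s Y z z" using z by (intro YK) (simp add: K_def)
        then show ?thesis using pd[OF z(1,2)] e
          by (simp add: Ye_def bilin_add_mat bilin_scale_mat add_nonneg_pos)
      qed
      obtain N where N: "N > 0" "\<And>z. 0 \<le> bilin s (Ye + N *\<^sub>R Y0) z z"
        using finsler[OF Y0pos pos] by blast
      have "Ye + N *\<^sub>R Y0 \<in> sym_mats s"
        unfolding Ye_def using p(4) xY1(1) Y0(1)
        by (intro subspace_add subspace_scale subspace_sym_mats) (auto simp: psd_cone_iff)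
      with N have psd: "Ye + N *\<^sub>R Y0 \<in> psd_cone s" by (simp add: psd_cone_iff)
      \<comment> \<open>Rescaling by \<open>1 / (1 + N)\<close> turns the sum with \<open>N\<close>
        copies of \<open>Y0\<close> into an affine combination, which stays in
        \<open>D\<close>.\<close>
      define u where "u = 1 / (1 + N)"
      have u: "0 < u" "u + u * N = 1" using N(1) by (auto simp: u_def field_simps)
      have "(u *\<^sub>R xe + (u * N) *\<^sub>R x0, u *\<^sub>R Ye + (u * N) *\<^sub>R Y0) \<in> D"
        by (rule affine_combination_pair[OF D xYe x0(1) u(2)])
      moreover have "u *\<^sub>R Ye + (u * N) *\<^sub>R Y0 \<in> psd_cone s"
        using psd_cone_scale[OF psd, of u] u by (simp add: scaleR_right_distrib)
      ultimately have "u *\<^sub>R xe + (u * N) *\<^sub>R x0 \<in> Q" unfolding Qeq by blast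
      from hQ[OF this] obtain p' where p': "p' \<in> P"
        "\<rho> (u *\<^sub>R xe + (u * N) *\<^sub>R x0) = h (u *\<^sub>R xe + (u * N) *\<^sub>R x0) *\<^sub>R p'" by blast
      then have "u *\<^sub>R \<rho> xe = u *\<^sub>R (h xe *\<^sub>R p')"
        by (simp add: linear_add[OF \<rho>] linear_scale[OF \<rho>] linear_add[OF h] linear_scale[OF h] \<rho>0 x0(2))
      moreover have "u \<noteq> 0" using u(1) by simp
      ultimately have "\<rho> xe = h xe *\<^sub>R p'" by (simp only: scaleR_cancel_left) simp
      then show ?thesis using p'(1) p(1,3) p1(2)
        by (intro bexI[of _ p'])
           (simp_all add: xe_def linear_add[OF \<rho>] linear_scale[OF \<rho>] linear_add[OF h] linear_scale[OF h])
    qed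
    show "p \<in> P"
    proof (cases "h x1 = 0")
      case True
      then show ?thesis using main[of "1/2"] by auto
    next
      case False
      then have h1': "h x1 > 0" using h1 by simp
      have "(1 - \<delta>) *\<^sub>R p + \<delta> *\<^sub>R p1 \<in> P" if \<delta>: "0 < \<delta>" "\<delta> < 1" for \<delta>
      proof -
        \<comment> \<open>The weights must account for \<open>h x1\<close> differing from
          \<open>h x = 1\<close>: with \<open>e\<close> equal to \<open>\<delta> / c\<close>, the
          coefficients of \<open>p\<close> and \<open>p1\<close> in \<open>main\<close> have the
          ratio of \<open>1 - \<delta>\<close> to \<open>\<delta>\<close>.\<close>
        define c where "c = \<delta> + h x1 * (1 - \<delta>)"
        have c: "c > 0" unfolding c_def using \<delta> h1' by (simp add: add_pos_pos)
        define e where "e = \<delta> / c"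
        have 1: "1 - e = h x1 * (1 - \<delta>) / c" using c by (simp add: e_def c_def field_simps)
        have e: "0 < e" "1 - e > 0" unfolding 1 using c \<delta> h1' by (auto simp: e_def)
        then obtain p' where p': "p' \<in> P" "(1 - e) *\<^sub>R p + (e * h x1) *\<^sub>R p1 = ((1 - e) + e * h x1) *\<^sub>R p'"
          using main[of e] by auto
        have t: "(1 - e) + e * h x1 = h x1 / c" unfolding 1 using c by (simp add: e_def field_simps)
        have "(h x1 / c) *\<^sub>R ((1 - \<delta>) *\<^sub>R p + \<delta> *\<^sub>R p1) = (1 - e) *\<^sub>R p + (e * h x1) *\<^sub>R p1"
          unfolding 1 by (simp add: e_def scaleR_right_distrib mult.commute)
        then have "(h x1 / c) *\<^sub>R ((1 - \<delta>) *\<^sub>R p + \<delta> *\<^sub>R p1) = (h x1 / c) *\<^sub>R p'"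
          unfolding p'(2) t .
        then have "(1 - \<delta>) *\<^sub>R p + \<delta> *\<^sub>R p1 = p'" using c h1' by simp
        with p'(1) show ?thesis by simp
      qed
      with P_closed[OF p1(1)] show ?thesis by blast
    qed
  qed
  have liftP: "sdp_lift P ?d"
    unfolding sdp_lift_def
  proof (intro exI conjI set_eqI iffI)
    show "affine DP" by (rule DP)
  next
    fix p assume "p \<in> P"
    then obtain q where q: "q \<in> Q" "h q = 1" "\<rho> q = p" using PQ by blast
    then obtain Y where Y: "Y \<in> psd_cone s" "(q, Y) \<in> D" unfolding Qeq by blast
    have "(p, gram s ?d k Y) \<in> DP"
      unfolding DP_def using q Y by (auto simp: psd_cone_iff image_iff intro!: bexI[of _ "(q, Y)"])
    with gram_psd[OF Y(1)] show "p \<in> {x. \<exists>Y\<in>psd_cone ?d. (x, Y) \<in> DP}" by blast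
  next
    fix p assume "p \<in> {x. \<exists>Y\<in>psd_cone ?d. (x, Y) \<in> DP}"
    then show "p \<in> P" unfolding DP_def using in_P by auto
  qed
  \<comment> \<open>If \<open>K\<close> were trivial, \<open>Y0\<close> would be positive definite,
    and one could move from \<open>x0\<close> a little away from a point at height 1 without losing
    feasibility. That would reach negative values of \<open>h\<close>.\<close>
  have "?d \<noteq> 0"
  proof
    assume "?d = 0"
    then have "K \<subseteq> {0}" using B(3) finB by auto
    obtain q Y2 where q: "(q, Y2) \<in> D" "Y2 \<in> psd_cone s" "h q = 1"
      using PQ P unfolding Qeq by blast
    have "0 < bilin s (Y0 - Y2) z z" if "z \<in> Rn s" "z \<noteq> 0" "bilin s Y0 z z = 0" for z
      using that \<open>K \<subseteq> {0}\<close> by (auto simp: K_def)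
    from finsler[OF Y0pos this] obtain N where N: "N > 0" "\<And>z. 0 \<le> bilin s ((Y0 - Y2) + N *\<^sub>R Y0) z z"
      by blast
    have "(Y0 - Y2) + N *\<^sub>R Y0 \<in> sym_mats s"
      using q(2) Y0(1) by (intro subspace_add subspace_diff subspace_scale subspace_sym_mats) (auto simp: psd_cone_iff)
    with N have psd: "(Y0 - Y2) + N *\<^sub>R Y0 \<in> psd_cone s" by (simp add: psd_cone_iff)
    have "((1 + 1/N) *\<^sub>R x0 + (- 1/N) *\<^sub>R q, (1 + 1/N) *\<^sub>R Y0 + (- 1/N) *\<^sub>R Y2) \<in> D"
      by (rule affine_combination_pair[OF D x0(1) q(1)]) simp
    moreover have "(1 + 1/N) *\<^sub>R Y0 + (- 1/N) *\<^sub>R Y2 = (1/N) *\<^sub>R ((Y0 - Y2) + N *\<^sub>R Y0)"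
      using N(1) by (simp add: algebra_simps)
    then have "(1 + 1/N) *\<^sub>R Y0 + (- 1/N) *\<^sub>R Y2 \<in> psd_cone s"
      using psd_cone_scale[OF psd, of "1/N"] N(1) by simp
    ultimately have "(1 + 1/N) *\<^sub>R x0 + (- 1/N) *\<^sub>R q \<in> Q" unfolding Qeq by blast
    then have "0 \<le> h ((1 + 1/N) *\<^sub>R x0 + (- 1/N) *\<^sub>R q)" using hQ by blast
    also have "\<dots> = - 1/N" unfolding linear_add[OF h] linear_scale[OF h] x0(2) q(3) by simp
    finally show False using N(1) by (simp add: divide_less_0_iff)
  qed
  moreover have "card (B' - B) + ?d \<le> s"
    using finB' B'(1) finB by (simp add: card_Diff_subset card_mono)
  ultimately show ?thesis
    using liftF liftP s(2) by (intro exI[of _ "card (B' - B)"] exI[of _ ?d]) auto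
qed

section \<open>Lifts and semidefinite extensions\<close>

text \<open>Adding a point makes the hull a continuous image of the unit interval times the previous
  hull.\<close>

lemma compact_convex_hull_fun:
  fixes S :: "('i \<Rightarrow> real) set"
  assumes "finite S"
  shows "compact (convex hull S)"
  using assms
proof (induction S rule: finite_induct)
  case (insert a S)
  show ?case
  proof (cases "S = {}")
    case False
    let ?f = "\<lambda>q. fst q *\<^sub>R a + (1 - fst q) *\<^sub>R snd q"
    have c: "continuous_on UNIV (\<lambda>q::real \<times> ('i \<Rightarrow> real). snd q i)" for i
      using continuous_on_compose2[OF continuous_on_product_coordinates[of i] continuous_on_snd[OF continuous_on_id]]
      by auto
    have "continuous_on UNIV (\<lambda>q::real \<times> ('i \<Rightarrow> real). fst q * a i + (1 - fst q) * snd q i)" for i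
      by (intro continuous_on_add continuous_on_mult continuous_on_diff continuous_on_const
          continuous_on_fst continuous_on_id c)
    then have "continuous_on UNIV ?f"
      by (intro continuous_on_coordinatewise_then_product) simp
    then have "compact (?f ` ({0..1} \<times> (convex hull S)))"
      using insert.IH by (intro compact_continuous_image compact_Times) (auto intro: continuous_on_subset)
    moreover have "convex hull (insert a S) = ?f ` ({0..1} \<times> (convex hull S))"
    proof (intro set_eqI iffI)
      fix x assume "x \<in> convex hull (insert a S)"
      then obtain u v b where "0 \<le> u" "0 \<le> v" "u + v = 1" "b \<in> convex hull S" "x = u *\<^sub>R a + v *\<^sub>R b"
        unfolding convex_hull_insert[OF False] by blast
      then have "(u, b) \<in> {0..1} \<times> (convex hull S)" "v = 1 - u" by auto
      with \<open>x = u *\<^sub>R a + v *\<^sub>R b\<close> have "(u, b) \<in> {0..1} \<times> (convex hull S)" "x = ?f (u, b)" by auto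
      then show "x \<in> ?f ` ({0..1} \<times> (convex hull S))" by blast
    next
      fix x assume "x \<in> ?f ` ({0..1} \<times> (convex hull S))"
      then obtain u b where "0 \<le> u" "u \<le> 1" "b \<in> convex hull S" "x = u *\<^sub>R a + (1 - u) *\<^sub>R b" by auto
      then show "x \<in> convex hull (insert a S)"
        unfolding convex_hull_insert[OF False]
        by (intro CollectI exI[of _ u] exI[of _ "1 - u"] exI[of _ b] conjI) auto
    qed
    ultimately show ?thesis by simp
  qed simp
qed simp

text \<open>The form in which closedness of a polytope enters \<open>sdp_lift_join\<close>.\<close>

lemma convex_hull_segment_closed:
  fixes S :: "(nat \<Rightarrow> real) set"
  assumes "finite S" and seg: "\<And>\<delta>. 0 < \<delta> \<Longrightarrow> \<delta> < 1 \<Longrightarrow> (1 - \<delta>) *\<^sub>R p + \<delta> *\<^sub>R q \<in> convex hull S"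
  shows "p \<in> convex hull S"
proof -
  let ?f = "\<lambda>\<delta>::real. (1 - \<delta>) *\<^sub>R p + \<delta> *\<^sub>R q"
  have "closed (convex hull S)" using compact_convex_hull_fun[OF assms(1)] by (rule compact_imp_closed)
  moreover have "continuous_on UNIV (\<lambda>\<delta>::real. (1 - \<delta>) * p i + \<delta> * q i)" for i
    by (intro continuous_on_add continuous_on_mult continuous_on_diff continuous_on_const continuous_on_id)
  then have "continuous_on UNIV ?f"
    by (intro continuous_on_coordinatewise_then_product) simp
  ultimately have "closed (?f -` (convex hull S))" by (simp add: continuous_on_closed_vimage)
  moreover have "{0<..<1} \<subseteq> ?f -` (convex hull S)" using seg by auto
  ultimately have "closure {0<..<1} \<subseteq> ?f -` (convex hull S)" by (intro closure_minimal)
  then have "(0::real) \<in> ?f -` (convex hull S)"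
    by (rule subsetD) simp
  then show ?thesis by simp
qed

text \<open>A projection \<open>g\<close> whose kernel on the coordinate space is the direction
  space of \<open>D\<close> describes \<open>D\<close> by \<open>g (z - p) = 0\<close>; the
  coordinates of this identity are the equations.\<close>

lemma affine_coordinate_equations:
  fixes D :: "('i \<Rightarrow> real) set"
  assumes J: "finite J" and D: "affine D" and sub: "D \<subseteq> {z. \<forall>i. i \<notin> J \<longrightarrow> z i = 0}"
  obtains m :: nat and a b where
    "D = {z. (\<forall>i. i \<notin> J \<longrightarrow> z i = 0) \<and> (\<forall>i<m. (\<Sum>j\<in>J. a i j * z j) = b i)}"
proof (cases "D = {}")
  case True
  \<comment> \<open>The empty set is given by the contradictory equation 0 = 1.\<close>
  show ?thesis by (rule that[of 1 "\<lambda>_ _. 0" "\<lambda>_. 1"]) (simp add: True)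
next
  case False
  define V where "V = {z :: 'i \<Rightarrow> real. \<forall>i. i \<notin> J \<longrightarrow> z i = 0}"
  obtain p where p: "p \<in> D" using False by blast
  define L where "L = (\<lambda>x. x - p) ` D"
  have L: "subspace L" unfolding L_def by (rule affine_diffs_subspace_subtract[OF D p])
  have V: "subspace V" unfolding V_def by (rule subspaceI) auto
  have pV: "p \<in> V" and DV: "D \<subseteq> V" using sub p by (auto simp: V_def)
  have LV: "L \<subseteq> V" unfolding L_def using DV pV subspace_diff[OF V] by auto
  obtain B where B: "B \<subseteq> L" "independent B" "L \<subseteq> span B" by (rule basis_exists)
  obtain B' where B': "B \<subseteq> B'" "B' \<subseteq> V" "independent B'" "V \<subseteq> span B'"
    using maximal_independent_subset_extend[OF subset_trans[OF B(1) LV] B(2)] by metis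
  obtain g where g: "linear g" "\<And>x. x \<in> B' \<Longrightarrow> g x = (if x \<in> B then 0 else x)"
    using linear_independent_extend[OF B'(3), of "\<lambda>x. if x \<in> B then 0 else x"] by metis
  have g0: "g x = 0" if "x \<in> span B" for x
  proof (rule linear_eq_on[OF g(1) linear_zero that])
    fix b assume "b \<in> B"
    then show "g b = 0" using g(2)[of b] B'(1) by auto
  qed
  have g1: "g x = x" if "x \<in> span (B' - B)" for x
  proof (rule linear_eq_on[OF g(1) linear_ident that])
    fix b assume "b \<in> B' - B"
    then show "g b = b" using g(2)[of b] by auto
  qed
  have spanB: "span B \<subseteq> L" using B(1) L by (rule span_minimal)
  have gV: "g x \<in> V \<and> (g x = 0 \<longleftrightarrow> x \<in> L)" if x: "x \<in> V" for x
  proof -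
    have "x \<in> span (B \<union> (B' - B))" using x B' by (auto simp: Un_absorb1)
    then obtain y e where ye: "x = y + e" "y \<in> span B" "e \<in> span (B' - B)" unfolding span_Un by blast
    have ge: "g x = e" unfolding ye(1) linear_add[OF g(1)] using g0[OF ye(2)] g1[OF ye(3)] by simp
    have "span (B' - B) \<subseteq> V" using B' V by (intro span_minimal) auto
    then have "g x \<in> V" using ge ye(3) by auto
    moreover have "x \<in> L" if "g x = 0" using ge that ye spanB by auto
    moreover have "g x = 0" if "x \<in> L" using g0 B(3) that by auto
    ultimately show ?thesis by blast
  qed
  define e where "e j = (\<lambda>i. if i = j then 1 else 0::real)" for j :: 'i
  have gsum: "g x i = (\<Sum>j\<in>J. g (e j) i * x j)" if x: "x \<in> V" for x i
  proof -
    have "x = (\<Sum>j\<in>J. x j *\<^sub>R e j)"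
      using x J by (auto simp: fun_eq_iff sum_fun_apply e_def V_def if_distrib[of "\<lambda>c. _ * c"] cong: if_cong)
    then have "g x = g (\<Sum>j\<in>J. x j *\<^sub>R e j)" by simp
    also have "\<dots> = (\<Sum>j\<in>J. x j *\<^sub>R g (e j))"
      by (simp add: linear_sum[OF g(1)] linear_scale[OF g(1)])
    finally show ?thesis by (simp add: sum_fun_apply mult.commute)
  qed
  obtain h where h: "bij_betw h {..<card J} J"
    using ex_bij_betw_nat_finite[OF J] by (auto simp: atLeast0LessThan)
  have "z \<in> D \<longleftrightarrow> z \<in> V \<and> (\<forall>i<card J. (\<Sum>j\<in>J. g (e j) (h i) * z j) = (\<Sum>j\<in>J. g (e j) (h i) * p j))" for z
  proof (cases "z \<in> V")
    case True
    have zp: "z - p \<in> V" using True pV by (rule subspace_diff[OF V])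
    have "z \<in> D \<longleftrightarrow> z - p \<in> L" unfolding L_def by (auto simp: image_iff)
    also have "\<dots> \<longleftrightarrow> g (z - p) = 0" using gV[OF zp] by simp
    also have "\<dots> \<longleftrightarrow> (\<forall>i\<in>J. g (z - p) i = 0)"
    proof -
      have "g (z - p) i = 0" if "i \<notin> J" for i using gV[OF zp] that by (simp add: V_def)
      then show ?thesis by (auto simp: fun_eq_iff)
    qed
    also have "\<dots> \<longleftrightarrow> (\<forall>i\<in>J. (\<Sum>j\<in>J. g (e j) i * z j) = (\<Sum>j\<in>J. g (e j) i * p j))"
      by (simp add: linear_diff[OF g(1)] gsum[OF True] gsum[OF pV])
    also have "\<dots> \<longleftrightarrow> (\<forall>i<card J. (\<Sum>j\<in>J. g (e j) (h i) * z j) = (\<Sum>j\<in>J. g (e j) (h i) * p j))"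
    proof -
      have "(\<forall>i\<in>J. R i) \<longleftrightarrow> (\<forall>i<card J. R (h i))" for R
        using bij_betw_imp_surj_on[OF h] by (metis imageE image_eqI lessThan_iff)
      then show ?thesis .
    qed
    finally show ?thesis using True by simp
  next
    case False
    then show ?thesis using DV by auto
  qed
  then show ?thesis
    by (intro that[of "card J" "\<lambda>i j. g (e j) (h i)" "\<lambda>i. \<Sum>j\<in>J. g (e j) (h i) * p j"]) (auto simp: V_def)
qed

text \<open>A pair of a point and a matrix is flattened into one vector with
  \<open>n + r * r\<close> relevant coordinates. Padding with zeros makes the flattening of every
  pair that matters vanish elsewhere, so finitely many equations suffice.\<close>

lemma has_sdp_extension_iff_lift:
  assumes P: "P \<subseteq> Rn n"
  shows "has_sdp_extension n P r \<longleftrightarrow> sdp_lift P r"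
proof
  assume "has_sdp_extension n P r"
  then obtain m :: nat and a U b where *: "P = {x \<in> Rn n. \<exists>Y\<in>psd_cone r. \<forall>i<m.
      (\<Sum>j<n. a i j * x j) + (\<Sum>k<r. \<Sum>l<r. U i k l * Y k l) = (b i :: real)}"
    unfolding has_sdp_extension_def by blast
  let ?L = "\<lambda>i (x, Y). (\<Sum>j<n. a i j * x j) + (\<Sum>k<r. \<Sum>l<r. U i k l * Y k l :: real)"
  have "linear (?L i)" for i
    by (rule linearI) (auto simp: algebra_simps sum.distrib sum_distrib_left)
  then have "affine (?L i -` {b i})" for i
    by (intro affine_linear_vimage affine_sing)
  moreover have "affine (Rn n \<times> (UNIV :: (nat \<Rightarrow> nat \<Rightarrow> real) set))"
    by (auto simp: affine_def Rn_def)
  ultimately have "affine ((Rn n \<times> UNIV) \<inter> (\<Inter>i<m. ?L i -` {b i}))"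
    by (intro affine_Int affine_Inter) auto
  moreover have "P = {x. \<exists>Y\<in>psd_cone r. (x, Y) \<in> (Rn n \<times> UNIV) \<inter> (\<Inter>i<m. ?L i -` {b i})}"
    unfolding * by auto
  ultimately show "sdp_lift P r" unfolding sdp_lift_def by blast
next
  assume "sdp_lift P r"
  then obtain D where D: "affine D" "P = {x. \<exists>Y\<in>psd_cone r. (x, Y) \<in> D}" unfolding sdp_lift_def by blast
  define J where "J = Inl ` {..<n} \<union> Inr ` ({..<r} \<times> {..<r})"
  have J: "finite J" unfolding J_def by auto
  define dec :: "(nat + nat \<times> nat \<Rightarrow> real) \<Rightarrow> (nat \<Rightarrow> real) \<times> (nat \<Rightarrow> nat \<Rightarrow> real)"
    where "dec z = (\<lambda>j. z (Inl j), \<lambda>k l. z (Inr (k, l)))" for z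
  define enc :: "(nat \<Rightarrow> real) \<Rightarrow> (nat \<Rightarrow> nat \<Rightarrow> real) \<Rightarrow> nat + nat \<times> nat \<Rightarrow> real"
    where "enc x Y = case_sum x (\<lambda>(k, l). Y k l)" for x Y
  have "linear dec" by (rule linearI) (auto simp: dec_def fun_eq_iff)
  then have "affine (dec -` D)" using D(1) by (rule affine_linear_vimage)
  moreover have "affine {z :: nat + nat \<times> nat \<Rightarrow> real. \<forall>i. i \<notin> J \<longrightarrow> z i = 0}" by (auto simp: affine_def)
  ultimately have "affine (dec -` D \<inter> {z. \<forall>i. i \<notin> J \<longrightarrow> z i = 0})" by (rule affine_Int)
  then obtain m :: nat and a b where eq: "dec -` D \<inter> {z. \<forall>i. i \<notin> J \<longrightarrow> z i = 0} =
      {z. (\<forall>i. i \<notin> J \<longrightarrow> z i = 0) \<and> (\<forall>i<m. (\<Sum>j\<in>J. a i j * z j) = b i)}"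
    by (rule affine_coordinate_equations[OF J _ inf_le2])
  have sumJ: "(\<Sum>j\<in>J. a i j * enc x Y j) =
      (\<Sum>j<n. a i (Inl j) * x j) + (\<Sum>k<r. \<Sum>l<r. a i (Inr (k, l)) * Y k l)" for i x Y
  proof -
    have "(\<Sum>j\<in>J. a i j * enc x Y j) = (\<Sum>j\<in>Inl ` {..<n}. a i j * enc x Y j) +
        (\<Sum>j\<in>Inr ` ({..<r} \<times> {..<r}). a i j * enc x Y j)"
      unfolding J_def by (rule sum.union_disjoint) auto
    also have "(\<Sum>j\<in>Inr ` ({..<r} \<times> {..<r}). a i j * enc x Y j) = (\<Sum>(k, l)\<in>{..<r} \<times> {..<r}. a i (Inr (k, l)) * Y k l)"
      by (subst sum.reindex) (auto simp: enc_def case_prod_unfold)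
    also have "(\<Sum>j\<in>Inl ` {..<n}. a i j * enc x Y j) = (\<Sum>j<n. a i (Inl j) * x j)"
      by (subst sum.reindex) (auto simp: enc_def)
    finally show ?thesis by (simp add: sum.cartesian_product)
  qed
  have key: "(x, Y) \<in> D \<longleftrightarrow> (\<forall>i<m. (\<Sum>j\<in>J. a i j * enc x Y j) = b i)"
    if x: "x \<in> Rn n" and Y: "Y \<in> psd_cone r" for x Y
  proof -
    have Y0: "k < r \<and> l < r" if "Y k l \<noteq> 0" for k l
      using Y that unfolding psd_cone_def by (metis (mono_tags, lifting) mem_Collect_eq not_le)
    have supp: "\<forall>i. i \<notin> J \<longrightarrow> enc x Y i = 0"
    proof (intro allI impI)
      fix i assume "i \<notin> J"
      then show "enc x Y i = 0"
        using x by (cases i) (auto simp: enc_def J_def Rn_def image_iff not_less dest: Y0)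
    qed
    have "dec (enc x Y) = (x, Y)" by (simp add: dec_def enc_def)
    then have "(x, Y) \<in> D \<longleftrightarrow> enc x Y \<in> dec -` D \<inter> {z. \<forall>i. i \<notin> J \<longrightarrow> z i = 0}" using supp by auto
    then show ?thesis unfolding eq using supp by auto
  qed
  have "P = {x \<in> Rn n. \<exists>Y\<in>psd_cone r. (x, Y) \<in> D}" using P D(2) by auto
  also have "\<dots> = {x \<in> Rn n. \<exists>Y\<in>psd_cone r. \<forall>i<m.
      (\<Sum>j<n. a i (Inl j) * x j) + (\<Sum>k<r. \<Sum>l<r. a i (Inr (k, l)) * Y k l) = b i}"
    using key by (auto simp: sumJ)
  finally show "has_sdp_extension n P r"
    unfolding has_sdp_extension_def
    by (intro exI[of _ m] exI[of _ "\<lambda>i j. a i (Inl j)"] exI[of _ "\<lambda>i k l. a i (Inr (k, l))"] exI[of _ b])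
qed

section \<open>Least order of a lift and hulls of subsets of the cube\<close>

definition lift_order :: "'a::real_vector set \<Rightarrow> nat" where
  "lift_order P = (LEAST r. sdp_lift P r)"

lemma lift_order_le: "sdp_lift P r \<Longrightarrow> lift_order P \<le> r"
  unfolding lift_order_def by (rule Least_le)

lemma sdp_lift_lift_order: "finite V \<Longrightarrow> sdp_lift (convex hull V) (lift_order (convex hull V))"
  unfolding lift_order_def by (rule LeastI) (rule sdp_lift_convex_hull_finite)

lemma finite_cube: "finite (cube n)"
proof -
  have "cube n \<subseteq> (\<lambda>A i. if i \<in> A then 1 else 0) ` Pow {..<n}"
  proof
    fix x assume x: "x \<in> cube n"
    have "x = (\<lambda>i. if i \<in> {i. i < n \<and> x i = 1} then 1 else 0)"
    proof
      fix i show "x i = (if i \<in> {i. i < n \<and> x i = 1} then 1 else 0)"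
        using x by (cases "i < n") (auto simp: cube_def Rn_def)
    qed
    then show "x \<in> (\<lambda>A i. if i \<in> A then 1 else 0) ` Pow {..<n}" by blast
  qed
  then show ?thesis using finite_subset by blast
qed

lemma card_cube_le: "card (cube n) \<le> 2 ^ n"
proof -
  have "inj_on (\<lambda>x. {i. i < n \<and> x i = 1}) (cube n)"
  proof (rule inj_onI, rule ext)
    fix x y i assume *: "x \<in> cube n" "y \<in> cube n" "{i. i < n \<and> x i = 1} = {i. i < n \<and> y i = 1}"
    then have "i < n \<Longrightarrow> x i = 1 \<longleftrightarrow> y i = 1" by blast
    moreover have "i < n \<Longrightarrow> x i \<in> {0, 1} \<and> y i \<in> {0, 1}" using * by (simp add: cube_def)
    moreover have "\<not> i < n \<Longrightarrow> x i = 0 \<and> y i = 0" using * by (simp add: cube_def Rn_def)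
    ultimately show "x i = y i" by (cases "i < n") auto
  qed
  then have "card (cube n) \<le> card (Pow {..<n})"
    by (rule card_inj_on_le) auto
  then show ?thesis by (simp add: card_Pow)
qed

lemma convex_hull_cube_subset_Rn: "S \<subseteq> cube n \<Longrightarrow> convex hull S \<subseteq> Rn n"
proof (rule hull_minimal)
  show "convex (Rn n)" by (auto simp: convex_def Rn_def)
qed (auto simp: cube_def)

lemma xc_SDP_eq_lift_order:
  assumes "S \<subseteq> cube n"
  shows "xc_SDP n S = lift_order (convex hull S)"
  unfolding xc_SDP_def lift_order_def has_sdp_extension_iff_lift[OF convex_hull_cube_subset_Rn[OF assms]] ..

text \<open>Weights are attached to the indices \<open>s\<close>, not to the points
  \<open>f s\<close>, so that \<open>f\<close> may identify indices.\<close>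

lemma convex_hull_image_finite:
  fixes f :: "'s \<Rightarrow> 'a::real_vector"
  assumes S: "finite S"
  shows "x \<in> convex hull (f ` S) \<longleftrightarrow>
    (\<exists>u. (\<forall>s\<in>S. 0 \<le> u s) \<and> sum u S = 1 \<and> (\<Sum>s\<in>S. u s *\<^sub>R f s) = x)"
proof
  let ?C = "{x. \<exists>u. (\<forall>s\<in>S. 0 \<le> u s) \<and> sum u S = 1 \<and> (\<Sum>s\<in>S. u s *\<^sub>R f s) = x}"
  have "f ` S \<subseteq> ?C"
  proof clarify
    fix s assume s: "s \<in> S"
    have "(\<Sum>t\<in>S. (if t = s then 1 else 0) *\<^sub>R f t) = (\<Sum>t\<in>S. if t = s then f t else 0)"
      by (intro sum.cong) auto
    also have "\<dots> = f s" using s S by simp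
    finally show "\<exists>u. (\<forall>s\<in>S. 0 \<le> u s) \<and> sum u S = 1 \<and> (\<Sum>t\<in>S. u t *\<^sub>R f t) = f s"
      using s S by (intro exI[of _ "\<lambda>t. if t = s then 1 else 0"]) auto
  qed
  moreover have "convex ?C"
  proof (rule convexI, clarify)
    fix u v :: real and a b :: "'s \<Rightarrow> real"
    assume uv: "0 \<le> u" "0 \<le> v" "u + v = 1" and a: "\<forall>s\<in>S. 0 \<le> a s" "sum a S = 1"
      and b: "\<forall>s\<in>S. 0 \<le> b s" "sum b S = 1"
    show "\<exists>w. (\<forall>s\<in>S. 0 \<le> w s) \<and> sum w S = 1 \<and>
        (\<Sum>s\<in>S. w s *\<^sub>R f s) = u *\<^sub>R (\<Sum>s\<in>S. a s *\<^sub>R f s) + v *\<^sub>R (\<Sum>s\<in>S. b s *\<^sub>R f s)"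
      using uv a b
      by (intro exI[of _ "\<lambda>s. u * a s + v * b s"])
         (auto simp: sum.distrib scaleR_left_distrib scaleR_sum_right simp flip: sum_distrib_left)
  qed
  ultimately have "convex hull (f ` S) \<subseteq> ?C" by (rule hull_minimal)
  then show "x \<in> convex hull (f ` S) \<Longrightarrow> \<exists>u. (\<forall>s\<in>S. 0 \<le> u s) \<and> sum u S = 1 \<and> (\<Sum>s\<in>S. u s *\<^sub>R f s) = x"
    by blast
next
  assume "\<exists>u. (\<forall>s\<in>S. 0 \<le> u s) \<and> sum u S = 1 \<and> (\<Sum>s\<in>S. u s *\<^sub>R f s) = x"
  then obtain u where "\<forall>s\<in>S. 0 \<le> u s" "sum u S = 1" "(\<Sum>s\<in>S. u s *\<^sub>R f s) = x" by blast
  then show "x \<in> convex hull (f ` S)"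
    using S convex_sum[OF S convex_convex_hull, of u "\<lambda>s. f s" "f ` S"] hull_inc[of _ "f ` S"] by auto
qed

section \<open>Gluing along a key\<close>

text \<open>Vertices of a simplex: among points tagged in this way, the tag of a convex combination
  is the distribution of the keys.\<close>

definition point_mass :: "'k \<Rightarrow> 'k \<Rightarrow> real" where
  "point_mass a = (\<lambda>b. if b = a then 1 else 0)"

text \<open>The two hypotheses give distributions on \<open>S\<close> with the same key marginal
  \<open>d\<close>. They are coupled independently given the key, and \<open>mix\<close> realizes
  each pair with a common key by one element of \<open>S\<close>.\<close>

lemma convex_hull_glue:
  fixes a1 :: "'s \<Rightarrow> 'a::real_vector" and a2 :: "'s \<Rightarrow> 'b::real_vector" and key :: "'s \<Rightarrow> 'k"
  assumes S: "finite S"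
    and mix: "\<And>s s'. s \<in> S \<Longrightarrow> s' \<in> S \<Longrightarrow> key s = key s' \<Longrightarrow>
      \<exists>u\<in>S. key u = key s \<and> a1 u = a1 s \<and> a2 u = a2 s'"
    and x: "(x, d) \<in> convex hull ((\<lambda>s. (a1 s, point_mass (key s))) ` S)"
    and y: "(y, d) \<in> convex hull ((\<lambda>s. (a2 s, point_mass (key s))) ` S)"
  shows "(x, y, d) \<in> convex hull ((\<lambda>s. (a1 s, a2 s, point_mass (key s))) ` S)"
proof -
  obtain l where l: "\<forall>s\<in>S. 0 \<le> l s" "sum l S = 1"
     "(\<Sum>s\<in>S. l s *\<^sub>R (a1 s, point_mass (key s))) = (x, d)"
    using x unfolding convex_hull_image_finite[OF S] by blast
  obtain m where m: "\<forall>s\<in>S. 0 \<le> m s" "sum m S = 1"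
     "(\<Sum>s\<in>S. m s *\<^sub>R (a2 s, point_mass (key s))) = (y, d)"
    using y unfolding convex_hull_image_finite[OF S] by blast
  have lx: "x = (\<Sum>s\<in>S. l s *\<^sub>R a1 s)" and ld: "d = (\<Sum>s\<in>S. l s *\<^sub>R point_mass (key s))"
    using arg_cong[OF l(3), of fst] arg_cong[OF l(3), of snd] by (simp_all add: fst_sum snd_sum)
  have my: "y = (\<Sum>s\<in>S. m s *\<^sub>R a2 s)" and md: "d = (\<Sum>s\<in>S. m s *\<^sub>R point_mass (key s))"
    using arg_cong[OF m(3), of fst] arg_cong[OF m(3), of snd] by (simp_all add: fst_sum snd_sum)
  have dl: "d k = (\<Sum>s\<in>S. if key s = k then l s else 0)" for k
    unfolding ld sum_fun_apply by (intro sum.cong) (auto simp: point_mass_def)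
  have dm: "d k = (\<Sum>s\<in>S. if key s = k then m s else 0)" for k
    unfolding md sum_fun_apply by (intro sum.cong) (auto simp: point_mass_def)
  have d0: "0 \<le> d k" for k unfolding dl using l by (intro sum_nonneg) auto
  have ld0: "l s = 0" if "s \<in> S" "d (key s) = 0" for s
  proof -
    have "(if key s = key s then l s else 0) = 0"
      by (rule sum_nonneg_0[OF S, of "\<lambda>t. if key t = key s then l t else 0"])
         (use l(1) that in \<open>auto simp: dl\<close>)
    then show ?thesis by simp
  qed
  have md0: "m s = 0" if "s \<in> S" "d (key s) = 0" for s
  proof -
    have "(if key s = key s then m s else 0) = 0"
      by (rule sum_nonneg_0[OF S, of "\<lambda>t. if key t = key s then m t else 0"])
         (use m(1) that in \<open>auto simp: dm\<close>)
    then show ?thesis by simp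
  qed
  \<comment> \<open>The conditionally independent coupling. Division by zero is harmless: where
    \<open>d\<close> vanishes, so do \<open>l\<close> and \<open>m\<close>.\<close>
  define n where "n s t = (if key s = key t then l s * m t / d (key s) else 0)" for s t
  have n1: "(\<Sum>t\<in>S. n s t) = l s" if s: "s \<in> S" for s
  proof -
    have "(\<Sum>t\<in>S. n s t) = (\<Sum>t\<in>S. l s / d (key s) * (if key t = key s then m t else 0))"
      by (intro sum.cong) (auto simp: n_def)
    also have "\<dots> = l s / d (key s) * d (key s)" by (simp add: dm sum_distrib_left)
    finally show ?thesis using ld0[OF s] by (cases "d (key s) = 0") auto
  qed
  have n2: "(\<Sum>s\<in>S. n s t) = m t" if t: "t \<in> S" for t
  proof -
    have "(\<Sum>s\<in>S. n s t) = (\<Sum>s\<in>S. m t / d (key t) * (if key s = key t then l s else 0))"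
      by (intro sum.cong) (auto simp: n_def)
    also have "\<dots> = m t / d (key t) * d (key t)" by (simp add: dl sum_distrib_left)
    finally show ?thesis using md0[OF t] by (cases "d (key t) = 0") auto
  qed
  obtain g where g: "\<And>s s'. s \<in> S \<Longrightarrow> s' \<in> S \<Longrightarrow> key s = key s' \<Longrightarrow>
      g s s' \<in> S \<and> key (g s s') = key s \<and> a1 (g s s') = a1 s \<and> a2 (g s s') = a2 s'"
    using mix by metis
  let ?F = "\<lambda>s. (a1 s, a2 s, point_mass (key s))"
  \<comment> \<open>Pairs with different keys have weight 0; their value only has to lie in the
    hull.\<close>
  define G where "G = (\<lambda>(s, t). if key s = key t then ?F (g s t) else ?F s)"
  have "(\<Sum>p\<in>S \<times> S. (case p of (s, t) \<Rightarrow> n s t) *\<^sub>R G p) \<in> convex hull (?F ` S)"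
  proof (rule convex_sum)
    show "(\<Sum>p\<in>S \<times> S. case p of (s, t) \<Rightarrow> n s t) = 1"
      using n1 l(2) by (simp add: sum.cartesian_product[symmetric])
    show "0 \<le> (case p of (s, t) \<Rightarrow> n s t)" if "p \<in> S \<times> S" for p
      using that l m d0 by (auto simp: n_def)
    show "G p \<in> convex hull (?F ` S)" if pS: "p \<in> S \<times> S" for p
    proof -
      obtain s t where p: "p = (s, t)" "s \<in> S" "t \<in> S" using pS by blast
      show ?thesis
      proof (cases "key s = key t")
        case True
        with g[OF p(2,3) True] have "g s t \<in> S" "G p = ?F (g s t)" unfolding G_def p(1) by simp_all
        then show ?thesis by (auto intro: hull_inc)
      next
        case False
        then have "G p = ?F s" unfolding G_def p(1) by simp
        then show ?thesis using p(2) by (auto intro: hull_inc)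
      qed
    qed
  qed (use S in auto)
  also have "(\<Sum>p\<in>S \<times> S. (case p of (s, t) \<Rightarrow> n s t) *\<^sub>R G p) =
      (\<Sum>s\<in>S. \<Sum>t\<in>S. n s t *\<^sub>R (a1 s, a2 t, point_mass (key s)))"
    unfolding sum.cartesian_product
  proof (intro sum.cong refl)
    fix p assume "p \<in> S \<times> S"
    then obtain s t where p: "p = (s, t)" "s \<in> S" "t \<in> S" by blast
    show "(case p of (s, t) \<Rightarrow> n s t) *\<^sub>R G p = (case p of (s, t) \<Rightarrow> n s t *\<^sub>R (a1 s, a2 t, point_mass (key s)))"
      using g[OF p(2,3)] by (cases "key s = key t") (simp_all add: p(1) G_def n_def)
  qed
  also have "\<dots> = (x, y, d)"
  proof -
    have "(\<Sum>s\<in>S. \<Sum>t\<in>S. n s t *\<^sub>R a1 s) = x"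
      using n1 by (simp add: lx scaleR_sum_left[symmetric])
    moreover have "(\<Sum>s\<in>S. \<Sum>t\<in>S. n s t *\<^sub>R a2 t) = y"
      using n2 by (subst sum.swap) (simp add: my scaleR_sum_left[symmetric])
    moreover have "(\<Sum>s\<in>S. \<Sum>t\<in>S. n s t *\<^sub>R point_mass (key s)) = d"
      using n1 by (simp add: ld scaleR_sum_left[symmetric])
    ultimately show ?thesis by (simp add: prod_eq_iff fst_sum snd_sum)
  qed
  finally show ?thesis .
qed

text \<open>The hull is the fibre product of the two tagged hulls over the key component: the
  section of their product by the subspace on which the tags agree.\<close>

lemma sdp_lift_glue:
  fixes a1 :: "'s \<Rightarrow> 'a::real_vector" and a2 :: "'s \<Rightarrow> 'b::real_vector" and key :: "'s \<Rightarrow> 'k"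
  assumes S: "finite S"
    and mix: "\<And>s s'. s \<in> S \<Longrightarrow> s' \<in> S \<Longrightarrow> key s = key s' \<Longrightarrow>
      \<exists>u\<in>S. key u = key s \<and> a1 u = a1 s \<and> a2 u = a2 s'"
    and r1: "sdp_lift (convex hull ((\<lambda>s. (a1 s, point_mass (key s))) ` S)) r1"
    and r2: "sdp_lift (convex hull ((\<lambda>s. (a2 s, point_mass (key s))) ` S)) r2"
  shows "sdp_lift (convex hull ((\<lambda>s. (a1 s, a2 s, point_mass (key s))) ` S)) (r1 + r2)"
proof -
  let ?Q1 = "convex hull ((\<lambda>s. (a1 s, point_mass (key s))) ` S)"
  let ?Q2 = "convex hull ((\<lambda>s. (a2 s, point_mass (key s))) ` S)"
  let ?Q = "convex hull ((\<lambda>s. (a1 s, a2 s, point_mass (key s))) ` S)"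
  let ?A = "{p :: ('a \<times> ('k \<Rightarrow> real)) \<times> ('b \<times> ('k \<Rightarrow> real)). snd (fst p) = snd (snd p)}"
  let ?L = "\<lambda>p :: ('a \<times> ('k \<Rightarrow> real)) \<times> ('b \<times> ('k \<Rightarrow> real)). (fst (fst p), fst (snd p), snd (snd p))"
  have "affine ?A" by (auto simp: affine_def)
  moreover have L: "linear ?L" by (rule linearI) auto
  ultimately have "sdp_lift (?L ` ((?Q1 \<times> ?Q2) \<inter> ?A)) (r1 + r2)"
    by (intro sdp_lift_linear_image sdp_lift_Int_affine sdp_lift_Times r1 r2)
  moreover have "?L ` ((?Q1 \<times> ?Q2) \<inter> ?A) = ?Q"
  proof (intro equalityI subsetI)
    fix q assume "q \<in> ?L ` ((?Q1 \<times> ?Q2) \<inter> ?A)"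
    then obtain x y d where xyd: "(x, d) \<in> ?Q1" "(y, d) \<in> ?Q2" "q = (x, y, d)"
      by (clarsimp simp del: split_paired_All)
    show "q \<in> ?Q" unfolding xyd(3) by (rule convex_hull_glue[OF S mix xyd(1,2)])
  next
    have proj: "linear (\<lambda>q :: 'a \<times> 'b \<times> ('k \<Rightarrow> real). (fst q, snd (snd q)))"
      "linear (\<lambda>q :: 'a \<times> 'b \<times> ('k \<Rightarrow> real). snd q)" by (rule linearI; simp)+
    fix q assume q: "q \<in> ?Q"
    have "(fst q, snd (snd q)) \<in> ?Q1" "snd q \<in> ?Q2"
      using in_convex_hull_linear_image[OF proj(1) q] in_convex_hull_linear_image[OF proj(2) q]
      by (simp_all add: image_image)
    then have "((fst q, snd (snd q)), snd q) \<in> (?Q1 \<times> ?Q2) \<inter> ?A" by simp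
    moreover have "?L ((fst q, snd (snd q)), snd q) = q" by simp
    ultimately show "q \<in> ?L ` ((?Q1 \<times> ?Q2) \<inter> ?A)" by (metis (no_types, lifting) imageI)
  qed
  ultimately show ?thesis by simp
qed

section \<open>Joins of blocks\<close>

text \<open>The block \<open>i\<close> consists of the coordinates \<open>i * (w + 1), \<dots>, i * (w + 1) + w\<close>.
  Its first coordinate is a switch; the switches are nonincreasing, and only the last block that is
  switched on carries a point of \<open>A\<close>.\<close>

definition block_point :: "nat \<Rightarrow> nat \<Rightarrow> (nat \<Rightarrow> real) \<Rightarrow> nat \<Rightarrow> real" where
  "block_point w i p = (\<lambda>u. if u mod Suc w = 0 then (if u div Suc w \<le> i then 1 else 0)
     else if u div Suc w = i then p (u mod Suc w - 1) else 0)"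

definition blocks :: "nat \<Rightarrow> nat \<Rightarrow> (nat \<Rightarrow> real) set \<Rightarrow> (nat \<Rightarrow> real) set" where
  "blocks w k A = insert 0 (\<Union>i<k. block_point w i ` A)"

lemma finite_blocks: "finite A \<Longrightarrow> finite (blocks w k A)"
  by (simp add: blocks_def)

lemma block_point_switch: "block_point w i p (k * Suc w) = (if k \<le> i then 1 else 0)"
proof -
  have "(k * Suc w) mod Suc w = 0" "(k * Suc w) div Suc w = k" by (simp_all del: mult_Suc_right)
  then show ?thesis unfolding block_point_def by presburger
qed

lemma block_point_coord:
  assumes "j < w"
  shows "block_point w i p (Suc (k * Suc w + j)) = (if k = i then p j else 0)"
proof -
  have eq: "Suc (k * Suc w + j) = k * Suc w + Suc j" by simp
  have *: "(k * Suc w + Suc j) mod Suc w = Suc j" using assms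
    by (metis Suc_less_eq add.commute mod_less mod_mult_self1)
  have "(k * Suc w + Suc j) div Suc w = k"
    using assms by (metis Suc_less_eq add.right_neutral add.commute div_less div_mult_self1 nat.simps(3))
  then show ?thesis unfolding block_point_def eq * by simp
qed

text \<open>The asserted properties define a convex set containing the generators. For a mixture of
  positive height, the point of \<open>P\<close> is the mean of the two given ones, weighted by
  their shares of the height.\<close>

lemma convex_hull_join:
  fixes h :: "'a::real_vector \<Rightarrow> real" and \<rho> :: "'a \<Rightarrow> 'b::real_vector"
  assumes h: "linear h" and \<rho>: "linear \<rho>" and P: "convex P" "P \<noteq> {}"
    and S1: "\<And>s. s \<in> S1 \<Longrightarrow> h s = 0 \<and> \<rho> s = 0"
    and S2: "\<And>s. s \<in> S2 \<Longrightarrow> h s = 1 \<and> \<rho> s \<in> P"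
    and q: "q \<in> convex hull (S1 \<union> S2)"
  shows "0 \<le> h q \<and> (\<exists>p\<in>P. \<rho> q = h q *\<^sub>R p) \<and> (h q = 0 \<longrightarrow> q \<in> convex hull S1)"
proof -
  let ?C = "{q. 0 \<le> h q \<and> (\<exists>p\<in>P. \<rho> q = h q *\<^sub>R p) \<and> (h q = 0 \<longrightarrow> q \<in> convex hull S1)}"
  have "convex ?C"
  proof (rule convexI)
    fix x y u v assume x: "x \<in> ?C" and y: "y \<in> ?C" and uv: "0 \<le> u" "0 \<le> v" "u + v = (1::real)"
    obtain p where p: "p \<in> P" "\<rho> x = h x *\<^sub>R p" using x by blast
    obtain p' where p': "p' \<in> P" "\<rho> y = h y *\<^sub>R p'" using y by blast
    let ?z = "u *\<^sub>R x + v *\<^sub>R y"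
    have hz: "h ?z = u * h x + v * h y" by (simp add: linear_add[OF h] linear_scale[OF h])
    have \<rho>z: "\<rho> ?z = (u * h x) *\<^sub>R p + (v * h y) *\<^sub>R p'"
      by (simp add: linear_add[OF \<rho>] linear_scale[OF \<rho>] p p')
    have nn: "0 \<le> u * h x" "0 \<le> v * h y" using x y uv by auto
    have "\<exists>p\<in>P. \<rho> ?z = h ?z *\<^sub>R p"
    proof (cases "h ?z = 0")
      case True
      then have "u * h x = 0" "v * h y = 0" using nn hz by linarith+
      then show ?thesis using True p(1) unfolding \<rho>z True by auto
    next
      case False
      let ?t = "h ?z"
      have "((u * h x) / ?t) *\<^sub>R p + ((v * h y) / ?t) *\<^sub>R p' \<in> P"
        using False nn hz p(1) p'(1) by (intro convexD[OF P(1)]) (auto simp: add_divide_distrib[symmetric])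
      moreover have "\<rho> ?z = ?t *\<^sub>R (((u * h x) / ?t) *\<^sub>R p + ((v * h y) / ?t) *\<^sub>R p')"
        unfolding \<rho>z using False by (simp add: scaleR_right_distrib)
      ultimately show ?thesis by blast
    qed
    moreover have "?z \<in> convex hull S1" if "h ?z = 0"
    proof -
      have "u * h x = 0" "v * h y = 0" using that nn hz by linarith+
      then have *: "u = 0 \<or> x \<in> convex hull S1" "v = 0 \<or> y \<in> convex hull S1" using x y by auto
      show ?thesis
      proof (cases "u = 0 \<or> v = 0")
        case True
        then show ?thesis using * uv by auto
      next
        case False
        then show ?thesis using * uv by (intro convexD[OF convex_convex_hull]) auto
      qed
    qed
    moreover have "0 \<le> h ?z" using nn hz by linarith
    ultimately show "?z \<in> ?C" by blast
  qed
  moreover have "S1 \<union> S2 \<subseteq> ?C"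
  proof
    fix s assume "s \<in> S1 \<union> S2"
    then show "s \<in> ?C"
    proof
      assume s: "s \<in> S1"
      with S1[OF s] P(2) show ?thesis by (auto intro: hull_inc)
    next
      assume s: "s \<in> S2"
      with S2[OF s] show ?thesis by auto
    qed
  qed
  ultimately have "convex hull (S1 \<union> S2) \<subseteq> ?C" by (intro hull_minimal)
  with q show ?thesis by blast
qed

text \<open>Take \<open>h\<close> to be the last switch. The face where it is 0 is the hull of the
  first \<open>k\<close> blocks, and the face where it is 1 projects onto
  \<open>convex hull A\<close>, so \<open>sdp_lift_join\<close> removes one block. The bound
  \<open>1 \<le> r2\<close> accounts for the \<open>max 1\<close>.\<close>

lemma lift_order_blocks:
  notes mult_Suc_right [simp del]
  assumes A: "A \<subseteq> cube w" "A \<noteq> {}"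
  shows "sdp_lift (convex hull (blocks w k A)) r \<Longrightarrow> k * max 1 (lift_order (convex hull A)) \<le> r"
proof (induction k arbitrary: r)
  case (Suc k)
  let ?Q = "convex hull (blocks w (Suc k) A)" and ?P = "convex hull A"
  let ?F = "convex hull (blocks w k A)"
  define h where "h q = q (k * Suc w)" for q :: "nat \<Rightarrow> real"
  define \<rho> where "\<rho> q = (\<lambda>j. if j < w then q (Suc (k * Suc w + j)) else 0)" for q :: "nat \<Rightarrow> real"
  have finA: "finite A" using A(1) finite_cube finite_subset by blast
  have lin: "linear h" "linear \<rho>"
    by (rule linearI; simp add: h_def \<rho>_def fun_eq_iff)+
  have Neq: "blocks w (Suc k) A = blocks w k A \<union> block_point w k ` A"
    by (auto simp: blocks_def lessThan_Suc)
  have A_R: "p j = 0" if "p \<in> A" "\<not> j < w" for p j using A that by (auto simp: cube_def Rn_def)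
  have \<rho>_block: "\<rho> (block_point w k p) = p" if "p \<in> A" for p
    using A_R[OF that] by (auto simp: \<rho>_def fun_eq_iff block_point_coord)
  have S1: "h s = 0 \<and> \<rho> s = 0" if "s \<in> blocks w k A" for s
    using that by (auto simp: blocks_def h_def \<rho>_def fun_eq_iff block_point_switch block_point_coord)
  have S2: "h s = 1 \<and> \<rho> s \<in> ?P" if "s \<in> block_point w k ` A" for s
  proof -
    obtain p where p: "p \<in> A" "s = block_point w k p" using \<open>s \<in> _\<close> by blast
    show ?thesis using p \<rho>_block[OF p(1)] by (auto simp: h_def block_point_switch hull_inc)
  qed
  have join: "0 \<le> h q \<and> (\<exists>p\<in>?P. \<rho> q = h q *\<^sub>R p) \<and> (h q = 0 \<longrightarrow> q \<in> ?F)" if "q \<in> ?Q" for q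
    by (rule convex_hull_join[OF lin convex_convex_hull _ S1 S2]) (use that A(2) in \<open>simp_all add: Neq\<close>)
  have F: "?F = {q \<in> ?Q. h q = 0}"
  proof (intro equalityI subsetI)
    fix q assume q: "q \<in> ?F"
    have "?F \<subseteq> ?Q" unfolding Neq by (rule hull_mono) auto
    moreover have "h q \<in> h ` ?F" using q by blast
    then have "h q \<in> convex hull (h ` blocks w k A)" using convex_hull_linear_image[OF lin(1)] by metis
    then have "h q \<in> convex hull {0}" using S1 hull_mono[of "h ` blocks w k A" "{0}" convex] by auto
    ultimately show "q \<in> {q \<in> ?Q. h q = 0}" using q by auto
  qed (use join in blast)
  have "\<exists>r1 r2. sdp_lift ?F r1 \<and> sdp_lift ?P r2 \<and> 1 \<le> r2 \<and> r1 + r2 \<le> r"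
  proof (rule sdp_lift_join[OF Suc.prems lin])
    show "\<exists>q\<in>?Q. h q = 1 \<and> \<rho> q = p" if pP: "p \<in> ?P" for p
    proof -
      have "h ` (convex hull (block_point w k ` A)) = {1}"
        using A(2) S2 unfolding convex_hull_linear_image[OF lin(1)] by (subgoal_tac "h ` block_point w k ` A = {1}") (simp, force)
      moreover have "\<rho> ` block_point w k ` A = A"
        using \<rho>_block by (simp add: image_image)
      then have "\<rho> ` (convex hull (block_point w k ` A)) = ?P"
        unfolding convex_hull_linear_image[OF lin(2)] by simp
      ultimately have "p \<in> \<rho> ` (convex hull (block_point w k ` A))"
          and h1: "h ` (convex hull (block_point w k ` A)) = {1}"
        using pP by simp_all
      then obtain q where q: "q \<in> convex hull (block_point w k ` A)" "p = \<rho> q" by (elim imageE)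
      have "h q \<in> h ` (convex hull (block_point w k ` A))" using q(1) by (rule imageI)
      then have "h q = 1" unfolding h1 by simp
      moreover have "convex hull (block_point w k ` A) \<subseteq> ?Q" unfolding Neq by (rule hull_mono) auto
      ultimately show ?thesis using q by (intro bexI[of _ q]) auto
    qed
    show "?F \<noteq> {}" "?P \<noteq> {}" using A(2) by (auto simp: blocks_def)
  next
    fix p p1 :: "nat \<Rightarrow> real"
    assume "\<And>\<delta>. 0 < \<delta> \<Longrightarrow> \<delta> < 1 \<Longrightarrow> (1 - \<delta>) *\<^sub>R p + \<delta> *\<^sub>R p1 \<in> ?P"
    then show "p \<in> ?P" by (rule convex_hull_segment_closed[OF finA])
  qed (use join F in blast)+
  then obtain r1 r2 where r: "sdp_lift ?F r1" "sdp_lift ?P r2" "1 \<le> r2" "r1 + r2 \<le> r" by blast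
  have "max 1 (lift_order ?P) \<le> r2" using r(3) lift_order_le[OF r(2)] by simp
  with Suc.IH[OF r(1)] r(4) show ?case unfolding mult_Suc by linarith
qed simp

section \<open>Chordal graphs\<close>

definition nbhd :: "'v set set \<Rightarrow> 'v set \<Rightarrow> 'v set" where
  "nbhd F T = {y. y \<notin> T \<and> (\<exists>x\<in>T. {x, y} \<in> F)}"

lemma nbhd_subset: "simple_graph V F \<Longrightarrow> nbhd F T \<subseteq> V"
  by (auto simp: nbhd_def simple_graph_def)

lemma is_clique_subset: "is_clique V F K \<Longrightarrow> K' \<subseteq> K \<Longrightarrow> is_clique V F K'"
  by (auto simp: is_clique_def)

text \<open>Let \<open>v\<close> have the most neighbours in the boundary clique, and suppose that
  it misses \<open>y\<close>. A shortest walk inside \<open>T\<close> from \<open>v\<close> to a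
  neighbour of \<open>y\<close> ends in a vertex that, by maximality of \<open>v\<close>, misses
  some neighbour \<open>x\<close> of \<open>v\<close>. A part of the walk together with
  \<open>x\<close> and \<open>y\<close> is a chordless cycle.\<close>

lemma chordal_complete_vertex:
  assumes G: "simple_graph V F" "chordal F" and T: "T \<subseteq> V" "T \<noteq> {}"
    and clique: "is_clique V F (nbhd F T)"
    and conn: "\<And>T1 T2. T = T1 \<union> T2 \<Longrightarrow> T1 \<inter> T2 = {} \<Longrightarrow> T1 \<noteq> {} \<Longrightarrow> T2 \<noteq> {} \<Longrightarrow>
      \<exists>x\<in>T1. \<exists>y\<in>T2. {x, y} \<in> F"
  shows "\<exists>v\<in>T. \<forall>y\<in>nbhd F T. {v, y} \<in> F"
proof (rule ccontr)
  assume neg: "\<not> ?thesis"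
  let ?N = "nbhd F T"
  have finT: "finite T" using G T finite_subset by (auto simp: simple_graph_def)
  have finN: "finite ?N" using G(1) finite_subset[OF nbhd_subset[OF G(1)]] by (simp add: simple_graph_def)
  define d where "d v = card {y \<in> ?N. {v, y} \<in> F}" for v
  obtain v where v: "v \<in> T" "\<And>w. w \<in> T \<Longrightarrow> d w \<le> d v"
    using finT T(2) Max_ge[of "d ` T"] Max_in[of "d ` T"]
    by (metis (no_types, lifting) finite_imageI image_eqI image_is_empty imageE)
  obtain y where y: "y \<in> ?N" "{v, y} \<notin> F" using neg v(1) by blast
  let ?E = "\<lambda>a b. {a, b} \<in> F"
  define walk where "walk p \<longleftrightarrow> p \<noteq> [] \<and> set p \<subseteq> T \<and> hd p = v \<and> successively ?E p" for p
  have reach: "\<exists>p. walk p \<and> last p = x" if x: "x \<in> T" for x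
  proof (rule ccontr)
    assume nx: "\<not> ?thesis"
    let ?R = "{x \<in> T. \<exists>p. walk p \<and> last p = x}"
    have "walk [v]" using v by (simp add: walk_def)
    then have "v \<in> ?R" using v(1) by auto
    then have "\<exists>a\<in>?R. \<exists>b\<in>T - ?R. {a, b} \<in> F" using x nx by (intro conn) auto
    then obtain a b p where ab: "a \<in> T" "b \<in> T" "{a, b} \<in> F" "walk p" "last p = a" "\<not> (\<exists>p. walk p \<and> last p = b)"
      by blast
    have "walk (p @ [b])" using ab by (auto simp: walk_def successively_append_iff)
    then show False using ab(6) by (metis last_snoc)
  qed
  let ?W = "\<lambda>p. walk p \<and> {last p, y} \<in> F"
  obtain w where "w \<in> T" "{w, y} \<in> F" using y(1) by (auto simp: nbhd_def)
  then have "\<exists>p. ?W p" using reach by blast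
  then obtain p where p: "?W p" and pmin: "\<And>q. ?W q \<Longrightarrow> length p \<le> length q"
    using ex_has_least_nat[of ?W _ length] by blast
  let ?m = "length p - 1"
  have pne: "p \<noteq> []" and pT: "set p \<subseteq> T" and phd: "hd p = v" and psucc: "successively ?E p"
    using p by (auto simp: walk_def)
  have lastp: "last p = p ! ?m" using pne by (rule last_conv_nth)
  have p0: "p ! 0 = v" using phd pne by (simp add: hd_conv_nth)
  have no_y: "{p ! i, y} \<notin> F" if i: "i < ?m" for i
  proof
    assume e: "{p ! i, y} \<in> F"
    have il: "Suc i \<le> length p" using i by simp
    have "successively ?E (take (Suc i) p @ drop (Suc i) p)" using psucc by simp
    then have "successively ?E (take (Suc i) p)" by (simp only: successively_append_iff)
    moreover have "last (take (Suc i) p) = p ! i" using i by (simp add: take_Suc_conv_app_nth)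
    ultimately have "?W (take (Suc i) p)"
      using e pne pT phd set_take_subset[of "Suc i" p] by (auto simp: walk_def)
    from pmin[OF this] i show False by simp
  qed
  \<comment> \<open>Removing the entries from \<open>i\<close> up to \<open>j - 1\<close> would give
    a shorter walk. This yields both distinctness and the absence of chords.\<close>
  have no_skip: False if ij: "i < j" "j < length p" "i = 0 \<or> {p ! (i - 1), p ! j} \<in> F" "i = 0 \<longrightarrow> p ! j = v" for i j
  proof -
    have "successively ?E (take i p @ drop i p)" "successively ?E (take j p @ drop j p)" using psucc by simp_all
    then have s: "successively ?E (take i p)" "successively ?E (drop j p)" by (simp_all only: successively_append_iff)
    have hdj: "hd (drop j p) = p ! j" using ij by (simp add: hd_drop_conv_nth)
    have "last (take i p) = p ! (i - 1)" if "i \<noteq> 0"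
      using that ij pne by (subst last_conv_nth) (auto simp: min_def)
    then have "successively ?E (take i p @ drop j p)"
      using s hdj ij by (cases "i = 0") (auto simp: successively_append_iff)
    moreover have "hd (take i p @ drop j p) = v"
      using ij hdj phd pne by (cases "i = 0") (auto simp: hd_append)
    moreover have "last (take i p @ drop j p) = last p" using ij by (simp add: last_append)
    moreover have "set (take i p @ drop j p) \<subseteq> T"
      using pT set_take_subset[of i p] set_drop_subset[of j p] by auto
    ultimately have "?W (take i p @ drop j p)" using p ij by (auto simp: walk_def)
    from pmin[OF this] ij show False by simp
  qed
  have dist: "distinct p"
  proof -
    have "p ! i \<noteq> p ! j" if ij: "i < j" "j < length p" for i j
    proof
      assume eq: "p ! i = p ! j"
      have "i = 0 \<or> {p ! (i - 1), p ! j} \<in> F"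
      proof (cases i)
        case (Suc k)
        then have "{p ! k, p ! Suc k} \<in> F" using psucc ij unfolding successively_conv_nth by auto
        then show ?thesis using Suc eq by simp
      qed simp
      moreover have "i = 0 \<longrightarrow> p ! j = v" using eq p0 by auto
      ultimately show False by (rule no_skip[OF ij])
    qed
    then show ?thesis by (metis distinct_conv_nth linorder_neqE_nat)
  qed
  have induced: "{p ! i, p ! j} \<notin> F" if ij: "Suc i < j" "j < length p" for i j
    using no_skip[of "Suc i" j] ij by auto
  let ?w = "last p"
  have wT: "?w \<in> T" using pne pT by auto
  have m1: "?m \<ge> 1"
  proof (rule ccontr)
    assume "\<not> ?m \<ge> 1"
    then have "?w = v" using lastp p0 by simp
    then show False using p y by simp
  qed
  \<comment> \<open>The last vertex sees \<open>y\<close>, which \<open>v\<close> does not; having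
    no more neighbours in the boundary than \<open>v\<close>, it must miss one of those of
    \<open>v\<close>.\<close>
  obtain x where x: "x \<in> ?N" "{v, x} \<in> F" "{?w, x} \<notin> F"
  proof (rule ccontr)
    assume nth: "\<not> thesis"
    then have "{y \<in> ?N. {v, y} \<in> F} \<subset> {y \<in> ?N. {?w, y} \<in> F}" using that y p by blast
    then have "d v < d ?w" unfolding d_def using finN by (intro psubset_card_mono) auto
    with v(2)[OF wT] show False by simp
  qed
  have xy: "x \<noteq> y" "{x, y} \<in> F" using x y clique p by (auto simp: is_clique_def)
  have xT: "x \<notin> T" and yT: "y \<notin> T" using x y by (auto simp: nbhd_def)
  \<comment> \<open>Starting the cycle at the last neighbour of \<open>x\<close> on the walk
    excludes chords at \<open>x\<close>.\<close>
  define i where "i = Max {i. i < length p \<and> {p ! i, x} \<in> F}"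
  have fin: "finite {i. i < length p \<and> {p ! i, x} \<in> F}" by auto
  have "0 \<in> {i. i < length p \<and> {p ! i, x} \<in> F}" using pne p0 x by auto
  then have "i \<in> {i. i < length p \<and> {p ! i, x} \<in> F}" unfolding i_def using fin by (intro Max_in) auto
  then have i: "i < length p" "{p ! i, x} \<in> F" by auto
  have imax: "{p ! j, x} \<notin> F" if "i < j" "j < length p" for j
  proof
    assume "{p ! j, x} \<in> F"
    then have "j \<le> i" unfolding i_def using that by (intro Max_ge[OF fin]) auto
    then show False using that by simp
  qed
  have im: "i < ?m" using i x(3) lastp by (cases "i = ?m") auto
  let ?q = "drop i p" let ?l = "length p - i"
  define c where "c = x # ?q @ [y]"
  have len: "length c = ?l + 2" using i by (simp add: c_def)
  have c0: "c ! 0 = x" and cq: "\<And>t. t < ?l \<Longrightarrow> c ! Suc t = p ! (i + t)" and cl: "c ! Suc ?l = y"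
    by (auto simp: c_def nth_append)
  have "is_cycle F c"
    unfolding is_cycle_def
  proof (intro conjI allI impI)
    show "3 \<le> length c" using len im by simp
    show "distinct c" using dist xT yT xy pT set_drop_subset[of i p] by (auto simp: c_def)
    fix j assume j: "j < length c"
    consider "j = 0" | t where "j = Suc t" "Suc t < ?l" | "j = ?l" | "j = Suc ?l"
      using j len by (cases j) (auto, linarith)
    then show "{c ! j, c ! (Suc j mod length c)} \<in> F"
    proof cases
      case 1
      then have "Suc j mod length c = Suc 0" using len by simp
      then show ?thesis using 1 c0 cq[of 0] i im by (simp add: insert_commute)
    next
      case (2 t)
      then have "Suc j mod length c = Suc (Suc t)" using len by simp
      moreover have "{p ! (i + t), p ! Suc (i + t)} \<in> F"
        using psucc 2 unfolding successively_conv_nth by auto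
      ultimately show ?thesis using 2 cq[of t] cq[of "Suc t"] by simp
    next
      case 3
      then have "Suc j mod length c = Suc ?l" using len by simp
      moreover have "c ! j = ?w" using 3 im cq[of "?l - 1"] lastp by (simp add: Suc_diff_Suc)
      ultimately show ?thesis using p cl by simp
    next
      case 4
      then have "Suc j mod length c = 0" using len by simp
      then show ?thesis using 4 c0 cl xy by (simp add: insert_commute)
    qed
  qed
  moreover have "length c \<ge> 4" using len im by simp
  ultimately have "has_chord F c" using G(2) unfolding chordal_def by blast
  then obtain a b where ab: "a < length c" "b < length c" "a \<noteq> b" "b \<noteq> Suc a mod length c"
    "a \<noteq> Suc b mod length c" "{c ! a, c ! b} \<in> F" unfolding has_chord_def by blast
  have chord: False if ab: "a < b" "b < length c" "b \<noteq> Suc a mod length c"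
    "a \<noteq> Suc b mod length c" "{c ! a, c ! b} \<in> F" for a b
  proof -
    have b1: "b \<noteq> Suc a" using ab by auto
    have b2: "\<not> (a = 0 \<and> b = Suc ?l)" using ab len by auto
    obtain t where t: "b = Suc t" using ab by (cases b) auto
    show False
    proof (cases a)
      case 0
      then have "t < ?l" "0 < t" using t b1 b2 ab len by auto
      moreover from this have "i + t < length p" by simp
      ultimately show False using ab(5) imax[of "i + t"] cq[of t] c0 0 t by (simp add: insert_commute)
    next
      case (Suc s)
      then have s: "s < ?l" "s < t" "t \<noteq> Suc s" using t ab b1 len by auto
      show False
      proof (cases "t < ?l")
        case True
        then have "i + t < length p" by simp
        then show False using True induced[of "i + s" "i + t"] s ab(5) cq[of s] cq[of t] Suc t by simp
      next
        case False
        then have "t = ?l" using t ab len by simp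
        then have "i + s < ?m" using s by simp
        then show False using \<open>t = ?l\<close> no_y[of "i + s"] s ab(5) cq[of s] cl Suc t by simp
      qed
    qed
  qed
  show False
  proof (cases "a < b")
    case True
    then show False using chord[OF True] ab by blast
  next
    case False
    then have "b < a" using ab by simp
    then show False using chord[of b a] ab by (simp add: insert_commute)
  qed
qed

text \<open>The recursion behind a junction tree: a piece with clique boundary falls apart, or one
  of its vertices can be moved into the separator. The smaller pieces again have clique
  boundaries.\<close>

lemma chordal_cases:
  assumes "simple_graph V F" "chordal F" "T \<subseteq> V" "T \<noteq> {}" "is_clique V F (nbhd F T)"
  obtains (split) T1 T2 where "T = T1 \<union> T2" "T1 \<inter> T2 = {}" "T1 \<noteq> {}" "T2 \<noteq> {}"
      "nbhd F T1 \<subseteq> nbhd F T" "nbhd F T2 \<subseteq> nbhd F T"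
    | (complete) v where "v \<in> T" "is_clique V F (insert v (nbhd F T))" "nbhd F (T - {v}) \<subseteq> insert v (nbhd F T)"
proof (cases "\<exists>T1 T2. T = T1 \<union> T2 \<and> T1 \<inter> T2 = {} \<and> T1 \<noteq> {} \<and> T2 \<noteq> {} \<and> (\<forall>x\<in>T1. \<forall>y\<in>T2. {x, y} \<notin> F)")
  case True
  then obtain T1 T2 where *: "T = T1 \<union> T2" "T1 \<inter> T2 = {}" "T1 \<noteq> {}" "T2 \<noteq> {}" "\<forall>x\<in>T1. \<forall>y\<in>T2. {x, y} \<notin> F"
    by blast
  have "nbhd F T1 \<subseteq> nbhd F T" "nbhd F T2 \<subseteq> nbhd F T"
  proof -
    have "\<forall>x\<in>T1. \<forall>y\<in>T2. {y, x} \<notin> F" using *(5) by (metis insert_commute)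
    with * show "nbhd F T1 \<subseteq> nbhd F T" "nbhd F T2 \<subseteq> nbhd F T" unfolding nbhd_def by blast+
  qed
  with * show ?thesis by (intro split)
next
  case False
  then obtain v where v: "v \<in> T" "\<forall>y\<in>nbhd F T. {v, y} \<in> F"
    using chordal_complete_vertex[OF assms] by blast
  have "is_clique V F (insert v (nbhd F T))"
    using assms(3,5) v by (auto simp: is_clique_def insert_commute)
  moreover have "nbhd F (T - {v}) \<subseteq> insert v (nbhd F T)" by (auto simp: nbhd_def)
  ultimately show ?thesis using v(1) by (intro complete)
qed

text \<open>Take a smallest piece with clique boundary and at least \<open>s\<close> vertices. One
  step of the recursion leaves pieces with fewer than \<open>s\<close> vertices, and it produces at
  most two pieces or removes one vertex.\<close>

lemma chordal_medium_piece:
  assumes G: "simple_graph V F" "chordal F" and s: "1 \<le> s" "s \<le> card V"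
  obtains T where "T \<subseteq> V" "s \<le> card T" "card T \<le> 2 * s" "is_clique V F (nbhd F T)"
proof -
  let ?P = "\<lambda>T. T \<subseteq> V \<and> is_clique V F (nbhd F T) \<and> s \<le> card T"
  have "nbhd F V = {}" using G(1) by (auto simp: nbhd_def simple_graph_def)
  then have "?P V" using s by (simp add: is_clique_def)
  then obtain T where T: "?P T" and Tmin: "\<And>T'. ?P T' \<Longrightarrow> card T \<le> card T'"
    using ex_has_least_nat[of ?P V card] by blast
  have finT: "finite T" using T G finite_subset by (auto simp: simple_graph_def)
  have small: "card T' < s" if "T' \<subset> T" "is_clique V F (nbhd F T')" for T'
  proof (rule ccontr)
    assume "\<not> card T' < s"
    then have "card T \<le> card T'" using that T by (intro Tmin) auto
    moreover have "card T' < card T" using that finT by (intro psubset_card_mono)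
    ultimately show False by simp
  qed
  have "T \<subseteq> V" "T \<noteq> {}" "is_clique V F (nbhd F T)" using T s by auto
  then have "card T \<le> 2 * s"
  proof (rule chordal_cases[OF G])
    fix T1 T2 assume split: "T = T1 \<union> T2" "T1 \<inter> T2 = {}" "T1 \<noteq> {}" "T2 \<noteq> {}"
      "nbhd F T1 \<subseteq> nbhd F T" "nbhd F T2 \<subseteq> nbhd F T"
    have "card T1 < s" "card T2 < s"
      using split T by (auto intro!: small is_clique_subset[of V F "nbhd F T"])
    then show ?thesis using split finT by (simp add: card_Un_disjoint)
  next
    fix v assume complete: "v \<in> T" "is_clique V F (insert v (nbhd F T))"
      "nbhd F (T - {v}) \<subseteq> insert v (nbhd F T)"
    have "card (T - {v}) < s"
      using complete by (intro small is_clique_subset[OF complete(2,3)]) auto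
    then show ?thesis using complete(1) finT s(1) by simp
  qed
  with T that show ?thesis by blast
qed

section \<open>Treewidth of 0/1 sets\<close>

lemma finite_cliques: "finite V \<Longrightarrow> finite {K. is_clique V F K}"
  by (rule finite_subset[of _ "Pow V"]) (auto simp: is_clique_def)

lemma card_le_clique_number:
  assumes "finite V" "is_clique V F K"
  shows "card K \<le> clique_number V F"
  unfolding clique_number_def using assms finite_cliques[of V F] by (intro Max_ge) auto

lemma clique_number_le:
  assumes "finite V" "\<And>K. is_clique V F K \<Longrightarrow> card K \<le> w"
  shows "clique_number V F \<le> w"
proof -
  have "is_clique V F {}" by (simp add: is_clique_def)
  then have "card ` {K. is_clique V F K} \<noteq> {}" by blast
  then show ?thesis
    unfolding clique_number_def using assms finite_cliques[of V F] by (subst Max_le_iff) auto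
qed

lemma treewidth_le:
  assumes "simple_graph V F" "E \<subseteq> F" "chordal F" "clique_number V F \<le> w + 1"
  shows "treewidth V E \<le> w"
  unfolding treewidth_def using assms by (intro Least_le) blast

lemma treewidth_obtain:
  assumes E: "simple_graph V E"
  obtains F where "simple_graph V F" "E \<subseteq> F" "chordal F" "clique_number V F \<le> treewidth V E + 1"
proof -
  \<comment> \<open>The complete graph is chordal, so the minimum in the treewidth is
    attained.\<close>
  let ?F = "{e. e \<subseteq> V \<and> card e = 2}"
  have 1: "simple_graph V ?F" using E by (auto simp: simple_graph_def)
  have 2: "E \<subseteq> ?F" using E by (auto simp: simple_graph_def)
  have 3: "chordal ?F"
    unfolding chordal_def
  proof (intro allI impI, elim conjE)
    fix c assume c: "is_cycle ?F c" "4 \<le> length c"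
    have V: "c ! i \<in> V" if "i < length c" for i
      using c(1) that unfolding is_cycle_def by blast
    have "distinct c" "0 < length c" "2 < length c" using c by (auto simp: is_cycle_def)
    then have "c ! 0 \<noteq> c ! 2" using nth_eq_iff_index_eq[of c 0 2] by simp
    moreover have "c ! 0 \<in> V" "c ! 2 \<in> V" using c(2) by (intro V; linarith)+
    ultimately have "{c ! 0, c ! 2} \<in> ?F" by (auto simp: card_2_iff)
    moreover have "Suc 0 mod length c = 1" "Suc 2 mod length c = 3" using c(2) by auto
    ultimately show "has_chord ?F c"
      unfolding has_chord_def using c(2) by (intro exI[of _ 0] conjI exI[of _ 2]) auto
  qed
  have "\<exists>F. simple_graph V F \<and> E \<subseteq> F \<and> chordal F \<and> clique_number V F \<le> clique_number V ?F + 1"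
    using 1 2 3 by (intro exI[of _ ?F]) simp
  then have "\<exists>F. simple_graph V F \<and> E \<subseteq> F \<and> chordal F \<and> clique_number V F \<le> treewidth V E + 1"
    unfolding treewidth_def by (rule LeastI)
  with that show ?thesis by blast
qed

lemma intersection_graph_simple: "simple_graph {..<n} (intersection_graph n m \<phi>)"
  by (auto simp: simple_graph_def intersection_graph_def appears_in_def)

lemma cube_upd: "x \<in> cube n \<Longrightarrow> j < n \<Longrightarrow> c \<in> {0, 1} \<Longrightarrow> x(j := c) \<in> cube n"
  by (auto simp: cube_def Rn_def)

lemma cube_values: "x \<in> cube n \<Longrightarrow> x j = 0 \<or> x j = 1"
  by (cases "j < n") (auto simp: cube_def Rn_def)

text \<open>The coordinates in which \<open>x\<close> and \<open>y\<close> differ are flipped one at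
  a time, and none of these flips changes the value.\<close>

lemma eq_if_agree_on_appearing:
  assumes "x \<in> cube n" "y \<in> cube n" "\<And>j. appears_in n j f \<Longrightarrow> x j = y j"
  shows "f x = f y"
proof -
  have "j < n" if "x j \<noteq> y j" for j
    using that assms(1,2) by (cases "j < n") (auto simp: cube_def Rn_def)
  then have "{j. x j \<noteq> y j} \<subseteq> {..<n}" by auto
  then have "finite {j. x j \<noteq> y j}" by (rule finite_subset) simp
  then show ?thesis
    using assms
  proof (induction "{j. x j \<noteq> y j}" arbitrary: x rule: finite_psubset_induct)
    case psubset
    show ?case
    proof (cases "{j. x j \<noteq> y j} = {}")
      case True
      then have "x = y" by (auto simp: fun_eq_iff)
      then show ?thesis by simp
    next
      case False
      then obtain j where j: "x j \<noteq> y j" by blast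
      then have jn: "j < n" using psubset.prems(1,2) by (cases "j < n") (auto simp: cube_def Rn_def)
      define x' where "x' = x(j := 1 - x j)"
      have y: "1 - x j = y j" using cube_values[OF psubset.prems(1), of j] cube_values[OF psubset.prems(2), of j] j by auto
      have "\<not> appears_in n j f" using psubset.prems(3)[of j] j by blast
      then have "f x' = f x" using psubset.prems(1) jn unfolding appears_in_def x'_def by blast
      moreover have "f x' = f y"
      proof (rule psubset.hyps(2))
        show "{j. x' j \<noteq> y j} \<subset> {j. x j \<noteq> y j}" using j y by (auto simp: x'_def)
        show "x' \<in> cube n" unfolding x'_def
          using psubset.prems(1) jn cube_values[OF psubset.prems(1), of j] by (intro cube_upd) auto
        show "appears_in n i f \<Longrightarrow> x' i = y i" for i using psubset.prems(3)[of i] y by (auto simp: x'_def)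
      qed (rule psubset.prems(2))
      ultimately show ?thesis by simp
    qed
  qed
qed

lemma tw_obtain:
  assumes S: "S \<subseteq> cube n"
  obtains m \<phi> F where "is_formulation n S m \<phi>" "simple_graph {..<n} F" "chordal F"
    "clique_number {..<n} F \<le> tw n S + 1" "\<And>i. i < m \<Longrightarrow> is_clique {..<n} F {j. appears_in n j (\<phi> i)}"
proof -
  \<comment> \<open>A single constraint, the indicator of the complement of \<open>S\<close>, shows
    that formulations exist.\<close>
  have "is_formulation n S 1 (\<lambda>_ x. if x \<in> S then 0 else 1)"
    using S by (auto simp: is_formulation_def)
  then have "\<exists>w m \<phi>. is_formulation n S m \<phi> \<and> w = treewidth {..<n} (intersection_graph n m \<phi>)" by blast
  then have "\<exists>m \<phi>. is_formulation n S m \<phi> \<and> tw n S = treewidth {..<n} (intersection_graph n m \<phi>)"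
    unfolding tw_def by (rule LeastI_ex)
  then obtain m \<phi> where \<phi>: "is_formulation n S m \<phi>" "tw n S = treewidth {..<n} (intersection_graph n m \<phi>)" by blast
  obtain F where F: "simple_graph {..<n} F" "intersection_graph n m \<phi> \<subseteq> F" "chordal F"
    "clique_number {..<n} F \<le> treewidth {..<n} (intersection_graph n m \<phi>) + 1"
    by (rule treewidth_obtain[OF intersection_graph_simple])
  have "is_clique {..<n} F {j. appears_in n j (\<phi> i)}" if i: "i < m" for i
    unfolding is_clique_def
  proof (intro conjI ballI impI)
    show "{j. appears_in n j (\<phi> i)} \<subseteq> {..<n}" by (auto simp: appears_in_def)
    fix u v assume uv: "u \<in> {j. appears_in n j (\<phi> i)}" "v \<in> {j. appears_in n j (\<phi> i)}" "u \<noteq> v"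
    then have "{u, v} \<in> intersection_graph n m \<phi>" using i unfolding intersection_graph_def by blast
    then show "{u, v} \<in> F" using F(2) by blast
  qed
  with that \<phi> F show ?thesis by metis
qed

lemma tw_le:
  assumes \<phi>: "is_formulation n S m \<phi>" and F: "simple_graph {..<n} F" "chordal F"
    "clique_number {..<n} F \<le> w + 1" and cl: "\<And>i. i < m \<Longrightarrow> is_clique {..<n} F {j. appears_in n j (\<phi> i)}"
  shows "tw n S \<le> w"
proof -
  have "tw n S \<le> treewidth {..<n} (intersection_graph n m \<phi>)"
    unfolding tw_def using \<phi> by (intro Least_le) blast
  also have "intersection_graph n m \<phi> \<subseteq> F"
    using cl unfolding intersection_graph_def is_clique_def by blast
  then have "treewidth {..<n} (intersection_graph n m \<phi>) \<le> w"
    using F by (intro treewidth_le)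
  finally show ?thesis .
qed

text \<open>A constraint violated at \<open>x\<close> involves a variable in which \<open>x\<close> and \<open>a\<close> differ, for every
  \<open>a \<in> S\<close>; all its variables form a clique.\<close>

lemma tw_lower_bound:
  assumes S: "S \<subseteq> cube n" and x: "x \<in> cube n" "x \<notin> S"
    and hit: "\<And>C. C \<subseteq> {..<n} \<Longrightarrow> (\<And>a. a \<in> S \<Longrightarrow> \<exists>j\<in>C. a j \<noteq> x j) \<Longrightarrow> t \<le> card C"
  shows "t \<le> tw n S + 1"
proof -
  obtain m \<phi> F where *: "is_formulation n S m \<phi>" "clique_number {..<n} F \<le> tw n S + 1"
    "\<And>i. i < m \<Longrightarrow> is_clique {..<n} F {j. appears_in n j (\<phi> i)}"
    using tw_obtain[OF S] by metis
  obtain i where i: "i < m" "\<phi> i x \<noteq> 0" using *(1) x unfolding is_formulation_def by blast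
  let ?C = "{j. appears_in n j (\<phi> i)}"
  have "t \<le> card ?C"
  proof (rule hit)
    show "?C \<subseteq> {..<n}" by (auto simp: appears_in_def)
    fix a assume a: "a \<in> S"
    have a': "a \<in> cube n" "\<phi> i a = 0" using *(1) a i(1) unfolding is_formulation_def by blast+
    show "\<exists>j\<in>?C. a j \<noteq> x j"
    proof (rule ccontr)
      assume "\<not> ?thesis"
      then have "\<phi> i a = \<phi> i x" by (intro eq_if_agree_on_appearing[OF a'(1) x(1)]) auto
      with a'(2) i(2) show False by simp
    qed
  qed
  also have "\<dots> \<le> clique_number {..<n} F" by (intro card_le_clique_number *(3) i) simp
  finally show ?thesis using *(2) by simp
qed

text \<open>A constraint meeting \<open>T\<close> has its variables in \<open>T\<close> and its
  boundary, where the mixture agrees with \<open>z\<close>; any other constraint sees only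
  \<open>x\<close>.\<close>

lemma formulation_mix:
  assumes \<phi>: "is_formulation n S m \<phi>" and cl: "\<And>i. i < m \<Longrightarrow> is_clique {..<n} F {j. appears_in n j (\<phi> i)}"
    and K: "nbhd F T \<subseteq> K" and xz: "x \<in> S" "z \<in> S" "\<And>k. k \<in> K \<Longrightarrow> x k = z k"
  shows "(\<lambda>i. if i \<in> T then z i else x i) \<in> S"
proof -
  let ?y = "\<lambda>i. if i \<in> T then z i else x i"
  have c: "x \<in> cube n" "z \<in> cube n" using \<phi> xz unfolding is_formulation_def by blast+
  then have y: "?y \<in> cube n" by (auto simp: cube_def Rn_def)
  have "\<phi> i ?y = 0" if i: "i < m" for i
  proof (cases "{j. appears_in n j (\<phi> i)} \<inter> T = {}")
    case True
    then have "\<phi> i ?y = \<phi> i x" by (intro eq_if_agree_on_appearing[OF y c(1)]) auto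
    then show ?thesis using \<phi> xz(1) i unfolding is_formulation_def by auto
  next
    case False
    then obtain t where t: "t \<in> T" "appears_in n t (\<phi> i)" by blast
    have "?y j = z j" if j: "appears_in n j (\<phi> i)" for j
    proof (cases "j \<in> T")
      case False
      then have "t \<noteq> j" using t(1) by auto
      then have "{t, j} \<in> F" using cl[OF i] t(2) j by (simp add: is_clique_def)
      then have "j \<in> nbhd F T" using False t(1) by (auto simp: nbhd_def)
      then have "j \<in> K" using K by auto
      then show ?thesis using xz(3) by simp
    qed simp
    then have "\<phi> i ?y = \<phi> i z" by (intro eq_if_agree_on_appearing[OF y c(2)]) auto
    then show ?thesis using \<phi> xz(2) i unfolding is_formulation_def by auto
  qed
  then show ?thesis using \<phi> y unfolding is_formulation_def by blast
qed

text \<open>Fixing the variables outside a window passes to an induced subgraph of the chordal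
  supergraph, which stays chordal and gains no larger clique.\<close>

lemma tw_restrict:
  assumes S: "S \<subseteq> cube n" and z: "z \<in> cube n" and on: "b + w \<le> n"
  shows "tw w {x \<in> cube w. (\<lambda>u. if b \<le> u \<and> u < b + w then x (u - b) else z u) \<in> S} \<le> tw n S"
proof -
  define emb where "emb x = (\<lambda>u. if b \<le> u \<and> u < b + w then x (u - b) else z u)" for x :: "nat \<Rightarrow> real"
  obtain m \<phi> F where *: "is_formulation n S m \<phi>" "simple_graph {..<n} F" "chordal F" "clique_number {..<n} F \<le> tw n S + 1"
    "\<And>i. i < m \<Longrightarrow> is_clique {..<n} F {j. appears_in n j (\<phi> i)}"
    using tw_obtain[OF S] by metis
  define F' where "F' = {e. e \<subseteq> {..<w} \<and> (\<lambda>u. u + b) ` e \<in> F}"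
  have F'_iff: "{u, v} \<in> F' \<longleftrightarrow> u < w \<and> v < w \<and> {u + b, v + b} \<in> F" for u v by (auto simp: F'_def)
  have inj: "inj_on (\<lambda>u. u + b) A" for A by (simp add: inj_on_def)
  have emb: "emb x \<in> cube n" if "x \<in> cube w" for x
  proof -
    have "emb x u = 0 \<or> emb x u = 1" for u
      using cube_values[OF that, of "u - b"] cube_values[OF z, of u] by (simp add: emb_def)
    moreover have "emb x u = 0" if "u \<ge> n" for u
      using z on that by (auto simp: emb_def cube_def Rn_def)
    ultimately show ?thesis by (auto simp: cube_def Rn_def)
  qed
  have "tw w {x \<in> cube w. emb x \<in> S} \<le> tw n S"
  proof (rule tw_le)
    show "is_formulation w {x \<in> cube w. emb x \<in> S} m (\<lambda>i x. \<phi> i (emb x))"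
      using *(1) emb unfolding is_formulation_def by auto
    show "simple_graph {..<w} F'"
      using *(2) unfolding simple_graph_def F'_def by (auto simp: card_image[OF inj])
    show "chordal F'"
      unfolding chordal_def
    proof (intro allI impI, elim conjE)
      fix c assume c: "is_cycle F' c" "4 \<le> length c"
      let ?c = "map (\<lambda>u. u + b) c"
      have nth: "?c ! (Suc i mod length c) = c ! (Suc i mod length c) + b" if "i < length c" for i
        by (rule nth_map, rule mod_less_divisor) (use that in linarith)
      have "is_cycle F ?c"
        using c(1) nth unfolding is_cycle_def by (auto simp: F'_iff distinct_map inj)
      then have "has_chord F ?c" using *(3) c(2) unfolding chordal_def by auto
      then obtain i j where ij: "i < length c" "j < length c" "i \<noteq> j" "j \<noteq> Suc i mod length c"
        "i \<noteq> Suc j mod length c" "{c ! i + b, c ! j + b} \<in> F" by (auto simp: has_chord_def)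
      have "c ! i < w" if "i < length c" for i using c(1) that unfolding is_cycle_def F'_iff by blast
      then show "has_chord F' c" unfolding has_chord_def F'_iff using ij by blast
    qed
    show "clique_number {..<w} F' \<le> tw n S + 1"
    proof (rule clique_number_le)
      fix K assume K: "is_clique {..<w} F' K"
      have "is_clique {..<n} F ((\<lambda>u. u + b) ` K)"
        using K on unfolding is_clique_def F'_iff by fastforce
      from card_le_clique_number[OF _ this] *(4) show "card K \<le> tw n S + 1"
        by (simp add: card_image[OF inj])
    qed simp
    fix i assume i: "i < m"
    have app: "appears_in n (j + b) (\<phi> i)" if app: "appears_in w j (\<lambda>x. \<phi> i (emb x))" for j
    proof -
      obtain x where j: "j < w" and x: "x \<in> cube w" "\<phi> i (emb (x(j := 1 - x j))) \<noteq> \<phi> i (emb x)"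
        using app unfolding appears_in_def by blast
      have "emb (x(j := 1 - x j)) = (emb x)(j + b := 1 - emb x (j + b))"
        using j by (auto simp: emb_def fun_eq_iff)
      then show ?thesis unfolding appears_in_def using j on x emb[OF x(1)] by (intro conjI bexI[of _ "emb x"]) auto
    qed
    show "is_clique {..<w} F' {j. appears_in w j (\<lambda>x. \<phi> i (emb x))}"
      unfolding is_clique_def F'_iff
    proof (intro conjI ballI impI)
      fix u v assume uv: "u \<in> {j. appears_in w j (\<lambda>x. \<phi> i (emb x))}" "v \<in> {j. appears_in w j (\<lambda>x. \<phi> i (emb x))}" "u \<noteq> v"
      then show "u < w" "v < w" by (auto simp: appears_in_def)
      show "{u + b, v + b} \<in> F" using *(5)[OF i] app uv unfolding is_clique_def by auto
    qed (auto simp: appears_in_def)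
  qed
  then show ?thesis by (simp add: emb_def)
qed

section \<open>Interval graphs as chordal supergraphs\<close>

definition interval_graph :: "nat \<Rightarrow> (nat \<Rightarrow> nat) \<Rightarrow> (nat \<Rightarrow> nat) \<Rightarrow> nat set set" where
  "interval_graph n l r = {{u, v} | u v. u < n \<and> v < n \<and> u \<noteq> v \<and> l u \<le> r v \<and> l v \<le> r u}"

lemma interval_graph_iff:
  "{u, v} \<in> interval_graph n l r \<longleftrightarrow> u < n \<and> v < n \<and> u \<noteq> v \<and> l u \<le> r v \<and> l v \<le> r u"
  by (auto simp: interval_graph_def doubleton_eq_iff)

text \<open>On a cycle, consider the interval that ends first: both neighbours contain its right end
  and hence meet each other.\<close>

lemma chordal_interval_graph:
  assumes lr: "\<And>u. l u \<le> r u"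
  shows "chordal (interval_graph n l r)"
  unfolding chordal_def
proof (intro allI impI, elim conjE)
  let ?F = "interval_graph n l r"
  fix c assume c: "is_cycle ?F c" "4 \<le> length c"
  let ?L = "length c"
  obtain i where i: "i < ?L" "\<And>j. j < ?L \<Longrightarrow> r (c ! i) \<le> r (c ! j)"
  proof -
    have "0 < ?L" using c(2) by linarith
    from ex_has_least_nat[of "\<lambda>i. i < ?L", OF this, of "\<lambda>i. r (c ! i)"] that show ?thesis by blast
  qed
  define a b where "a = Suc i mod ?L" and "b = (if i = 0 then ?L - 1 else i - 1)"
  have a: "a < ?L" unfolding a_def by (rule mod_less_divisor) (use i in linarith)
  have b: "b < ?L" "Suc b mod ?L = i" using i c(2) by (auto simp: b_def)
  have ab: "a \<noteq> b" "b \<noteq> Suc a mod ?L" "a \<noteq> Suc b mod ?L"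
  proof -
    have "a = (if Suc i = ?L then 0 else Suc i)" using i by (auto simp: a_def)
    moreover from this have "Suc a mod ?L = (if Suc i = ?L then 1 else if Suc (Suc i) = ?L then 0 else Suc (Suc i))"
      using i c(2) by auto
    ultimately show "a \<noteq> b" "b \<noteq> Suc a mod ?L" "a \<noteq> Suc b mod ?L"
      unfolding b(2) using i c(2) by (auto simp: b_def split: if_splits)
  qed
  have "{c ! i, c ! a} \<in> ?F" "{c ! b, c ! i} \<in> ?F"
    using c(1) i(1) b unfolding is_cycle_def a_def by metis+
  then have e: "l (c ! a) \<le> r (c ! i)" "l (c ! b) \<le> r (c ! i)" "c ! a < n" "c ! b < n"
    by (auto simp: interval_graph_iff)
  have "c ! a \<noteq> c ! b" using c(1) a b(1) ab(1) by (auto simp: is_cycle_def nth_eq_iff_index_eq)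
  then have "{c ! a, c ! b} \<in> ?F"
    unfolding interval_graph_iff using e i(2)[OF a] i(2)[OF b(1)] by auto
  with a b(1) ab show "has_chord ?F c" unfolding has_chord_def by blast
qed

text \<open>Helly's property on the line: all intervals of a clique contain the smallest right
  end.\<close>

lemma clique_number_interval_graph:
  assumes lr: "\<And>u. l u \<le> r u" and mult: "\<And>q. card {v. v < n \<and> l v \<le> q \<and> q \<le> r v} \<le> w"
  shows "clique_number {..<n} (interval_graph n l r) \<le> w"
proof (rule clique_number_le)
  fix K assume K: "is_clique {..<n} (interval_graph n l r) K"
  show "card K \<le> w"
  proof (cases "K = {}")
    case False
    then obtain u where u: "u \<in> K" "\<And>v. v \<in> K \<Longrightarrow> r u \<le> r v"
      using ex_has_least_nat[of "\<lambda>u. u \<in> K" _ r] by blast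
    have "K \<subseteq> {v. v < n \<and> l v \<le> r u \<and> r u \<le> r v}"
    proof
      fix v assume v: "v \<in> K"
      have "v < n" using K v by (auto simp: is_clique_def)
      moreover have "l v \<le> r u"
        using K u(1) v lr[of u] unfolding is_clique_def interval_graph_iff by (cases "u = v") auto
      ultimately show "v \<in> {v. v < n \<and> l v \<le> r u \<and> r u \<le> r v}" using u(2)[OF v] by simp
    qed
    then have "card K \<le> card {v. v < n \<and> l v \<le> r u \<and> r u \<le> r v}" by (intro card_mono) auto
    with mult[of "r u"] show ?thesis by simp
  qed simp
qed simp

lemma tw_le_local_constraints:
  assumes S: "S = {x \<in> cube n. \<forall>i<(m::nat). R i x}"
    and loc: "\<And>i x y. i < m \<Longrightarrow> x \<in> cube n \<Longrightarrow> y \<in> cube n \<Longrightarrow> (\<And>j. j \<in> C i \<Longrightarrow> x j = y j) \<Longrightarrow> R i x \<Longrightarrow> R i y"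
    and F: "simple_graph {..<n} F" "chordal F" "clique_number {..<n} F \<le> w + 1"
    and cl: "\<And>i. i < m \<Longrightarrow> is_clique {..<n} F (C i \<inter> {..<n})"
  shows "tw n S \<le> w"
proof (rule tw_le[OF _ F])
  let ?\<phi> = "\<lambda>i x. if R i x then 0 else 1 :: nat"
  show "is_formulation n S m ?\<phi>" unfolding is_formulation_def S by auto
  fix i assume i: "i < m"
  have "{j. appears_in n j (?\<phi> i)} \<subseteq> C i \<inter> {..<n}"
  proof clarify
    fix j assume "appears_in n j (?\<phi> i)"
    then obtain x where j: "j < n" and x: "x \<in> cube n" "?\<phi> i (x(j := 1 - x j)) \<noteq> ?\<phi> i x"
      unfolding appears_in_def by blast
    have x': "x(j := 1 - x j) \<in> cube n" using cube_values[OF x(1), of j] j x(1) by (intro cube_upd) auto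
    have "j \<in> C i"
    proof (rule ccontr)
      assume "j \<notin> C i"
      then have eq: "(x(j := 1 - x j)) k = x k" if "k \<in> C i" for k using that by auto
      have "R i (x(j := 1 - x j)) \<longleftrightarrow> R i x"
        using loc[OF i x' x(1) eq] loc[OF i x(1) x' eq[symmetric]] by blast
      with x(2) show False by simp
    qed
    with j show "j \<in> C i \<inter> {..<n}" by simp
  qed
  then show "is_clique {..<n} F {j. appears_in n j (?\<phi> i)}" by (rule is_clique_subset[OF cl[OF i]])
qed

section \<open>Local constraints and treewidth of \<open>blocks\<close>\<close>

lemma nat_block_cases:
  obtains (switch) i where "u = i * Suc w" | (coord) i j where "j < w" "u = Suc (i * Suc w + j)"
proof (cases "u mod Suc w")
  case 0
  then have "u = (u div Suc w) * Suc w" using div_mult_mod_eq[of u "Suc w"] by linarith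
  then show ?thesis by (rule switch)
next
  case (Suc j)
  then have "u = Suc ((u div Suc w) * Suc w + j)" using div_mult_mod_eq[of u "Suc w"] by linarith
  moreover have "j < w" using Suc mod_less_divisor[of "Suc w" u] by linarith
  ultimately show ?thesis by (intro coord)
qed

lemma le_div_Suc_iff: "k \<le> u div Suc w \<longleftrightarrow> k * Suc w \<le> u"
  by (rule less_eq_div_iff_mult_less_eq) simp

lemma div_Suc_switch: "(i * Suc w) div Suc w = i"
  by (rule nonzero_mult_div_cancel_right) simp

lemma block_point_cube:
  assumes "p \<in> cube w" "i < k" "k * Suc w \<le> n"
  shows "block_point w i p \<in> cube n"
proof -
  have "block_point w i p u = 0 \<or> block_point w i p u = 1" for u
    using cube_values[OF assms(1)] by (auto simp: block_point_def)
  moreover have "block_point w i p u = 0" if u: "n \<le> u" for u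
  proof -
    have "k \<le> u div Suc w" using u assms(3) unfolding le_div_Suc_iff by simp
    then have "\<not> u div Suc w \<le> i" "u div Suc w \<noteq> i" using assms(2) by linarith+
    then show ?thesis unfolding block_point_def by presburger
  qed
  ultimately show ?thesis by (auto simp: cube_def Rn_def)
qed

lemma zero_cube: "0 \<in> cube n"
  by (simp add: cube_def Rn_def)

lemma blocks_cube:
  assumes "A \<subseteq> cube w" "k * Suc w \<le> n"
  shows "blocks w k A \<subseteq> cube n"
  using assms block_point_cube zero_cube unfolding blocks_def by blast

text \<open>The switch after the last block is read as 0. The first alternative describes the last
  block switched on, the second any other block. A change between neighbouring switches is permitted
  only from 1 to 0, so the chain is nonincreasing.\<close>

definition block_ok :: "nat \<Rightarrow> nat \<Rightarrow> (nat \<Rightarrow> real) set \<Rightarrow> nat \<Rightarrow> (nat \<Rightarrow> real) \<Rightarrow> bool" where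
  "block_ok w k A i x \<longleftrightarrow> (let s = (if Suc i < k then x (Suc i * Suc w) else 0) in
     (x (i * Suc w) = 1 \<and> s = 0 \<and> (\<lambda>j. if j < w then x (Suc (i * Suc w + j)) else 0) \<in> A) \<or>
     (x (i * Suc w) = s \<and> (\<forall>j<w. x (Suc (i * Suc w + j)) = 0)))"

lemma blocks_characterization:
  notes mult_Suc_right [simp del] and mult_Suc [simp del]
  assumes A: "A \<subseteq> cube w" and n: "k * Suc w \<le> n"
  shows "blocks w k A = {x \<in> cube n. (\<forall>i<k. block_ok w k A i x) \<and> (\<forall>u\<ge>k * Suc w. x u = 0)}"
proof (intro equalityI subsetI)
  fix x assume x: "x \<in> blocks w k A"
  have xc: "x \<in> cube n" using blocks_cube[OF A n] x by blast
  have xk: "x \<in> cube (k * Suc w)" using blocks_cube[OF A order_refl] x by blast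
  have "block_ok w k A i x" if i: "i < k" for i
  proof (cases "x = 0")
    case True
    then show ?thesis by (simp add: block_ok_def)
  next
    case False
    then obtain i0 p where p: "i0 < k" "p \<in> A" "x = block_point w i0 p" using x by (auto simp: blocks_def)
    have pz: "p = (\<lambda>j. if j < w then p j else 0)"
      using A p(2) by (auto simp: fun_eq_iff cube_def Rn_def)
    have c: "x (Suc (i * Suc w + j)) = (if i = i0 then p j else 0)" if "j < w" for j
      unfolding p(3) using that by (rule block_point_coord)
    have s: "x (i * Suc w) = (if i \<le> i0 then 1 else 0)" "x (Suc i * Suc w) = (if Suc i \<le> i0 then 1 else 0)"
      unfolding p(3) by (rule block_point_switch)+
    show ?thesis
    proof (cases "i = i0")
      case True
      then have "(\<lambda>j. if j < w then x (Suc (i * Suc w + j)) else 0) = p"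
        using c by (subst pz) (auto simp: fun_eq_iff)
      then show ?thesis unfolding block_ok_def Let_def s using True p(2) by simp
    next
      case False
      then show ?thesis unfolding block_ok_def Let_def s using c p(1) i by auto
    qed
  qed
  then show "x \<in> {x \<in> cube n. (\<forall>i<k. block_ok w k A i x) \<and> (\<forall>u\<ge>k * Suc w. x u = 0)}"
    using xc xk by (auto simp: cube_def Rn_def)
next
  fix x assume "x \<in> {x \<in> cube n. (\<forall>i<k. block_ok w k A i x) \<and> (\<forall>u\<ge>k * Suc w. x u = 0)}"
  then have x: "x \<in> cube n" and ok: "\<And>i. i < k \<Longrightarrow> block_ok w k A i x" and z: "\<And>u. k * Suc w \<le> u \<Longrightarrow> x u = 0"
    by auto
  define s where "s i = x (i * Suc w)" for i
  define b where "b i = (\<lambda>j. if j < w then x (Suc (i * Suc w + j)) else 0)" for i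
  have s01: "s i = 0 \<or> s i = 1" for i unfolding s_def by (rule cube_values[OF x])
  have sk: "s i = 0" if "k \<le> i" for i unfolding s_def by (rule z) (use that in \<open>rule mult_le_mono1\<close>)
  have bk: "b i = 0" if "k \<le> i" for i
  proof -
    have "x (Suc (i * Suc w + j)) = 0" for j
      by (rule z) (use mult_le_mono1[OF that, of "Suc w"] in linarith)
    then show ?thesis by (auto simp: b_def)
  qed
  have step: "(s i = 1 \<and> s (Suc i) = 0 \<and> b i \<in> A) \<or> (s i = s (Suc i) \<and> b i = 0)" if "i < k" for i
  proof -
    have "(if Suc i < k then x (Suc i * Suc w) else 0) = s (Suc i)" using sk[of "Suc i"] by (auto simp: s_def)
    then show ?thesis using ok[OF that] unfolding block_ok_def Let_def
      by (auto simp: s_def b_def fun_eq_iff)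
  qed
  have xs: "x u = y u" if "\<And>i. s i = y (i * Suc w)" "\<And>i j. j < w \<Longrightarrow> b i j = y (Suc (i * Suc w + j))" for u and y :: "nat \<Rightarrow> real"
  proof (cases rule: nat_block_cases[of u w])
    case (switch i)
    then show ?thesis using that(1)[of i] by (simp only: s_def)
  next
    case (coord i j)
    then show ?thesis using that(2)[of j i] by (simp add: b_def)
  qed
  show "x \<in> blocks w k A"
  proof (cases "\<exists>i. s i = 1")
    case False
    then have s0: "s i = 0" for i using s01 by blast
    have "b i = 0" for i using step[of i] bk[of i] s0 by (cases "i < k") auto
    then have "x = 0" using xs[of "\<lambda>_. 0"] s0 by (auto simp: fun_eq_iff)
    then show ?thesis by (simp add: blocks_def)
  next
    case True
    have "i < k" if "s i = 1" for i using sk[of i] that by (cases "i < k") auto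
    then have "{i. s i = 1} \<subseteq> {..<k}" by auto
    then have fin: "finite {i. s i = 1}" by (rule finite_subset) simp
    define i0 where "i0 = Max {i. s i = 1}"
    have i0: "s i0 = 1" unfolding i0_def using Max_in[OF fin] True by auto
    have i0max: "s i = 0" if "i0 < i" for i
    proof (rule ccontr)
      assume "s i \<noteq> 0"
      then have "i \<in> {i. s i = 1}" using s01 by blast
      then have "i \<le> i0" unfolding i0_def by (rule Max_ge[OF fin])
      with that show False by simp
    qed
    have i0k: "i0 < k" using sk[of i0] i0 by (cases "i0 < k") auto
    have bA: "b i0 \<in> A" using step[OF i0k] i0 i0max[of "Suc i0"] by auto
    \<comment> \<open>Downward induction from \<open>i0\<close>. Truncated subtraction stays at 0
      once \<open>d\<close> exceeds \<open>i0\<close>, so the claim on the switches needs no bound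
      on \<open>d\<close>.\<close>
    have down: "s (i0 - d) = 1 \<and> (0 < d \<longrightarrow> d \<le> i0 \<longrightarrow> b (i0 - d) = 0)" for d
    proof (induction d)
      case (Suc d)
      show ?case
      proof (cases "Suc d \<le> i0")
        case True
        then have e: "Suc (i0 - Suc d) = i0 - d" by simp
        show ?thesis using step[of "i0 - Suc d"] i0k Suc unfolding e by auto
      next
        case False
        then have "i0 - Suc d = i0 - d" by simp
        then show ?thesis using Suc False by simp
      qed
    qed (use i0 in simp)
    have s_eq: "s i = (if i \<le> i0 then 1 else 0)" for i
      using down[of "i0 - i"] i0max[of i] by (cases "i \<le> i0") auto
    have b_eq: "b i = 0" if "i \<noteq> i0" for i
    proof (cases "i < i0")
      case True
      then show ?thesis using down[of "i0 - i"] by simp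
    next
      case False
      then have "s i = 0" using that i0max by simp
      then show ?thesis using step[of i] bk[of i] by (cases "i < k") auto
    qed
    have "x = block_point w i0 (b i0)"
    proof
      fix u show "x u = block_point w i0 (b i0) u"
        by (rule xs) (auto simp: block_point_switch block_point_coord s_eq b_eq)
    qed
    then show ?thesis using i0k bA by (auto simp: blocks_def)
  qed
qed

lemma simple_interval_graph: "simple_graph {..<n} (interval_graph n l r)"
  by (auto simp: simple_graph_def interval_graph_def)

lemma tw_blocks_le:
  assumes A: "A \<subseteq> cube w" and n: "k * Suc w \<le> n"
  shows "tw n (blocks w k A) \<le> w + 1"
proof -
  note [simp del] = mult_Suc_right mult_Suc
  \<comment> \<open>Block \<open>i\<close> lives at time \<open>i\<close>, but its switch already at
    time \<open>i - 1\<close>, where the preceding block reads it. Time \<open>q\<close> thus meets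
    \<open>w + 1\<close> coordinates of its own block and at most one further switch. Each
    coordinate beyond the blocks gets a time of its own, after all blocks.\<close>
  define l where "l u = (if u < k * Suc w then (if u mod Suc w = 0 then u div Suc w - 1 else u div Suc w) else k + u)" for u
  define r where "r u = (if u < k * Suc w then u div Suc w else k + u)" for u
  have lr: "l u \<le> r u" for u by (auto simp: l_def r_def)
  have rk: "r u < k" if "u < k * Suc w" for u
    using that le_div_Suc_iff[of k u w] by (auto simp: r_def)
  have mult: "card {v. v < n \<and> l v \<le> q \<and> q \<le> r v} \<le> w + 1 + 1" for q
  proof (cases "q < k")
    case True
    have "{v. v < n \<and> l v \<le> q \<and> q \<le> r v} \<subseteq> {q * Suc w..Suc q * Suc w}"
    proof clarify
      fix v assume v: "l v \<le> q" "q \<le> r v"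
      then have vk: "v < k * Suc w" using True by (auto simp: l_def split: if_splits)
      then have "q \<le> v div Suc w" using v by (simp add: r_def)
      then have "q * Suc w \<le> v" by (simp only: le_div_Suc_iff)
      moreover have "v \<le> Suc q * Suc w"
      proof (cases "v mod Suc w = 0")
        case True
        then have "v div Suc w \<le> Suc q" using v vk by (auto simp: l_def)
        then have "(v div Suc w) * Suc w \<le> Suc q * Suc w" by (rule mult_le_mono1)
        then show ?thesis using True div_mult_mod_eq[of v "Suc w"] by linarith
      next
        case False
        then have "v div Suc w < Suc q" using v vk by (auto simp: l_def)
        then show ?thesis using le_div_Suc_iff[of "Suc q" v w] by linarith
      qed
      ultimately show "v \<in> {q * Suc w..Suc q * Suc w}" by simp
    qed
    then have "card {v. v < n \<and> l v \<le> q \<and> q \<le> r v} \<le> card {q * Suc w..Suc q * Suc w}"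
      by (intro card_mono) auto
    also have "\<dots> = w + 1 + 1" by (simp add: mult_Suc)
    finally show ?thesis .
  next
    case False
    have "{v. v < n \<and> l v \<le> q \<and> q \<le> r v} \<subseteq> {q - k}"
    proof clarify
      fix v assume v: "l v \<le> q" "q \<le> r v"
      then have "\<not> v < k * Suc w" using rk[of v] False by linarith
      then show "v = q - k" using v by (simp add: l_def r_def)
    qed
    then have "card {v. v < n \<and> l v \<le> q \<and> q \<le> r v} \<le> card {q - k}" by (intro card_mono) auto
    then show ?thesis by simp
  qed
  \<comment> \<open>Indices below \<open>k\<close> are block constraints; index \<open>k + u\<close>
    forces coordinate \<open>u\<close> to vanish if it lies beyond the blocks.\<close>
  define R where "R i x \<longleftrightarrow> (if i < k then block_ok w k A i x else k * Suc w \<le> i - k \<longrightarrow> x (i - k) = 0)"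
    for i and x :: "nat \<Rightarrow> real"
  \<comment> \<open>The intersection cuts off the switch that would follow the last block.\<close>
  define C where "C i = (if i < k then {i * Suc w..Suc i * Suc w} \<inter> {..<k * Suc w} else {i - k})" for i
  show ?thesis
  proof (rule tw_le_local_constraints[where m = "k + n" and R = R and C = C])
    have "(\<forall>i<k + n. R i x) \<longleftrightarrow> (\<forall>i<k. block_ok w k A i x) \<and> (\<forall>u\<ge>k * Suc w. x u = 0)"
      if x: "x \<in> cube n" for x
    proof (intro iffI conjI allI impI)
      fix u assume a: "\<forall>i<k + n. R i x" and u: "k * Suc w \<le> u"
      show "x u = 0"
      proof (cases "u < n")
        case True
        then show ?thesis using spec[OF a, of "k + u"] u by (simp add: R_def)
      next
        case False
        then show ?thesis using x by (simp add: cube_def Rn_def)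
      qed
    qed (auto simp: R_def split: if_splits)
    then show "blocks w k A = {x \<in> cube n. \<forall>i<k + n. R i x}"
      unfolding blocks_characterization[OF A n] by blast
  next
    fix i x y assume i: "i < k + n" and xy: "\<And>j. j \<in> C i \<Longrightarrow> x j = y j" and R: "R i x"
    show "R i y"
    proof (cases "i < k")
      case True
      have le: "Suc i * Suc w \<le> k * Suc w" using True by (intro mult_le_mono1) simp
      have "x (i * Suc w) = y (i * Suc w)"
        using True le by (intro xy) (simp add: C_def mult_Suc)
      moreover have "x (Suc i * Suc w) = y (Suc i * Suc w)" if "Suc i < k"
      proof (rule xy)
        have "Suc i * Suc w < k * Suc w" using that by (rule mult_less_mono1) simp
        then show "Suc i * Suc w \<in> C i" using True by (simp add: C_def mult_Suc)
      qed
      moreover have c: "x (Suc (i * Suc w + j)) = y (Suc (i * Suc w + j))" if "j < w" for j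
        using True le that by (intro xy) (simp add: C_def mult_Suc)
      then have "(\<lambda>j. if j < w then x (Suc (i * Suc w + j)) else 0) = (\<lambda>j. if j < w then y (Suc (i * Suc w + j)) else 0)"
        by auto
      ultimately have "block_ok w k A i y = block_ok w k A i x"
        unfolding block_ok_def Let_def using c by auto
      then show ?thesis using R True by (simp add: R_def)
    next
      case False
      then show ?thesis using R xy[of "i - k"] by (simp add: R_def C_def)
    qed
  next
    show "simple_graph {..<n} (interval_graph n l r)" by (rule simple_interval_graph)
    show "chordal (interval_graph n l r)" using lr by (rule chordal_interval_graph)
    show "clique_number {..<n} (interval_graph n l r) \<le> w + 1 + 1"
      using lr mult by (rule clique_number_interval_graph)
  next
    fix i assume "i < k + n"
    show "is_clique {..<n} (interval_graph n l r) (C i \<inter> {..<n})"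
    proof (cases "i < k")
      case True
      have in_i: "l u \<le> i \<and> i \<le> r u" if "u \<in> C i" for u
      proof -
        have u: "i * Suc w \<le> u" "u \<le> Suc i * Suc w" "u < k * Suc w" using that True by (auto simp: C_def)
        have d: "i \<le> u div Suc w" using u(1) by (simp only: le_div_Suc_iff)
        show ?thesis
        proof (cases "u = Suc i * Suc w")
          case True
          then have "u div Suc w = Suc i" "u mod Suc w = 0" using div_Suc_switch[of "Suc i" w] by simp_all
          then show ?thesis using u(3) by (simp add: l_def r_def)
        next
          case False
          then have "\<not> Suc i \<le> u div Suc w" using u(2) by (simp only: le_div_Suc_iff)
          then have "u div Suc w = i" using d by simp
          then show ?thesis using u(3) by (simp add: l_def r_def)
        qed
      qed
      show ?thesis
        unfolding is_clique_def interval_graph_iff using in_i by (auto intro: order_trans)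
    next
      case False
      then show ?thesis by (auto simp: is_clique_def C_def)
    qed
  qed
qed

lemma block_point_zero: "block_point w i p 0 = 1"
  by (simp add: block_point_def)

lemma block_point_nonzero: "block_point w i p \<noteq> 0"
proof
  assume "block_point w i p = 0"
  then show False using block_point_zero[of w i p] by simp
qed

lemma block_point_inject:
  assumes "p \<in> cube w" "q \<in> cube w" "block_point w i p = block_point w j q"
  shows "i = j" "p = q"
proof -
  have "i \<le> j" "j \<le> i"
    using fun_cong[OF assms(3), of "i * Suc w"] fun_cong[OF assms(3), of "j * Suc w"]
    unfolding block_point_switch by (auto split: if_splits)
  then show ij: "i = j" by simp
  show "p = q"
  proof
    fix u show "p u = q u"
    proof (cases "u < w")
      case True
      then show ?thesis using fun_cong[OF assms(3), of "Suc (i * Suc w + u)"] ij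
        by (simp only: block_point_coord) simp
    next
      case False
      then show ?thesis using assms(1,2) by (simp add: cube_def Rn_def)
    qed
  qed
qed

lemma tw_le_tw_blocks:
  assumes A: "A \<subseteq> cube w" and n: "k * Suc w \<le> n" and k: "1 \<le> k"
  shows "tw w A \<le> tw n (blocks w k A)"
proof -
  \<comment> \<open>First switch on, everything else 0: fixing these values outside the data of the
    first block leaves exactly \<open>A\<close>.\<close>
  let ?z = "block_point w 0 0"
  have wn: "1 + w \<le> n" using order_trans[OF mult_le_mono1[OF k] n] by simp
  have "{x \<in> cube w. (\<lambda>u. if 1 \<le> u \<and> u < 1 + w then x (u - 1) else ?z u) \<in> blocks w k A} = A"
  proof -
    have emb: "(\<lambda>u. if 1 \<le> u \<and> u < 1 + w then x (u - 1) else ?z u) = block_point w 0 x" if x: "x \<in> cube w" for x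
    proof
      fix u
      show "(if 1 \<le> u \<and> u < 1 + w then x (u - 1) else ?z u) = block_point w 0 x u"
      proof (cases "1 \<le> u \<and> u < 1 + w")
        case True
        then have "u mod Suc w = u" "u div Suc w = 0" by simp_all
        then show ?thesis using True by (simp add: block_point_def)
      next
        case False
        then have "u mod Suc w = 0 \<or> u div Suc w \<noteq> 0" by (cases "u = 0") (auto simp: div_eq_0_iff)
        then show ?thesis using False by (auto simp: block_point_def)
      qed
    qed
    have "block_point w 0 x \<in> blocks w k A \<longleftrightarrow> x \<in> A" if x: "x \<in> cube w" for x
    proof
      assume "block_point w 0 x \<in> blocks w k A"
      then obtain i p where "p \<in> A" "block_point w 0 x = block_point w i p"
        using block_point_nonzero by (auto simp: blocks_def)
      then show "x \<in> A" using block_point_inject(2)[OF x, of p] A by blast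
    next
      assume "x \<in> A"
      then show "block_point w 0 x \<in> blocks w k A" using k by (auto simp: blocks_def)
    qed
    with emb A show ?thesis by auto
  qed
  with tw_restrict[OF blocks_cube[OF A n] _ wn, of ?z] k n zero_cube show ?thesis
    using block_point_cube[OF zero_cube[of w], of 0 k n] by simp
qed

text \<open>Switching off the first switch of a point of the last block leaves the set. A constraint
  violated there involves that switch and, because the origin is allowed, another variable. A
  treewidth of at least 1 later absorbs additive constants.\<close>

lemma tw_blocks_ge_1:
  assumes A: "A \<subseteq> cube w" and n: "k * Suc w \<le> n" and k: "1 \<le> k" and p: "p \<in> A"
    and kp: "2 \<le> k \<or> p \<noteq> 0"
  shows "1 \<le> tw n (blocks w k A)"
proof -
  let ?a = "block_point w (k - 1) p"
  let ?x = "?a(0 := 0)"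
  have a: "?a \<in> blocks w k A" using p k by (auto simp: blocks_def)
  have S: "blocks w k A \<subseteq> cube n" by (rule blocks_cube[OF A n])
  have n0: "0 < n" using order_trans[OF mult_le_mono1[OF k] n] by simp
  have x: "?x \<in> cube n" using a S n0 by (intro cube_upd) auto
  have "?x \<noteq> 0"
  proof (cases "2 \<le> k")
    case True
    have "?x (1 * Suc w) = 1" using block_point_switch[of w "k - 1" p 1] True by simp
    then show ?thesis by (metis zero_fun_apply zero_neq_one)
  next
    case False
    then have k1: "k - 1 = 0" and "p \<noteq> 0" using kp by auto
    then obtain j where j: "p j \<noteq> 0" by (auto simp: fun_eq_iff)
    then have "j < w" using A p by (cases "j < w") (auto simp: cube_def Rn_def)
    then have "?x (Suc (0 * Suc w + j)) = p j" using block_point_coord[of j w 0 p 0] unfolding k1 by simp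
    with j show ?thesis by (metis zero_fun_apply)
  qed
  moreover have "?x \<noteq> block_point w i q" for i q
  proof
    assume "?x = block_point w i q"
    from fun_cong[OF this, of 0] show False by (simp add: block_point_zero)
  qed
  ultimately have xS: "?x \<notin> blocks w k A" unfolding blocks_def by blast
  have "2 \<le> tw n (blocks w k A) + 1"
  proof (rule tw_lower_bound[OF S x xS])
    fix C assume C: "C \<subseteq> {..<n}" and hit: "\<And>a. a \<in> blocks w k A \<Longrightarrow> \<exists>j\<in>C. a j \<noteq> ?x j"
    obtain j where j: "j \<in> C" "?a j \<noteq> ?x j" using hit[OF a] by blast
    then have j0: "0 \<in> C" by (cases "j = 0") auto
    obtain i where i: "i \<in> C" "0 \<noteq> ?x i" using hit[of 0] by (auto simp: blocks_def)
    have "i \<noteq> 0" using i(2) by (cases "i = 0") auto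
    then have "card {0, i} = 2" by simp
    moreover have "finite C" using C by (rule finite_subset) simp
    then have "card {0, i} \<le> card C" using j0 i(1) by (intro card_mono) auto
    ultimately show "2 \<le> card C" by simp
  qed
  then show ?thesis by simp
qed

text \<open>All points but the origin have their first switch on, so the base lies in a hyperplane
  that misses the apex.\<close>

lemma is_pyramid_blocks:
  assumes "finite A"
  shows "is_pyramid (convex hull (blocks w k A))"
proof -
  let ?T = "\<Union>i<k. block_point w i ` A"
  have lin: "linear (\<lambda>x::nat \<Rightarrow> real. x 0)" by (rule linearI) simp_all
  have "?T \<subseteq> (\<lambda>x. x 0) -` {1}" using block_point_zero by auto
  moreover have aff: "affine ((\<lambda>x::nat \<Rightarrow> real. x 0) -` {1})"
    using lin by (rule affine_linear_vimage) (rule affine_sing)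
  ultimately have "convex hull ?T \<subseteq> (\<lambda>x. x 0) -` {1}"
    by (intro hull_minimal affine_imp_convex)
  then have "affine hull (convex hull ?T) \<subseteq> (\<lambda>x. x 0) -` {1}" using aff by (rule hull_minimal)
  then have "0 \<notin> affine hull (convex hull ?T)" by auto
  moreover have "polytope (convex hull ?T)" 
    unfolding polytope_def by (intro exI[of _ ?T]) (use assms in simp)
  moreover have "convex hull (blocks w k A) = convex hull (convex hull ?T \<union> {0})"
    unfolding blocks_def using hull_Un_left[of convex ?T "{0}"] by simp
  ultimately show ?thesis unfolding is_pyramid_def by blast
qed

section \<open>Lifts along clique separations\<close>

definition restr :: "'i set \<Rightarrow> ('i \<Rightarrow> real) \<Rightarrow> 'i \<Rightarrow> real" where
  "restr T s = (\<lambda>i. if i \<in> T then s i else 0)"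

lemma restr_eq_iff: "restr T s = restr T s' \<longleftrightarrow> (\<forall>i\<in>T. s i = s' i)"
  by (auto simp: restr_def fun_eq_iff)

lemma restr_restr: "N \<subseteq> K \<Longrightarrow> restr N (restr K s) = restr N s"
  by (auto simp: restr_def fun_eq_iff)

lemma card_restr_le:
  assumes S: "S \<subseteq> cube n" and K: "finite K"
  shows "finite (restr K ` S)" "card (restr K ` S) \<le> 2 ^ card K"
proof -
  show "finite (restr K ` S)" using S finite_cube finite_subset by blast
  have "inj_on (\<lambda>x. {i \<in> K. x i = 1}) (restr K ` S)"
  proof (rule inj_onI, clarify)
    fix s s' assume s: "s \<in> S" "s' \<in> S" and eq: "{i \<in> K. restr K s i = 1} = {i \<in> K. restr K s' i = 1}"
    have "s i = s' i" if "i \<in> K" for i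
    proof -
      have "i \<in> {i \<in> K. restr K s i = 1} \<longleftrightarrow> i \<in> {i \<in> K. restr K s' i = 1}" using eq by simp
      then have "s i = 1 \<longleftrightarrow> s' i = 1" using that by (simp add: restr_def)
      then show ?thesis using cube_values[OF subsetD[OF S s(1)], of i] cube_values[OF subsetD[OF S s(2)], of i] by auto
    qed
    then show "restr K s = restr K s'" by (simp add: restr_eq_iff)
  qed
  then have "card (restr K ` S) \<le> card (Pow K)" using K by (intro card_inj_on_le) auto
  then show "card (restr K ` S) \<le> 2 ^ card K" by (simp add: card_Pow K)
qed

text \<open>The map takes at most one value per pattern on \<open>K\<close>, so the simplex lift is
  small enough.\<close>

lemma sdp_lift_local:
  fixes g :: "(nat \<Rightarrow> real) \<Rightarrow> 'a::real_vector"
  assumes S: "S \<subseteq> cube n" and K: "finite K" "card K \<le> q"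
    and g: "\<And>s s'. s \<in> S \<Longrightarrow> s' \<in> S \<Longrightarrow> restr K s = restr K s' \<Longrightarrow> g s = g s'"
  obtains r where "r \<le> 2 ^ q" "sdp_lift (convex hull (g ` S)) r"
proof -
  have finS: "finite S" using S finite_cube finite_subset by blast
  have "card (g ` S) \<le> card (restr K ` S)"
  proof -
    define h where "h d = g (SOME s. s \<in> S \<and> restr K s = d)" for d
    have "g s = h (restr K s)" if s: "s \<in> S" for s
    proof -
      have "(SOME t. t \<in> S \<and> restr K t = restr K s) \<in> S \<and> restr K (SOME t. t \<in> S \<and> restr K t = restr K s) = restr K s"
        by (rule someI[of _ s]) (simp add: s)
      then show ?thesis unfolding h_def using g[OF s] by metis
    qed
    then have "g ` S = h ` restr K ` S" by (auto simp: image_image)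
    then show ?thesis using card_image_le[OF card_restr_le(1)[OF S K(1)], of h] by simp
  qed
  also have "\<dots> \<le> 2 ^ card K" by (rule card_restr_le[OF S K(1)])
  also have "\<dots> \<le> 2 ^ q" using K(2) by simp
  finally show ?thesis using that sdp_lift_convex_hull_finite[of "g ` S"] finS by auto
qed

lemma sum_point_mass:
  assumes "finite P" "a \<in> P"
  shows "(\<Sum>p\<in>P. point_mass a p * f p) = f a"
proof -
  have "(\<Sum>p\<in>P. point_mass a p * f p) = (\<Sum>p\<in>P. if p = a then f p else 0)"
    by (intro sum.cong) (auto simp: point_mass_def)
  then show ?thesis using assms by simp
qed

lemma sdp_lift_image_hull:
  fixes L :: "'a::real_vector \<Rightarrow> 'b::real_vector"
  assumes "sdp_lift (convex hull (g ` S)) r" "linear L" "\<And>s. s \<in> S \<Longrightarrow> L (g s) = f s"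
  shows "sdp_lift (convex hull (f ` S)) r"
proof -
  have "f ` S = L ` g ` S" using assms(3) by (auto simp: image_image)
  then show ?thesis
    using sdp_lift_linear_image[OF assms(2,1)] convex_hull_linear_image[OF assms(2), of "g ` S"] by simp
qed

text \<open>The pattern on the clique \<open>K\<close> is the key along which pieces are glued: the constraints do
  not link \<open>T\<close> to variables outside \<open>T \<union> K\<close>.\<close>

lemma junction_tree_bound:
  assumes S: "S \<subseteq> cube n" and \<phi>: "is_formulation n S m \<phi>"
    and F: "simple_graph {..<n} F" "chordal F" "clique_number {..<n} F \<le> q"
    and cl: "\<And>i. i < m \<Longrightarrow> is_clique {..<n} F {j. appears_in n j (\<phi> i)}"
  shows "T \<subseteq> {..<n} \<Longrightarrow> T \<noteq> {} \<Longrightarrow> nbhd F T \<subseteq> K \<Longrightarrow> K \<inter> T = {} \<Longrightarrow> is_clique {..<n} F K \<Longrightarrow>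
    \<exists>r \<le> 2 * card T * 2 ^ q. sdp_lift (convex hull ((\<lambda>s. (restr T s, point_mass (restr K s))) ` S)) r"
proof (induction "card T" arbitrary: T K rule: less_induct)
  case less
  have finS: "finite S" using S finite_cube finite_subset by blast
  have finT: "finite T" using less.prems(1) finite_subset by auto
  have clq: "finite C \<and> card C \<le> q" if "is_clique {..<n} F C" for C
    using card_le_clique_number[OF _ that] F(3) that finite_subset[of C "{..<n}"] by (auto simp: is_clique_def)
  let ?N = "nbhd F T"
  have cN: "is_clique {..<n} F ?N" using less.prems(3,5) is_clique_subset by blast
  have NT: "?N \<inter> T = {}" by (auto simp: nbhd_def)
  show ?case
  proof (rule chordal_cases[OF F(1,2) less.prems(1,2) cN])
    fix T1 T2 assume split: "T = T1 \<union> T2" "T1 \<inter> T2 = {}" "T1 \<noteq> {}" "T2 \<noteq> {}"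
      "nbhd F T1 \<subseteq> ?N" "nbhd F T2 \<subseteq> ?N"
    have fin12: "finite T1" "finite T2" using finT split by auto
    have c: "card T = card T1 + card T2" using split fin12 by (simp add: card_Un_disjoint)
    have pos: "0 < card T1" "0 < card T2" using split fin12 by auto
    have "\<exists>r \<le> 2 * card T1 * 2 ^ q. sdp_lift (convex hull ((\<lambda>s. (restr T1 s, point_mass (restr K s))) ` S)) r"
      by (rule less.hyps) (use split less.prems c pos in auto)
    then obtain r1 where r1: "r1 \<le> 2 * card T1 * 2 ^ q" "sdp_lift (convex hull ((\<lambda>s. (restr T1 s, point_mass (restr K s))) ` S)) r1"
      by blast
    have "\<exists>r \<le> 2 * card T2 * 2 ^ q. sdp_lift (convex hull ((\<lambda>s. (restr T2 s, point_mass (restr K s))) ` S)) r"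
      by (rule less.hyps) (use split less.prems c pos in auto)
    then obtain r2 where r2: "r2 \<le> 2 * card T2 * 2 ^ q" "sdp_lift (convex hull ((\<lambda>s. (restr T2 s, point_mass (restr K s))) ` S)) r2"
      by blast
    have mix: "\<exists>u\<in>S. restr K u = restr K s \<and> restr T1 u = restr T1 s \<and> restr T2 u = restr T2 s'"
      if s: "s \<in> S" "s' \<in> S" "restr K s = restr K s'" for s s'
    proof (rule bexI)
      have "nbhd F T2 \<subseteq> K" using split less.prems by auto
      moreover have "s k = s' k" if "k \<in> K" for k using s(3) that by (simp add: restr_eq_iff)
      ultimately show "(\<lambda>i. if i \<in> T2 then s' i else s i) \<in> S"
        by (intro formulation_mix[OF \<phi> cl _ s(1,2)])
      show "restr K (\<lambda>i. if i \<in> T2 then s' i else s i) = restr K s \<and>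
         restr T1 (\<lambda>i. if i \<in> T2 then s' i else s i) = restr T1 s \<and>
         restr T2 (\<lambda>i. if i \<in> T2 then s' i else s i) = restr T2 s'"
        using split less.prems(4) by (auto simp: restr_eq_iff)
    qed
    have lin: "linear (\<lambda>p :: (nat \<Rightarrow> real) \<times> (nat \<Rightarrow> real) \<times> ((nat \<Rightarrow> real) \<Rightarrow> real). (fst p + fst (snd p), snd (snd p)))"
      by (rule linearI) (simp_all add: scaleR_right_distrib)
    have "sdp_lift (convex hull ((\<lambda>s. (restr T s, point_mass (restr K s))) ` S)) (r1 + r2)"
      by (rule sdp_lift_image_hull[OF sdp_lift_glue[OF finS mix r1(2) r2(2)] lin])
         (use split in \<open>auto simp: restr_def fun_eq_iff\<close>)
    moreover have "r1 + r2 \<le> 2 * card T * 2 ^ q" using r1(1) r2(1) c by (simp add: algebra_simps)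
    ultimately show ?thesis by blast
  next
    fix v assume v: "v \<in> T" "is_clique {..<n} F (insert v ?N)" "nbhd F (T - {v}) \<subseteq> insert v ?N"
    let ?K' = "insert v ?N"
    have finK': "finite ?K'" "card ?K' \<le> q" using clq[OF v(2)] by auto
    have vN: "v \<notin> ?N" using v(1) NT by auto
    \<comment> \<open>The budget per vertex is twice \<open>2 ^ q\<close>: one share for moving the
      vertex into the separator or for the single-vertex case, one for attaching the tag on
      \<open>K\<close>. The latter is part of \<open>r2\<close> below.\<close>
    obtain r1 where r1: "r1 + 2 ^ q \<le> 2 * card T * 2 ^ q"
      "sdp_lift (convex hull ((\<lambda>s. (restr T s, point_mass (restr ?N s))) ` S)) r1"
    proof (cases "T = {v}")
      case True
      have *: "(restr T s, point_mass (restr ?N s)) = (restr T s', point_mass (restr ?N s'))"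
        if "restr ?K' s = restr ?K' s'" for s s'
      proof -
        have "restr T s = restr T s'" "restr ?N s = restr ?N s'"
          using that True by (auto simp: restr_eq_iff)
        then show ?thesis by simp
      qed
      obtain r where "r \<le> 2 ^ q" "sdp_lift (convex hull ((\<lambda>s. (restr T s, point_mass (restr ?N s))) ` S)) r"
        by (rule sdp_lift_local[OF S finK', of "\<lambda>s. (restr T s, point_mass (restr ?N s))"]) (use * in blast)+
      then show ?thesis using that[of r] True by simp
    next
      case False
      let ?T' = "T - {v}"
      have cT: "card T = Suc (card ?T')" by (rule card.remove[OF finT v(1)])
      have T': "?T' \<noteq> {}" using False v(1) by auto
      have "\<exists>r \<le> 2 * card ?T' * 2 ^ q. sdp_lift (convex hull ((\<lambda>s. (restr ?T' s, point_mass (restr ?K' s))) ` S)) r"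
        by (rule less.hyps) (use cT T' less.prems(1) v NT in auto)
      then obtain r where r: "r \<le> 2 * card ?T' * 2 ^ q"
        "sdp_lift (convex hull ((\<lambda>s. (restr ?T' s, point_mass (restr ?K' s))) ` S)) r" by blast
      define P where "P = restr ?K' ` S"
      have finP: "finite P" unfolding P_def using finS by simp
      \<comment> \<open>A pattern tag determines the coordinate \<open>v\<close> and the coarser tag
        on \<open>?N\<close>. As functions of a point mass, both are linear.\<close>
      define L where "L = (\<lambda>p :: (nat \<Rightarrow> real) \<times> ((nat \<Rightarrow> real) \<Rightarrow> real).
        (fst p + (\<lambda>i. if i = v then \<Sum>a\<in>P. snd p a * a v else 0),
         (\<lambda>b. \<Sum>a\<in>P. snd p a * (if restr ?N a = b then 1 else 0))))"
      have lin: "linear L"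
        unfolding L_def
        by (rule linearI) (auto simp: fun_eq_iff distrib_right distrib_left sum.distrib sum_distrib_left mult.assoc)
      have Ls: "L (restr ?T' s, point_mass (restr ?K' s)) = (restr T s, point_mass (restr ?N s))" if s: "s \<in> S" for s
      proof -
        have K'P: "restr ?K' s \<in> P" using s by (simp add: P_def)
        have "L (restr ?T' s, point_mass (restr ?K' s)) =
           (restr ?T' s + (\<lambda>i. if i = v then restr ?K' s v else 0), (\<lambda>b. if restr ?N (restr ?K' s) = b then 1 else 0))"
          unfolding L_def fst_conv snd_conv sum_point_mass[OF finP K'P] ..
        also have "restr ?T' s + (\<lambda>i. if i = v then restr ?K' s v else 0) = restr T s"
          using v(1) by (auto simp: restr_def fun_eq_iff)
        also have "restr ?N (restr ?K' s) = restr ?N s" by (rule restr_restr) auto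
        finally show ?thesis by (auto simp: point_mass_def fun_eq_iff)
      qed
      have "sdp_lift (convex hull ((\<lambda>s. (restr T s, point_mass (restr ?N s))) ` S)) r"
        by (rule sdp_lift_image_hull[OF r(2) lin Ls])
      moreover have "r + 2 ^ q \<le> 2 * card T * 2 ^ q" using r(1) unfolding cT by (simp add: algebra_simps)
      ultimately show ?thesis using that by blast
    qed
    have finK: "finite K" "card K \<le> q" using clq[OF less.prems(5)] by auto
    \<comment> \<open>\<open>K\<close> may exceed the boundary of \<open>T\<close>; its tag is glued
      on as a separate piece, with the pattern on \<open>?N\<close> as key.\<close>
    obtain r2 where r2: "r2 \<le> 2 ^ q"
      "sdp_lift (convex hull ((\<lambda>s. (point_mass (restr K s), point_mass (restr ?N s))) ` S)) r2"
    proof (rule sdp_lift_local[OF S finK, of "\<lambda>s. (point_mass (restr K s), point_mass (restr ?N s))"])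
      fix s s' :: "nat \<Rightarrow> real" assume "restr K s = restr K s'"
      then show "(point_mass (restr K s), point_mass (restr ?N s)) = (point_mass (restr K s'), point_mass (restr ?N s'))"
        using restr_restr[OF less.prems(3)] by metis
    qed blast
    have mix: "\<exists>u\<in>S. restr ?N u = restr ?N s \<and> restr T u = restr T s \<and> point_mass (restr K u) = point_mass (restr K s')"
      if s: "s \<in> S" "s' \<in> S" "restr ?N s = restr ?N s'" for s s'
    proof (rule bexI)
      let ?u = "\<lambda>i. if i \<in> T then s i else s' i"
      have "s' k = s k" if "k \<in> ?N" for k using s(3) that by (simp add: restr_eq_iff)
      then show "?u \<in> S" by (intro formulation_mix[OF \<phi> cl order_refl s(2,1)])
      have "restr K ?u = restr K s'" using less.prems(4) by (auto simp: restr_eq_iff)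
      moreover have "restr ?N ?u = restr ?N s" using NT s(3) by (auto simp: restr_eq_iff)
      moreover have "restr T ?u = restr T s" by (auto simp: restr_eq_iff)
      ultimately show "restr ?N ?u = restr ?N s \<and> restr T ?u = restr T s \<and> point_mass (restr K ?u) = point_mass (restr K s')"
        by simp
    qed
    have lin: "linear (\<lambda>p :: (nat \<Rightarrow> real) \<times> ((nat \<Rightarrow> real) \<Rightarrow> real) \<times> ((nat \<Rightarrow> real) \<Rightarrow> real). (fst p, fst (snd p)))"
      by (rule linearI) simp_all
    have "sdp_lift (convex hull ((\<lambda>s. (restr T s, point_mass (restr K s))) ` S)) (r1 + r2)"
      by (rule sdp_lift_image_hull[OF sdp_lift_glue[OF finS mix r1(2) r2(2)] lin]) simp_all
    then show ?thesis using r1(1) r2(1) by (intro exI[of _ "r1 + r2"]) auto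
  qed
qed

lemma lift_order_le_tw:
  assumes S: "S \<subseteq> cube n" and n: "1 \<le> n"
  shows "lift_order (convex hull S) \<le> 2 * n * 2 ^ (tw n S + 1)"
proof -
  obtain m \<phi> F where F: "is_formulation n S m \<phi>" "simple_graph {..<n} F" "chordal F"
    "clique_number {..<n} F \<le> tw n S + 1" "\<And>i. i < m \<Longrightarrow> is_clique {..<n} F {j. appears_in n j (\<phi> i)}"
    using tw_obtain[OF S] by metis
  have nb: "nbhd F {..<n} \<subseteq> {}" using nbhd_subset[OF F(2), of "{..<n}"] unfolding nbhd_def by blast
  have "0 \<in> {..<n}" using n by simp
  then have ne: "{..<n} \<noteq> {}" by blast
  have "\<exists>r \<le> 2 * card {..<n} * 2 ^ (tw n S + 1).
     sdp_lift (convex hull ((\<lambda>s. (restr {..<n} s, point_mass (restr {} s))) ` S)) r"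
    by (rule junction_tree_bound[OF S F(1-4) F(5) order_refl ne nb]) (auto simp: is_clique_def)
  then obtain r where r: "r \<le> 2 * n * 2 ^ (tw n S + 1)"
     "sdp_lift (convex hull ((\<lambda>s. (restr {..<n} s, point_mass (restr {} s))) ` S)) r" by auto
  have "restr {..<n} s = s" if "s \<in> S" for s
    using S that by (auto simp: restr_def fun_eq_iff cube_def Rn_def)
  then have "sdp_lift (convex hull ((\<lambda>s. s) ` S)) r"
    by (intro sdp_lift_image_hull[OF r(2) linear_fst]) simp
  then show ?thesis using lift_order_le[of "convex hull S" r] r(1) by simp
qed


text \<open>\<open>T\<close> and its complement are glued along the pattern on the boundary, and the
  larger of the two orders is at least half the sum.\<close>

lemma clique_separation_bound:
  assumes S: "S \<subseteq> cube n" and \<phi>: "is_formulation n S m \<phi>"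
    and cl: "\<And>i. i < m \<Longrightarrow> is_clique {..<n} F {j. appears_in n j (\<phi> i)}"
    and T: "T \<subseteq> {..<n}"
  obtains U where "U = T \<or> U = {..<n} - T"
    "lift_order (convex hull S) \<le>
      2 * lift_order (convex hull ((\<lambda>s. (restr U s, point_mass (restr (nbhd F T) s))) ` S))"
proof -
  let ?N = "nbhd F T" and ?R = "{..<n} - T"
  let ?Q = "\<lambda>U. convex hull ((\<lambda>s. (restr U s, point_mass (restr ?N s))) ` S)"
  have finS: "finite S" using S finite_cube finite_subset by blast
  have lift: "sdp_lift (?Q U) (lift_order (?Q U))" for U
    using finS by (intro sdp_lift_lift_order) simp
  have mix: "\<exists>u\<in>S. restr ?N u = restr ?N s \<and> restr T u = restr T s \<and> restr ?R u = restr ?R s'"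
    if s: "s \<in> S" "s' \<in> S" "restr ?N s = restr ?N s'" for s s'
  proof (rule bexI)
    let ?u = "\<lambda>i. if i \<in> T then s i else s' i"
    have "s' k = s k" if "k \<in> ?N" for k using s(3) that by (simp add: restr_eq_iff)
    then show "?u \<in> S" by (intro formulation_mix[OF \<phi> cl order_refl s(2,1)])
    have "?N \<inter> T = {}" by (auto simp: nbhd_def)
    then show "restr ?N ?u = restr ?N s \<and> restr T ?u = restr T s \<and> restr ?R ?u = restr ?R s'"
      using s(3) by (auto simp: restr_eq_iff)
  qed
  have lin: "linear (\<lambda>p :: (nat \<Rightarrow> real) \<times> (nat \<Rightarrow> real) \<times> ((nat \<Rightarrow> real) \<Rightarrow> real). fst p + fst (snd p))"
    by (rule linearI) (simp_all add: scaleR_right_distrib)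
  have "sdp_lift (convex hull ((\<lambda>s. s) ` S)) (lift_order (?Q T) + lift_order (?Q ?R))"
  proof (rule sdp_lift_image_hull[OF sdp_lift_glue[OF finS mix lift lift] lin])
    fix s assume "s \<in> S"
    then have "i \<ge> n \<Longrightarrow> s i = 0" for i using S by (auto simp: cube_def Rn_def)
    then show "fst (restr T s, restr ?R s, point_mass (restr ?N s)) +
        fst (snd (restr T s, restr ?R s, point_mass (restr ?N s))) = s"
      using T by (auto simp: restr_def fun_eq_iff)
  qed
  then have "lift_order (convex hull S) \<le> lift_order (?Q T) + lift_order (?Q ?R)"
    by (intro lift_order_le) simp
  then have "lift_order (convex hull S) \<le> 2 * lift_order (?Q T) \<or> lift_order (convex hull S) \<le> 2 * lift_order (?Q ?R)"
    by linarith
  with that show ?thesis by blast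
qed

text \<open>The points of \<open>S\<close>, restricted to \<open>U\<close> and tagged by the indicator vector of their pattern on
  \<open>N\<close>, fit into \<open>b\<close> coordinates. Taking the product with a \<open>t\<close>-cube that lacks one vertex forces
  treewidth at least \<open>t - 1\<close>.\<close>

lemma tagged_realization:
  assumes S: "S \<subseteq> cube n" "S \<noteq> {}" and U: "finite U" and N: "finite N"
    and b: "card U + 2 ^ card N \<le> b" and t: "2 \<le> t"
  obtains A where "A \<subseteq> cube (b + t)" "\<exists>p\<in>A. p \<noteq> 0" "t \<le> tw (b + t) A + 1"
    "lift_order (convex hull ((\<lambda>s. (restr U s, point_mass (restr N s))) ` S)) \<le> lift_order (convex hull A)"
proof -
  define P where "P = restr N ` S"
  have P: "finite P" "card P \<le> 2 ^ card N" unfolding P_def by (rule card_restr_le[OF S(1) N])+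
  \<comment> \<open>One coordinate for each element of \<open>U\<close> and one indicator for each
    pattern on \<open>N\<close> that occurs.\<close>
  define J :: "(nat + (nat \<Rightarrow> real)) set" where "J = Inl ` U \<union> Inr ` P"
  have J: "finite J" unfolding J_def using U P by simp
  have "card J \<le> card U + card P"
    unfolding J_def using card_Un_le[of "Inl ` U" "Inr ` P"] card_image_le[OF U, of Inl] card_image_le[OF P(1), of Inr]
    by (meson add_mono order_trans)
  then have cJ: "card J \<le> b" using P(2) b by linarith
  obtain e where e: "bij_betw e J {..<card J}"
    using ex_bij_betw_finite_nat[OF J] by (auto simp: atLeast0LessThan)
  have eb: "e j < b" if "j \<in> J" for j using bij_betwE[OF e] that cJ by force
  have einv: "inv_into J e (e j) = j" if "j \<in> J" for j
    using e that by (intro inv_into_f_f) (auto simp: bij_betw_def)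
  define cd :: "(nat \<Rightarrow> real) \<Rightarrow> nat + (nat \<Rightarrow> real) \<Rightarrow> real"
    where "cd s = case_sum s (point_mass (restr N s))" for s
  define pt where "pt s c = (\<lambda>j. if j \<in> e ` J then cd s (inv_into J e j)
      else if b \<le> j \<and> j < b + t then c j else 0)" for s and c :: "nat \<Rightarrow> real"
  have pt_hi: "pt s c j = c j" if "b \<le> j" "j < b + t" for s c j
    using that eb by (force simp: pt_def)
  have pt_e: "pt s c (e j) = cd s j" if "j \<in> J" for s c j
    using that by (simp add: pt_def einv)
  \<comment> \<open>The missing vertex is the all-ones vector on the last \<open>t\<close>
    coordinates.\<close>
  define B where "B = {c :: nat \<Rightarrow> real. (\<forall>j. c j = 0 \<or> c j = 1) \<and> (\<exists>j. b \<le> j \<and> j < b + t \<and> c j = 0)}"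
  define A where "A = {pt s c | s c. s \<in> S \<and> c \<in> B}"
  have pt_cube: "pt s c \<in> cube (b + t)" if "s \<in> S" "\<And>j. c j = 0 \<or> c j = 1" for s c
  proof -
    have "cd s j = 0 \<or> cd s j = 1" for j
      using cube_values[OF subsetD[OF S(1) that(1)]] by (cases j) (auto simp: cd_def point_mass_def)
    then have "pt s c j = 0 \<or> pt s c j = 1" for j using that(2) by (simp add: pt_def)
    moreover have "pt s c j = 0" if "b + t \<le> j" for j using that eb by (force simp: pt_def)
    ultimately show ?thesis by (auto simp: cube_def Rn_def)
  qed
  have A: "A \<subseteq> cube (b + t)" using pt_cube by (auto simp: A_def B_def)
  obtain s0 where s0: "s0 \<in> S" using S(2) by blast
  have hole: "(\<lambda>i. if i = j then 0 else 1) \<in> B" if "b \<le> j" "j < b + t" for j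
    using that by (auto simp: B_def)
  have nz: "\<exists>p\<in>A. p \<noteq> 0"
  proof (rule bexI)
    show "pt s0 (\<lambda>i. if i = b then 0 else 1) \<in> A" unfolding A_def using s0 hole[of b] t by auto
    have "pt s0 (\<lambda>i. if i = b then 0 else 1) (b + 1) = 1" using t by (subst pt_hi) auto
    then show "pt s0 (\<lambda>i. if i = b then 0 else 1) \<noteq> 0" by (metis zero_fun_apply zero_neq_one)
  qed
  have "t \<le> tw (b + t) A + 1"
  proof (rule tw_lower_bound[OF A])
    let ?x = "pt s0 (\<lambda>_. 1)"
    show "?x \<in> cube (b + t)" using s0 by (intro pt_cube) auto
    show "?x \<notin> A"
    proof
      assume "?x \<in> A"
      then obtain s c where sc: "?x = pt s c" "c \<in> B" unfolding A_def by blast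
      then obtain j where j: "b \<le> j" "j < b + t" "c j = 0" unfolding B_def by blast
      from fun_cong[OF sc(1), of j] show False unfolding pt_hi[OF j(1,2)] using j(3) by simp
    qed
    fix C assume C: "C \<subseteq> {..<b + t}" and hit: "\<And>a. a \<in> A \<Longrightarrow> \<exists>j\<in>C. a j \<noteq> ?x j"
    \<comment> \<open>Lowering any single one of the last \<open>t\<close> coordinates of
      \<open>?x\<close> gives a point of \<open>A\<close>, so a violated constraint involves each of
      them.\<close>
    have "{b..<b + t} \<subseteq> C"
    proof
      fix j assume "j \<in> {b..<b + t}"
      then have j: "b \<le> j" "j < b + t" by auto
      let ?c = "\<lambda>i. if i = j then 0 else 1 :: real"
      have "pt s0 ?c \<in> A" unfolding A_def using s0 hole[OF j] by blast
      then obtain i where i: "i \<in> C" "pt s0 ?c i \<noteq> ?x i" using hit by blast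
      then have "i = j" by (auto simp: pt_def split: if_splits)
      with i show "j \<in> C" by simp
    qed
    moreover have "finite C" using C by (rule finite_subset) simp
    ultimately have "card {b..<b + t} \<le> card C" by (intro card_mono)
    then show "t \<le> card C" by simp
  qed
  moreover have "lift_order (convex hull ((\<lambda>s. (restr U s, point_mass (restr N s))) ` S)) \<le> lift_order (convex hull A)"
  proof (rule lift_order_le)
    define L where "L y = (\<lambda>i. if i \<in> U then y (e (Inl i)) else 0, \<lambda>p. if p \<in> P then y (e (Inr p)) else 0)"
      for y :: "nat \<Rightarrow> real"
    have lin: "linear L" by (rule linearI) (auto simp: L_def fun_eq_iff)
    have Lpt: "L (pt s c) = (restr U s, point_mass (restr N s))" if s: "s \<in> S" for s c
    proof -
      have "restr N s \<in> P" using s by (simp add: P_def)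
      then have "point_mass (restr N s) p = 0" if "p \<notin> P" for p
        using that by (auto simp: point_mass_def)
      moreover have "pt s c (e (Inl i)) = s i" if "i \<in> U" for i
        using that by (subst pt_e) (auto simp: J_def cd_def)
      moreover have "pt s c (e (Inr p)) = point_mass (restr N s) p" if "p \<in> P" for p
        using that by (subst pt_e) (auto simp: J_def cd_def)
      ultimately show ?thesis by (auto simp: L_def restr_def fun_eq_iff)
    qed
    have "L ` A = (\<lambda>s. (restr U s, point_mass (restr N s))) ` S"
    proof (intro equalityI subsetI)
      fix y assume "y \<in> L ` A"
      then obtain s c where "s \<in> S" "y = L (pt s c)" unfolding A_def by blast
      then show "y \<in> (\<lambda>s. (restr U s, point_mass (restr N s))) ` S" using Lpt by auto
    next
      fix y assume "y \<in> (\<lambda>s. (restr U s, point_mass (restr N s))) ` S"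
      then obtain s where s: "s \<in> S" "y = (restr U s, point_mass (restr N s))" by blast
      have "pt s (\<lambda>i. if i = b then 0 else 1) \<in> A" unfolding A_def using s(1) hole[of b] t by auto
      then have "L (pt s (\<lambda>i. if i = b then 0 else 1)) \<in> L ` A" by (rule imageI)
      then show "y \<in> L ` A" unfolding Lpt[OF s(1)] s(2) .
    qed
    moreover have "finite A" using A finite_cube by (rule finite_subset)
    then have "sdp_lift (convex hull A) (lift_order (convex hull A))" by (rule sdp_lift_lift_order)
    ultimately show "sdp_lift (convex hull ((\<lambda>s. (restr U s, point_mass (restr N s))) ` S)) (lift_order (convex hull A))"
      using sdp_lift_linear_image[OF lin] convex_hull_linear_image[OF lin, of A] by metis
  qed
  ultimately show ?thesis using that[of A] A nz by blast
qed

section \<open>Choice of the blocks and assembly of the family\<close>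

lemma lift_order_trivial:
  assumes "S \<subseteq> {0 :: 'a::real_vector}"
  shows "lift_order (convex hull S) = 0"
proof -
  have "S = {} \<or> S = {0}" using assms by blast
  then have "sdp_lift (convex hull S) 0" using sdp_lift_empty sdp_lift_singleton by auto
  then show ?thesis using lift_order_le by fastforce
qed

lemma high_treewidth_block:
  assumes S: "S \<subseteq> cube w" and X: "0 < lift_order (convex hull S)"
  obtains A where "A \<subseteq> cube w" "\<exists>p\<in>A. p \<noteq> 0"
    "lift_order (convex hull S) \<le> 2 * max 1 (lift_order (convex hull A))"
    "lift_order (convex hull S) \<le> 2 ^ (10 * tw w A + 19)"
proof -
  let ?X = "lift_order (convex hull S)"
  let ?q = "tw w S + 1"
  have nz: "\<exists>p\<in>S. p \<noteq> 0" using lift_order_trivial[of S] X by auto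
  show ?thesis
  \<comment> \<open>Below the threshold the factor \<open>w\<close> in the junction tree bound is
    itself exponential in the treewidth, and \<open>S\<close> can be kept. Above it there is room
    for the tags and for a tenth of the coordinates.\<close>
  proof (cases "10 * 2 ^ ?q \<le> w")
    case False
    have "1 \<le> w"
    proof (rule ccontr)
      assume "\<not> 1 \<le> w"
      then have "S \<subseteq> {0}" using S by (auto simp: cube_def Rn_def fun_eq_iff)
      then have "?X = 0" by (rule lift_order_trivial)
      with X show False by simp
    qed
    then have "?X \<le> 2 * w * 2 ^ ?q" by (rule lift_order_le_tw[OF S])
    also have "\<dots> \<le> 2 * (10 * 2 ^ ?q) * 2 ^ ?q" using False by (intro mult_le_mono) auto
    also have "\<dots> = 20 * 2 ^ (2 * ?q)" by (simp add: power_add mult_2)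
    also have "\<dots> \<le> 2 ^ 5 * 2 ^ (2 * ?q)" by simp
    also have "\<dots> = 2 ^ (5 + 2 * ?q)" by (rule power_add[symmetric])
    also have "\<dots> \<le> 2 ^ (10 * tw w S + 19)" by (intro power_increasing) auto
    finally show ?thesis using that[OF S nz] by simp
  next
    case True
    define t where "t = w div 10"
    \<comment> \<open>A piece of size between \<open>s\<close> and \<open>2 * s\<close> leaves room
      on either side. Its complement frees \<open>2 ^ ?q + t\<close> coordinates, for the tags and
      the cube. The piece itself, the tags and the cube together need at most \<open>6 * t\<close>
      coordinates.\<close>
    define s where "s = 2 ^ ?q + t"
    have qt: "2 ^ ?q \<le> t" unfolding t_def using True by (simp add: less_eq_div_iff_mult_less_eq mult.commute)
    have t2: "2 \<le> t" using qt by (rule order_trans[rotated]) simp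
    have tw10: "10 * t \<le> w" "w \<le> 10 * t + 9" unfolding t_def by linarith+
    obtain m \<phi> F where F: "is_formulation w S m \<phi>" "simple_graph {..<w} F" "chordal F"
      "clique_number {..<w} F \<le> ?q" "\<And>i. i < m \<Longrightarrow> is_clique {..<w} F {j. appears_in w j (\<phi> i)}"
      using tw_obtain[OF S] by metis
    have s: "1 \<le> s" "s \<le> card {..<w}" using t2 qt tw10 unfolding s_def by (simp_all del: power_Suc)
    obtain T where T: "T \<subseteq> {..<w}" "s \<le> card T" "card T \<le> 2 * s" "is_clique {..<w} F (nbhd F T)"
      by (rule chordal_medium_piece[OF F(2,3) s])
    let ?N = "nbhd F T"
    have N: "card ?N \<le> ?q" using card_le_clique_number[OF _ T(4)] F(4) by simp
    have finN: "finite ?N" using nbhd_subset[OF F(2)] by (rule finite_subset) simp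
    have finT: "finite T" using T(1) by (rule finite_subset) simp
    obtain U where U: "U = T \<or> U = {..<w} - T"
      "?X \<le> 2 * lift_order (convex hull ((\<lambda>s. (restr U s, point_mass (restr ?N s))) ` S))"
      by (rule clique_separation_bound[OF S F(1,5) T(1)])
    have pw: "(2::nat) ^ card ?N \<le> 2 ^ ?q" using N by (intro power_increasing) auto
    have cU: "card U + 2 ^ card ?N \<le> w - t"
      using U(1)
    proof
      assume "U = T"
      have "x + y \<le> w - t" if "x \<le> 2 * (z + t)" "y \<le> z" "z \<le> t" for x y z :: nat
      proof (rule add_le_imp_le_diff)
        have "6 * t \<le> w" using tw10(1) by simp
        with that show "x + y + t \<le> w" by (simp add: add_mult_distrib2)
      qed
      from this[OF T(3)[unfolded s_def] pw qt] show ?thesis unfolding \<open>U = T\<close> .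
    next
      assume "U = {..<w} - T"
      then have cU: "card U = w - card T" using finT T(1) by (simp add: card_Diff_subset)
      have "w - x + y \<le> w - t" if "z + t \<le> x" "x \<le> w" "y \<le> z" for x y z :: nat
        using that by linarith
      from this[OF T(2)[unfolded s_def] _ pw] show ?thesis
        unfolding cU using card_mono[OF _ T(1)] by simp
    qed
    have finU: "finite U" using U(1) finT by auto
    have Sne: "S \<noteq> {}" using nz by blast
    obtain A where A: "A \<subseteq> cube (w - t + t)" "\<exists>p\<in>A. p \<noteq> 0" "t \<le> tw (w - t + t) A + 1"
      "lift_order (convex hull ((\<lambda>s. (restr U s, point_mass (restr ?N s))) ` S)) \<le> lift_order (convex hull A)"
      by (rule tagged_realization[OF S Sne finU finN cU t2])
    have wt: "w - t + t = w" using tw10 by simp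
    have finS: "finite S" using S finite_cube finite_subset by blast
    have "?X \<le> card S" using sdp_lift_convex_hull_finite[OF finS] by (rule lift_order_le)
    also have "\<dots> \<le> card (cube w)" using S finite_cube by (intro card_mono)
    also have "\<dots> \<le> 2 ^ w" by (rule card_cube_le)
    \<comment> \<open>\<open>w\<close> is at most \<open>10 * t + 9\<close>, and \<open>t\<close> at
      most the treewidth plus 1.\<close>
    also have "\<dots> \<le> 2 ^ (10 * tw w A + 19)"
      using A(3) tw10(2) unfolding wt by (intro power_increasing) auto
    finally show ?thesis using that[of A] A U(2) unfolding wt by simp
  qed
qed

theorem theorem11:
  fixes S :: "nat \<Rightarrow> (nat \<Rightarrow> real) set" and f :: "nat \<Rightarrow> real" and \<omega> :: "nat \<Rightarrow> nat"
  assumes "\<And>n. S n \<subseteq> cube n"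
    and "(\<lambda>n. real (xc_SDP n (S n))) \<in> \<Omega>(\<lambda>n. 2 powr f n)"
    and "liminf (\<lambda>n. ereal (log 2 (real n)) / ereal (f n)) < 1"
    and "\<And>n. n \<ge> 1 \<Longrightarrow> \<omega> n \<le> n - 1"
  shows "\<exists>S' :: nat \<Rightarrow> (nat \<Rightarrow> real) set.
    (\<forall>n\<ge>1. S' n \<subseteq> cube n \<and> tw n (S' n) \<le> \<omega> n + 1) \<and>
    (\<lambda>n. real (xc_SDP n (S' n))) \<in> \<Omega>(\<lambda>n. real n / (real (\<omega> n) + 1) * 2 powr f (\<omega> n)) \<and>
    (\<forall>n\<ge>1. is_pyramid (convex hull S' n)) \<and>
    (\<lambda>n. real (tw n (S' n))) \<in> \<Omega>(\<lambda>n. max 0 (f (\<omega> n)))"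
proof -
  note S = assms(1)
  let ?X = "\<lambda>w. lift_order (convex hull S w)"
  obtain c N where c: "c > 0" and N: "\<And>n. N \<le> n \<Longrightarrow> c * 2 powr f n \<le> real (?X n)"
  proof -
    obtain c where c: "c > 0" "eventually (\<lambda>n. norm (real (xc_SDP n (S n))) \<ge> c * norm (2 powr f n)) at_top"
      using assms(2) by (rule landau_omega.bigE)
    then obtain N where "\<And>n. N \<le> n \<Longrightarrow> norm (real (xc_SDP n (S n))) \<ge> c * norm (2 powr f n)"
      unfolding eventually_at_top_linorder by blast
    then show ?thesis using that[of c N] c(1) by (simp add: xc_SDP_eq_lift_order[OF S])
  qed
  \<comment> \<open>\<open>N\<close> is the start of the range where the bound on \<open>S w\<close>
    holds; below it the block is just \<open>{0}\<close>.\<close>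
  have "\<exists>A. A \<subseteq> cube w \<and> A \<noteq> {} \<and> (N \<le> w \<longrightarrow> (\<exists>p\<in>A. p \<noteq> 0) \<and>
      real (?X w) \<le> 2 * real (max 1 (lift_order (convex hull A))) \<and>
      real (?X w) \<le> 2 ^ (10 * tw w A + 19))" for w
  proof (cases "N \<le> w")
    case False
    then show ?thesis using zero_cube by (intro exI[of _ "{0}"]) auto
  next
    case True
    have "0 < c * 2 powr f w" using c by simp
    also have "\<dots> \<le> real (?X w)" using N[OF True] .
    finally have "0 < ?X w" by simp
    from high_treewidth_block[OF S this] obtain A where A: "A \<subseteq> cube w" "\<exists>p\<in>A. p \<noteq> 0"
      "?X w \<le> 2 * max 1 (lift_order (convex hull A))" "?X w \<le> 2 ^ (10 * tw w A + 19)" by metis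
    have "real (?X w) \<le> real (2 * max 1 (lift_order (convex hull A)))" "real (?X w) \<le> real (2 ^ (10 * tw w A + 19))"
      using A(3,4) by (simp_all only: of_nat_le_iff)
    then show ?thesis using A(1,2) by (intro exI[of _ A]) auto
  qed
  then obtain A where A: "\<And>w. A w \<subseteq> cube w" "\<And>w. A w \<noteq> {}"
    "\<And>w. N \<le> w \<Longrightarrow> \<exists>p\<in>A w. p \<noteq> 0"
    "\<And>w. N \<le> w \<Longrightarrow> real (?X w) \<le> 2 * real (max 1 (lift_order (convex hull A w)))"
    "\<And>w. N \<le> w \<Longrightarrow> real (?X w) \<le> 2 ^ (10 * tw w (A w) + 19)"
    by metis
  define k where "k n = n div Suc (\<omega> n)" for n
  define S' where "S' n = blocks (\<omega> n) (k n) (A (\<omega> n))" for n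
  have k1: "1 \<le> k n" if "1 \<le> n" for n
    unfolding k_def using assms(4)[OF that] that by (simp add: less_eq_div_iff_mult_less_eq)
  have kn: "k n * Suc (\<omega> n) \<le> n" for n unfolding k_def by (rule div_times_less_eq_dividend)
  have S'c: "S' n \<subseteq> cube n" for n unfolding S'_def by (rule blocks_cube[OF A(1) kn])
  have finA: "finite (A w)" for w using A(1) finite_cube by (rule finite_subset)
  \<comment> \<open>The finitely many values of \<open>f\<close> below \<open>N\<close> are absorbed
    into one constant.\<close>
  define M where "M = Max (insert 1 ((\<lambda>w. 2 powr f w) ` {..<N}))"
  have M: "1 \<le> M" "\<And>w. w < N \<Longrightarrow> 2 powr f w \<le> M" unfolding M_def by (auto intro: Max_ge)
  \<comment> \<open>As there is at least one block, rounding down loses at most a factor 2.\<close>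
  have kreal: "real n / (real (\<omega> n) + 1) \<le> 2 * real (k n)" if n: "1 \<le> n" for n
  proof -
    have "\<not> Suc (k n) \<le> n div Suc (\<omega> n)" by (simp add: k_def)
    then have "n < Suc (k n) * Suc (\<omega> n)" by (simp only: le_div_Suc_iff not_le)
    also have "\<dots> \<le> (2 * k n) * Suc (\<omega> n)" using k1[OF n] by (intro mult_le_mono1) simp
    finally have "real n \<le> real ((2 * k n) * Suc (\<omega> n))" by (simp only: of_nat_le_iff less_imp_le)
    then show ?thesis by (simp add: field_simps)
  qed
  have xc: "real (k n) * real (max 1 (lift_order (convex hull A (\<omega> n)))) \<le> real (xc_SDP n (S' n))" for n
  proof -
    have "sdp_lift (convex hull S' n) (lift_order (convex hull S' n))"
      unfolding S'_def by (rule sdp_lift_lift_order[OF finite_blocks[OF finA]])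
    then have "k n * max 1 (lift_order (convex hull A (\<omega> n))) \<le> lift_order (convex hull S' n)"
      unfolding S'_def by (rule lift_order_blocks[OF A(1,2)])
    then have "real (k n * max 1 (lift_order (convex hull A (\<omega> n)))) \<le> real (lift_order (convex hull S' n))"
      by (simp only: of_nat_le_iff)
    then show ?thesis by (simp add: xc_SDP_eq_lift_order[OF S'c])
  qed
  show ?thesis
  proof (intro exI[of _ S'] conjI allI impI)
    fix n :: nat
    show "S' n \<subseteq> cube n" by (rule S'c)
    show "tw n (S' n) \<le> \<omega> n + 1" unfolding S'_def by (rule tw_blocks_le[OF A(1) kn])
    show "is_pyramid (convex hull S' n)" unfolding S'_def by (rule is_pyramid_blocks[OF finA])
  next
    \<comment> \<open>In \<open>c / 4\<close>, one factor 2 pays for replacing \<open>S w\<close> by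
      \<open>A w\<close> and one for rounding. Below \<open>N\<close>, the cost of at least 1 per
      block suffices against \<open>M\<close>.\<close>
    define d where "d = min (c / 4) (1 / (2 * M))"
    have d: "d > 0" using c M(1) by (simp add: d_def)
    have bound: "d * (real n / (real (\<omega> n) + 1) * 2 powr f (\<omega> n)) \<le> real (xc_SDP n (S' n))" if n: "1 \<le> n" for n
    proof -
      let ?w = "\<omega> n" and ?m = "real (max 1 (lift_order (convex hull A (\<omega> n))))"
      have "d * 2 powr f ?w \<le> ?m / 2"
      proof (cases "N \<le> ?w")
        case True
        have "d * 2 powr f ?w \<le> c / 4 * 2 powr f ?w" by (intro mult_right_mono) (auto simp: d_def)
        also have "\<dots> \<le> real (?X ?w) / 4" using N[OF True] by simp
        also have "\<dots> \<le> ?m / 2" using A(4)[OF True] by simp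
        finally show ?thesis .
      next
        case False
        have "d * 2 powr f ?w \<le> 1 / (2 * M) * M"
          using M False d by (intro mult_mono) (auto simp: d_def)
        also have "\<dots> = 1 / 2" using M(1) by simp
        also have "\<dots> \<le> ?m / 2" by simp
        finally show ?thesis .
      qed
      then have "(real n / (real ?w + 1)) * (d * 2 powr f ?w) \<le> (2 * real (k n)) * (?m / 2)"
        using kreal[OF n] d by (intro mult_mono) auto
      also have "\<dots> \<le> real (xc_SDP n (S' n))" using xc[of n] by simp
      finally show ?thesis by (simp add: mult_ac)
    qed
    show "(\<lambda>n. real (xc_SDP n (S' n))) \<in> \<Omega>(\<lambda>n. real n / (real (\<omega> n) + 1) * 2 powr f (\<omega> n))"
    proof (rule landau_omega.bigI[OF d])
      show "eventually (\<lambda>n. norm (real (xc_SDP n (S' n))) \<ge>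
          d * norm (real n / (real (\<omega> n) + 1) * 2 powr f (\<omega> n))) at_top"
        using eventually_ge_at_top[of 1]
      proof eventually_elim
        case (elim n)
        then show ?case using bound[OF elim] by simp
      qed
    qed
  next
    \<comment> \<open>29 is 10 + 19: since the treewidth is at least 1, the additive constants 19
      and the logarithm of \<open>c\<close> become multiples of it.\<close>
    define e where "e = max (29 + \<bar>log 2 c\<bar>) (log 2 M)"
    have e: "e > 0" by (simp add: e_def)
    \<comment> \<open>From \<open>2 * N + 2\<close> on, a small block width
      \<open>\<omega> n < N\<close> leaves at least two blocks, as \<open>tw_blocks_ge_1\<close>
      requires when the block is \<open>{0}\<close>.\<close>
    have bound: "f (\<omega> n) \<le> e * real (tw n (S' n))" if n: "2 * N + 2 \<le> n" for n
    proof -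
      let ?w = "\<omega> n" and ?t = "tw n (S' n)"
      have n1: "1 \<le> n" using n by simp
      obtain p where p: "p \<in> A ?w" "2 \<le> k n \<or> p \<noteq> 0"
      proof (cases "N \<le> ?w")
        case True
        then show ?thesis using A(3)[OF True] that by blast
      next
        case False
        then have "2 * Suc ?w \<le> n" using n by simp
        then have "2 \<le> k n" unfolding k_def by (simp add: less_eq_div_iff_mult_less_eq)
        then show ?thesis using A(2) that by blast
      qed
      have t1: "1 \<le> ?t" unfolding S'_def by (rule tw_blocks_ge_1[OF A(1) kn k1[OF n1] p])
      show ?thesis
      proof (cases "N \<le> ?w")
        case True
        have tA: "tw ?w (A ?w) \<le> ?t" unfolding S'_def by (rule tw_le_tw_blocks[OF A(1) kn k1[OF n1]])
        have "c * 2 powr f ?w \<le> 2 ^ (10 * tw ?w (A ?w) + 19)" using N[OF True] A(5)[OF True] by linarith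
        also have "\<dots> \<le> 2 ^ (10 * ?t + 19)" using tA by (intro power_increasing) auto
        finally have "log 2 (c * 2 powr f ?w) \<le> log 2 (2 ^ (10 * ?t + 19))" using c by (subst log_le_cancel_iff) auto
        then have "log 2 c + f ?w \<le> 10 * real ?t + 19" using c by (simp add: log_mult log_nat_power)
        also have "\<dots> \<le> 29 * real ?t" using t1 by simp
        finally have "f ?w \<le> 29 * real ?t + \<bar>log 2 c\<bar>" by linarith
        also have "\<dots> \<le> 29 * real ?t + \<bar>log 2 c\<bar> * real ?t"
          using t1 mult_left_mono[of 1 "real ?t" "\<bar>log 2 c\<bar>"] by simp
        also have "\<dots> \<le> e * real ?t" unfolding e_def distrib_right[symmetric] by (intro mult_right_mono) auto
        finally show ?thesis .
      next
        case False
        have "f ?w = log 2 (2 powr f ?w)" by simp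
        also have "\<dots> \<le> log 2 M" using M(1) M(2)[of ?w] False by (subst log_le_cancel_iff) auto
        also have "\<dots> \<le> e" by (simp add: e_def)
        also have "\<dots> \<le> e * real ?t" using t1 e by simp
        finally show ?thesis .
      qed
    qed
    show "(\<lambda>n. real (tw n (S' n))) \<in> \<Omega>(\<lambda>n. max 0 (f (\<omega> n)))"
    proof (rule landau_omega.bigI)
      show "1 / e > 0" using e by simp
      show "eventually (\<lambda>n. norm (real (tw n (S' n))) \<ge> 1 / e * norm (max 0 (f (\<omega> n)))) at_top"
        using eventually_ge_at_top[of "2 * N + 2"]
      proof eventually_elim
        case (elim n)
        have "max 0 (f (\<omega> n)) \<le> e * real (tw n (S' n))" using bound[OF elim] e by simp
        then show ?case using e by (simp add: field_simps)
      qed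
    qed
  qed
qed

end
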